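(* There is a positive constant $a$, depending only on $\Omega$ and the tensors $\mathbb{C},\mathbb{H},\mathbb{L}_c$, such that for every solution $\{u,P\}$ of problem $(\mathcal{P})$ corresponding to data $\{f,M,0,0,0,0\}$ (that is, $u_0=\dot u_0=0$ and $P_0=\dot P_0=0$), one has, for all $t\in[0,T]$, $$\sqrt{a}\,\big(\|u_{,t}\|^2_{L^2(\Omega)}+\|P_{,t}\|^2_{L^2(\Omega)}+\|\nabla u\|^2_{L^2(\Omega)}+\|P\|^2_{L^2(\Omega)}+\|\mathrm{Curl}\,P\|^2_{L^2(\Omega)}\big)^{1/2}(t)\le\frac12\int_0^t g(s)\,ds,$$ where $g(s)=\Big\{\int_\Omega\big(\|f(s)\|^2+\|M(s)\|^2\big)dv\Big\}^{1/2}$.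
   Context: Setting. $\Omega\subset\mathbb{R}^3$ is a bounded domain with piecewise smooth boundary $\partial\Omega$ and outward unit normal $n$; $T>0$. On $\mathbb{R}^{3\times3}$: $\langle X,Y\rangle=\mathrm{tr}(XY^T)$, $\|X\|^2=\langle X,X\rangle$, $\mathrm{sym}\,X=\frac12(X+X^T)$; $\mathrm{Sym}(3)$ is the set of symmetric matrices. For a vector field $u$, $\nabla u$ is the matrix field whose $i$-th row is the gradient of $u_i$; for a matrix field, $\mathrm{Curl}$ and $\mathrm{Div}$ act row-wise (curl, resp. divergence, of each row). All derivatives are in the sense of distributions. $H^1_0(\Omega)$ is the closure of $C_0^\infty(\Omega)$ in $H^1(\Omega)$ (vector-valued); $H(\mathrm{Curl};\Omega)$ is the space of $L^2$ matrix fields $P$ with $\mathrm{Curl}\,P\in L^2(\Omega)$, and $H_0(\mathrm{Curl};\Omega)$ is the closure of $C_0^\infty(\Omega)$ in it for the norm $(\|P\|^2_{L^2(\Omega)}+\|\mathrm{Curl}\,P\|_{L^2(\Omega)}^2)^{1/2}$ (this encodes $P_i\times n=0$ on $\partial\Omega$ for the rows $P_i$). Coefficients. $\mathbb{C},\mathbb{H},\mathbb{L}_c$ are fourth order tensor fields of class $C^1(\Omega)$, acting by $(\mathbb{C}.X)_{ij}=\sum_{k,l}\mathbb{C}_{ijkl}X_{kl}$, with symmetries $\mathbb{C}_{ijrs}=\mathbb{C}_{rsij}=\mathbb{C}_{jirs}$, $\mathbb{H}_{ijrs}=\mathbb{H}_{rsij}=\mathbb{H}_{jirs}$, $(\mathbb{L}_c)_{ijrs}=(\mathbb{L}_c)_{rsij}$,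 and there are positive constants $c_m,c_M,h_m,h_M,(L_c)_m,(L_c)_M$ such that at every point of $\Omega$: $c_m\|X\|^2\le\langle\mathbb{C}.X,X\rangle\le c_M\|X\|^2$ and $h_m\|X\|^2\le\langle\mathbb{H}.X,X\rangle\le h_M\|X\|^2$ for all $X\in\mathrm{Sym}(3)$, and $(L_c)_m\|X\|^2\le\langle\mathbb{L}_c.X,X\rangle\le (L_c)_M\|X\|^2$ for all $X\in\mathbb{R}^{3\times3}$. Problem $(\mathcal{P})$. Find $u:\Omega\times[0,T]\to\mathbb{R}^3$, $P:\Omega\times[0,T]\to\mathbb{R}^{3\times3}$ with $u_{,tt}=\mathrm{Div}[\mathbb{C}.\,\mathrm{sym}(\nabla u-P)]+f$, $P_{,tt}=-\mathrm{Curl}[\mathbb{L}_c.\,\mathrm{Curl}\,P]+\mathbb{C}.\,\mathrm{sym}(\nabla u-P)-\mathbb{H}.\,\mathrm{sym}\,P+M$ in $\Omega\times[0,T]$; $u=0$ and $P_i\times n=0$ ($i=1,2,3$) on $\partial\Omega\times[0,T]$; $u(0)=u_0$, $u_{,t}(0)=\dot u_0$, $P(0)=P_0$, $P_{,t}(0)=\dot P_0$. Solution. Let $\mathcal{X}=H_0^1(\Omega)\times L^2(\Omega)\times H_0(\mathrm{Curl};\Omega)\times L^2(\Omega)$ (elements $w=(u,v,P,K)$), $\mathcal{A}w=(v,\ \mathrm{Div}[\mathbb{C}.\mathrm{sym}(\nabla u-P)],\ K,\ -\mathrm{Curl}[\mathbb{L}_c.\mathrm{Curl}\,P]+\mathbb{C}.\mathrm{sym}(\nabla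 u-P)-\mathbb{H}.\mathrm{sym}\,P)$, $\mathcal{D}(\mathcal{A})=\{w\in\mathcal{X}:\mathcal{A}w\in\mathcal{X}\}$. With $f,M\in L^1(0,T;L^2(\Omega))$, $\{u,P\}$ is a solution of $(\mathcal{P})$ if $w=(u,u_{,t},P,P_{,t})$ is continuous from $[0,T]$ to $\mathcal{X}$, continuously differentiable on $(0,T]$, $w(t)\in\mathcal{D}(\mathcal{A})$ and $w'(t)=\mathcal{A}w(t)+(0,f(t),0,M(t))$ for $t\in(0,T]$, and $w(0)=(u_0,\dot u_0,P_0,\dot P_0)$. *)

theory Defs
  imports "HOL-Analysis.Analysis"
begin

text \<open>
  Vector fields on three-space are functions \<open>real^3 \<Rightarrow> real^3\<close>, matrix fields are functions
  \<open>real^3 \<Rightarrow> real^3^3\<close>, with \<open>P x $ i\<close> the \<open>i\<close>-th row. On \<open>real^3^3\<close> the library inner product and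
  norm are \<open>tr (X Y\<^sup>T)\<close> and the Frobenius norm. Elements of Lebesgue and Sobolev spaces are
  represented by functions; the spaces and norms below are insensitive to changes on null sets.
\<close>

type_synonym vfield = "real^3 \<Rightarrow> real^3"
type_synonym mfield = "real^3 \<Rightarrow> real^3^3"
type_synonym tensor4 = "real^3^3^3^3"


section \<open>Smooth functions and domains with piecewise smooth boundary\<close>

text \<open>Class \<open>C\<^sup>k\<close> on an open set, by iterated partial derivatives.\<close>

primrec Ck_on :: "nat \<Rightarrow> ('a::euclidean_space \<Rightarrow> 'b::real_normed_vector) \<Rightarrow> 'a set \<Rightarrow> bool" where
  "Ck_on 0 f S \<longleftrightarrow> continuous_on S f"
| "Ck_on (Suc k) f S \<longleftrightarrow>
     (\<forall>x\<in>S. f differentiable (at x)) \<and>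
     (\<forall>b\<in>Basis. Ck_on k (\<lambda>x. frechet_derivative f (at x) b) S)"

definition smooth_on :: "('a::euclidean_space \<Rightarrow> 'b::real_normed_vector) \<Rightarrow> 'a set \<Rightarrow> bool" where
  "smooth_on f S \<longleftrightarrow> (\<forall>k. Ck_on k f S)"

text \<open>
  A piece of the boundary: a regular compact parameter region whose edge is a null set, with a
  Lipschitz injective parametrization that is a smooth immersion off the edge. Smoothness up to the
  edge is not required, so that for instance the lateral surface of a cone is admitted.
\<close>

definition surface_patch :: "(real^2 \<Rightarrow> real^3) \<Rightarrow> (real^2) set \<Rightarrow> bool" where
  "surface_patch \<phi> D \<longleftrightarrow>
     compact D \<and> D \<noteq> {} \<and> D = closure (interior D) \<and> negligible (frontier D) \<and>
     (\<exists>B. B-lipschitz_on D \<phi>) \<and> inj_on \<phi> D \<and>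
     smooth_on \<phi> (interior D) \<and> (\<forall>y\<in>interior D. inj (frechet_derivative \<phi> (at y)))"

definition outward_unit_normal ::
    "(real^3) set \<Rightarrow> (real^2 \<Rightarrow> real^3) \<Rightarrow> real^2 \<Rightarrow> real^3 \<Rightarrow> bool" where
  "outward_unit_normal \<Omega> \<phi> y n \<longleftrightarrow>
     norm n = 1 \<and> (\<forall>h. n \<bullet> frechet_derivative \<phi> (at y) h = 0) \<and>
     (\<exists>\<delta>>0. \<forall>s. 0 < s \<and> s < \<delta> \<longrightarrow> \<phi> y - s *\<^sub>R n \<in> \<Omega> \<and> \<phi> y + s *\<^sub>R n \<notin> closure \<Omega>)"

text \<open>
  The boundary is a finite union of patches meeting only along their edges, and off the edges the
  domain lies on one side of it.
\<close>

definition piecewise_smooth_boundary :: "(real^3) set \<Rightarrow> bool" where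
  "piecewise_smooth_boundary \<Omega> \<longleftrightarrow>
     (\<exists>(m::nat) \<phi> D.
        (\<forall>k<m. surface_patch (\<phi> k) (D k)) \<and>
        frontier \<Omega> = (\<Union>k<m. \<phi> k ` D k) \<and>
        (\<forall>j<m. \<forall>k<m. j \<noteq> k \<longrightarrow> \<phi> j ` interior (D j) \<inter> \<phi> k ` D k = {}) \<and>
        (\<forall>k<m. \<forall>y\<in>interior (D k). \<exists>n. outward_unit_normal \<Omega> (\<phi> k) y n))"

definition admissible_domain :: "(real^3) set \<Rightarrow> bool" where
  "admissible_domain \<Omega> \<longleftrightarrow>
     \<Omega> \<noteq> {} \<and> open \<Omega> \<and> connected \<Omega> \<and> bounded \<Omega> \<and> piecewise_smooth_boundary \<Omega>"


section \<open>Distributions\<close>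

definition test_functions :: "(real^3) set \<Rightarrow> (real^3 \<Rightarrow> 'b::real_normed_vector) set" where
  "test_functions \<Omega> =
     {\<phi>. smooth_on \<phi> UNIV \<and> compact (closure {x. \<phi> x \<noteq> 0}) \<and> closure {x. \<phi> x \<noteq> 0} \<subseteq> \<Omega>}"

text \<open>
  A distribution with values in \<open>'b\<close> is a functional on scalar test functions. Linearity and
  continuity are not part of the type; only derivatives of locally integrable fields occur below.
\<close>

type_synonym 'b distr = "(real^3 \<Rightarrow> real) \<Rightarrow> 'b"

definition distr_of ::
    "(real^3) set \<Rightarrow> (real^3 \<Rightarrow> 'b::{banach,second_countable_topology}) \<Rightarrow> 'b distr" where
  "distr_of \<Omega> F = (\<lambda>\<phi>. LINT x|lebesgue_on \<Omega>. \<phi> x *\<^sub>R F x)"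

definition distr_eq :: "(real^3) set \<Rightarrow> 'b distr \<Rightarrow> 'b distr \<Rightarrow> bool" where
  "distr_eq \<Omega> D E \<longleftrightarrow> (\<forall>\<phi>\<in>test_functions \<Omega>. D \<phi> = E \<phi>)"

definition distr_deriv :: "3 \<Rightarrow> 'b::real_normed_vector distr \<Rightarrow> 'b distr" where
  "distr_deriv j D = (\<lambda>\<phi>. - D (\<lambda>x. frechet_derivative \<phi> (at x) (axis j 1)))"

definition grad_distr :: "(real^3) distr \<Rightarrow> (real^3^3) distr" where
  "grad_distr D = (\<lambda>\<phi>. \<chi> i j. distr_deriv j D \<phi> $ i)"

definition div_distr :: "(real^3^3) distr \<Rightarrow> (real^3) distr" where
  "div_distr D = (\<lambda>\<phi>. \<chi> i. \<Sum>j\<in>UNIV. distr_deriv j D \<phi> $ i $ j)"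

definition curl_distr :: "(real^3^3) distr \<Rightarrow> (real^3^3) distr" where
  "curl_distr D = (\<lambda>\<phi>. \<chi> i. vector
     [distr_deriv 2 D \<phi> $ i $ 3 - distr_deriv 3 D \<phi> $ i $ 2,
      distr_deriv 3 D \<phi> $ i $ 1 - distr_deriv 1 D \<phi> $ i $ 3,
      distr_deriv 1 D \<phi> $ i $ 2 - distr_deriv 2 D \<phi> $ i $ 1])"


section \<open>Function spaces\<close>

definition L2 :: "(real^3) set \<Rightarrow> (real^3 \<Rightarrow> 'b::euclidean_space) set" where
  "L2 \<Omega> = {F. F \<in> borel_measurable (lebesgue_on \<Omega>) \<and>
               integrable (lebesgue_on \<Omega>) (\<lambda>x. (norm (F x))\<^sup>2)}"

text \<open>The integral in \<open>L2_norm\<close> is a junk value outside \<open>L2 \<Omega>\<close>; all uses below are guarded by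
  membership in \<open>L2 \<Omega>\<close>.\<close>

definition L2_norm :: "(real^3) set \<Rightarrow> (real^3 \<Rightarrow> 'b::euclidean_space) \<Rightarrow> real" where
  "L2_norm \<Omega> F = sqrt (LINT x|lebesgue_on \<Omega>. (norm (F x))\<^sup>2)"

definition H1 :: "(real^3) set \<Rightarrow> vfield set" where
  "H1 \<Omega> = {u \<in> L2 \<Omega>. \<exists>G\<in>L2 \<Omega>. distr_eq \<Omega> (grad_distr (distr_of \<Omega> u)) (distr_of \<Omega> G)}"

text \<open>A representative of the gradient; it is determined up to a null set for \<open>u \<in> H1 \<Omega>\<close>.\<close>

definition Grad :: "(real^3) set \<Rightarrow> vfield \<Rightarrow> mfield" where
  "Grad \<Omega> u = (SOME G. G \<in> L2 \<Omega> \<and> distr_eq \<Omega> (grad_distr (distr_of \<Omega> u)) (distr_of \<Omega> G))"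

definition H1_norm :: "(real^3) set \<Rightarrow> vfield \<Rightarrow> real" where
  "H1_norm \<Omega> u = sqrt ((L2_norm \<Omega> u)\<^sup>2 + (L2_norm \<Omega> (Grad \<Omega> u))\<^sup>2)"

definition H1_0 :: "(real^3) set \<Rightarrow> vfield set" where
  "H1_0 \<Omega> = {u \<in> H1 \<Omega>. \<forall>\<epsilon>>0. \<exists>\<phi>\<in>test_functions \<Omega>. H1_norm \<Omega> (\<lambda>x. u x - \<phi> x) < \<epsilon>}"

definition HCurl :: "(real^3) set \<Rightarrow> mfield set" where
  "HCurl \<Omega> = {P \<in> L2 \<Omega>. \<exists>Q\<in>L2 \<Omega>. distr_eq \<Omega> (curl_distr (distr_of \<Omega> P)) (distr_of \<Omega> Q)}"

definition Curl :: "(real^3) set \<Rightarrow> mfield \<Rightarrow> mfield" where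
  "Curl \<Omega> P = (SOME Q. Q \<in> L2 \<Omega> \<and> distr_eq \<Omega> (curl_distr (distr_of \<Omega> P)) (distr_of \<Omega> Q))"

definition HCurl_norm :: "(real^3) set \<Rightarrow> mfield \<Rightarrow> real" where
  "HCurl_norm \<Omega> P = sqrt ((L2_norm \<Omega> P)\<^sup>2 + (L2_norm \<Omega> (Curl \<Omega> P))\<^sup>2)"

definition HCurl_0 :: "(real^3) set \<Rightarrow> mfield set" where
  "HCurl_0 \<Omega> = {P \<in> HCurl \<Omega>. \<forall>\<epsilon>>0. \<exists>\<Phi>\<in>test_functions \<Omega>. HCurl_norm \<Omega> (\<lambda>x. P x - \<Phi> x) < \<epsilon>}"

text \<open>The Bochner space \<open>L\<^sup>1(0,T; L\<^sup>2(\<Omega>))\<close>: a.e. limits of simple functions, with integrable norm.\<close>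

definition simple_L2_valued ::
    "real \<Rightarrow> (real^3) set \<Rightarrow> (real \<Rightarrow> real^3 \<Rightarrow> 'b::euclidean_space) \<Rightarrow> bool" where
  "simple_L2_valued T \<Omega> s \<longleftrightarrow>
     finite (s ` {0..T}) \<and> s ` {0..T} \<subseteq> L2 \<Omega> \<and> (\<forall>F. {t \<in> {0..T}. s t = F} \<in> sets lebesgue)"

definition L1_L2 :: "real \<Rightarrow> (real^3) set \<Rightarrow> (real \<Rightarrow> real^3 \<Rightarrow> 'b::euclidean_space) set" where
  "L1_L2 T \<Omega> = {F.
     (AE t in lebesgue_on {0..T}. F t \<in> L2 \<Omega>) \<and>
     (\<exists>s. (\<forall>n. simple_L2_valued T \<Omega> (s n)) \<and>
          (AE t in lebesgue_on {0..T}.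
             (\<lambda>n. L2_norm \<Omega> (\<lambda>x. s n t x - F t x)) \<longlonglongrightarrow> 0)) \<and>
     integrable (lebesgue_on {0..T}) (\<lambda>t. L2_norm \<Omega> (F t))}"


section \<open>Coefficients\<close>

definition tensor_app :: "tensor4 \<Rightarrow> real^3^3 \<Rightarrow> real^3^3" where
  "tensor_app A X = (\<chi> i j. \<Sum>k\<in>UNIV. \<Sum>l\<in>UNIV. A $ i $ j $ k $ l * X $ k $ l)"

definition sym_part :: "real^3^3 \<Rightarrow> real^3^3" where
  "sym_part X = (1/2) *\<^sub>R (X + transpose X)"

definition Sym3 :: "(real^3^3) set" where
  "Sym3 = {X. transpose X = X}"

definition major_symmetric :: "tensor4 \<Rightarrow> bool" where
  "major_symmetric A \<longleftrightarrow> (\<forall>i j r s. A $ i $ j $ r $ s = A $ r $ s $ i $ j)"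

definition minor_symmetric :: "tensor4 \<Rightarrow> bool" where
  "minor_symmetric A \<longleftrightarrow> (\<forall>i j r s. A $ i $ j $ r $ s = A $ j $ i $ r $ s)"

definition uniformly_definite_on :: "(real^3) set \<Rightarrow> (real^3^3) set \<Rightarrow> (real^3 \<Rightarrow> tensor4) \<Rightarrow> bool"
  where
  "uniformly_definite_on \<Omega> V A \<longleftrightarrow>
     (\<exists>m>0. \<exists>M>0. \<forall>x\<in>\<Omega>. \<forall>X\<in>V.
        m * (norm X)\<^sup>2 \<le> tensor_app (A x) X \<bullet> X \<and> tensor_app (A x) X \<bullet> X \<le> M * (norm X)\<^sup>2)"

definition admissible_coefficients ::
    "(real^3) set \<Rightarrow> (real^3 \<Rightarrow> tensor4) \<Rightarrow> (real^3 \<Rightarrow> tensor4) \<Rightarrow> (real^3 \<Rightarrow> tensor4) \<Rightarrow> bool" where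
  "admissible_coefficients \<Omega> \<C> \<H> \<L> \<longleftrightarrow>
     Ck_on 1 \<C> \<Omega> \<and> Ck_on 1 \<H> \<Omega> \<and> Ck_on 1 \<L> \<Omega> \<and>
     (\<forall>x\<in>\<Omega>. major_symmetric (\<C> x) \<and> minor_symmetric (\<C> x)) \<and>
     (\<forall>x\<in>\<Omega>. major_symmetric (\<H> x) \<and> minor_symmetric (\<H> x)) \<and>
     (\<forall>x\<in>\<Omega>. major_symmetric (\<L> x)) \<and>
     uniformly_definite_on \<Omega> Sym3 \<C> \<and>
     uniformly_definite_on \<Omega> Sym3 \<H> \<and>
     uniformly_definite_on \<Omega> UNIV \<L>"


section \<open>The evolution problem\<close>

text \<open>States are quadruples \<open>(u, v, P, K)\<close>.\<close>

type_synonym state = "vfield \<times> vfield \<times> mfield \<times> mfield"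

definition state_add :: "state \<Rightarrow> state \<Rightarrow> state" where
  "state_add = (\<lambda>(u, v, P, K) (u', v', P', K').
     (\<lambda>x. u x + u' x, \<lambda>x. v x + v' x, \<lambda>x. P x + P' x, \<lambda>x. K x + K' x))"

definition state_scale :: "real \<Rightarrow> state \<Rightarrow> state" where
  "state_scale c = (\<lambda>(u, v, P, K).
     (\<lambda>x. c *\<^sub>R u x, \<lambda>x. c *\<^sub>R v x, \<lambda>x. c *\<^sub>R P x, \<lambda>x. c *\<^sub>R K x))"

definition state_diff :: "state \<Rightarrow> state \<Rightarrow> state" where
  "state_diff w z = state_add w (state_scale (-1) z)"

definition X_space :: "(real^3) set \<Rightarrow> state set" where
  "X_space \<Omega> = H1_0 \<Omega> \<times> L2 \<Omega> \<times> HCurl_0 \<Omega> \<times> L2 \<Omega>"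

definition X_norm :: "(real^3) set \<Rightarrow> state \<Rightarrow> real" where
  "X_norm \<Omega> = (\<lambda>(u, v, P, K).
     sqrt ((H1_norm \<Omega> u)\<^sup>2 + (L2_norm \<Omega> v)\<^sup>2 + (HCurl_norm \<Omega> P)\<^sup>2 + (L2_norm \<Omega> K)\<^sup>2))"

definition X_continuous_on :: "(real^3) set \<Rightarrow> real set \<Rightarrow> (real \<Rightarrow> state) \<Rightarrow> bool" where
  "X_continuous_on \<Omega> I w \<longleftrightarrow>
     (\<forall>t\<in>I. w t \<in> X_space \<Omega>) \<and>
     (\<forall>t\<in>I. ((\<lambda>s. X_norm \<Omega> (state_diff (w s) (w t))) \<longlongrightarrow> 0) (at t within I))"

definition X_has_derivative_within ::
    "(real^3) set \<Rightarrow> real set \<Rightarrow> (real \<Rightarrow> state) \<Rightarrow> state \<Rightarrow> real \<Rightarrow> bool" where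
  "X_has_derivative_within \<Omega> I w d t \<longleftrightarrow>
     d \<in> X_space \<Omega> \<and>
     ((\<lambda>s. X_norm \<Omega> (state_diff (state_scale (1 / (s - t)) (state_diff (w s) (w t))) d)) \<longlongrightarrow> 0)
       (at t within I)"

text \<open>\<open>z\<close> represents \<open>\<A> w\<close>, the second and fourth components of which are distributions.\<close>

definition represents_A ::
    "(real^3) set \<Rightarrow> (real^3 \<Rightarrow> tensor4) \<Rightarrow> (real^3 \<Rightarrow> tensor4) \<Rightarrow> (real^3 \<Rightarrow> tensor4) \<Rightarrow>
     state \<Rightarrow> state \<Rightarrow> bool" where
  "represents_A \<Omega> \<C> \<H> \<L> = (\<lambda>(u, v, P, K) (z1, z2, z3, z4).
     z1 = v \<and>
     distr_eq \<Omega>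
       (div_distr (distr_of \<Omega> (\<lambda>x. tensor_app (\<C> x) (sym_part (Grad \<Omega> u x - P x)))))
       (distr_of \<Omega> z2) \<and>
     z3 = K \<and>
     distr_eq \<Omega>
       (\<lambda>\<phi>. - curl_distr (distr_of \<Omega> (\<lambda>x. tensor_app (\<L> x) (Curl \<Omega> P x))) \<phi>
             + distr_of \<Omega> (\<lambda>x. tensor_app (\<C> x) (sym_part (Grad \<Omega> u x - P x))) \<phi>
             - distr_of \<Omega> (\<lambda>x. tensor_app (\<H> x) (sym_part (P x))) \<phi>)
       (distr_of \<Omega> z4))"

definition dom_A ::
    "(real^3) set \<Rightarrow> (real^3 \<Rightarrow> tensor4) \<Rightarrow> (real^3 \<Rightarrow> tensor4) \<Rightarrow> (real^3 \<Rightarrow> tensor4) \<Rightarrow>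
     state set" where
  "dom_A \<Omega> \<C> \<H> \<L> = {w \<in> X_space \<Omega>. \<exists>z\<in>X_space \<Omega>. represents_A \<Omega> \<C> \<H> \<L> w z}"

definition op_A ::
    "(real^3) set \<Rightarrow> (real^3 \<Rightarrow> tensor4) \<Rightarrow> (real^3 \<Rightarrow> tensor4) \<Rightarrow> (real^3 \<Rightarrow> tensor4) \<Rightarrow>
     state \<Rightarrow> state" where
  "op_A \<Omega> \<C> \<H> \<L> w = (SOME z. z \<in> X_space \<Omega> \<and> represents_A \<Omega> \<C> \<H> \<L> w z)"

definition L2_time_derivative_on ::
    "(real^3) set \<Rightarrow> real set \<Rightarrow> (real \<Rightarrow> real^3 \<Rightarrow> 'b::euclidean_space) \<Rightarrow>
     (real \<Rightarrow> real^3 \<Rightarrow> 'b) \<Rightarrow> bool" where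
  "L2_time_derivative_on \<Omega> I u u' \<longleftrightarrow>
     (\<forall>t\<in>I. ((\<lambda>s. L2_norm \<Omega> (\<lambda>x. (1 / (s - t)) *\<^sub>R (u s x - u t x) - u' t x)) \<longlongrightarrow> 0)
               (at t within I))"

text \<open>
  \<open>{u, P}\<close> solves the problem with data \<open>{f, M, u0, v0, P0, K0}\<close>, where \<open>ut\<close> and \<open>Pt\<close> are the time
  derivatives of \<open>u\<close> and \<open>P\<close>. Derivatives at \<open>t = T\<close> are one-sided, and initial values are
  attained almost everywhere.
\<close>

definition is_solution ::
    "(real^3) set \<Rightarrow> (real^3 \<Rightarrow> tensor4) \<Rightarrow> (real^3 \<Rightarrow> tensor4) \<Rightarrow> (real^3 \<Rightarrow> tensor4) \<Rightarrow>
     real \<Rightarrow> (real \<Rightarrow> vfield) \<Rightarrow> (real \<Rightarrow> mfield) \<Rightarrow> vfield \<Rightarrow> vfield \<Rightarrow> mfield \<Rightarrow> mfield \<Rightarrow>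
     (real \<Rightarrow> vfield) \<Rightarrow> (real \<Rightarrow> vfield) \<Rightarrow> (real \<Rightarrow> mfield) \<Rightarrow> (real \<Rightarrow> mfield) \<Rightarrow> bool" where
  "is_solution \<Omega> \<C> \<H> \<L> T f M u0 v0 P0 K0 u ut P Pt \<longleftrightarrow>
     (let w = (\<lambda>t. (u t, ut t, P t, Pt t));
          w' = (\<lambda>t. state_add (op_A \<Omega> \<C> \<H> \<L> (w t)) (\<lambda>x. 0, f t, \<lambda>x. 0, M t))
      in L2_time_derivative_on \<Omega> {0..T} u ut \<and>
         L2_time_derivative_on \<Omega> {0..T} P Pt \<and>
         X_continuous_on \<Omega> {0..T} w \<and>
         (\<forall>t\<in>{0<..T}. w t \<in> dom_A \<Omega> \<C> \<H> \<L> \<and> X_has_derivative_within \<Omega> {0..T} w (w' t) t) \<and>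
         X_continuous_on \<Omega> {0<..T} w' \<and>
         (AE x in lebesgue_on \<Omega>. u 0 x = u0 x \<and> ut 0 x = v0 x \<and> P 0 x = P0 x \<and> Pt 0 x = K0 x))"

end

theory Submission
  imports Defs
begin

text \<open>
  Consider, along a solution, the quantity
  \<open>E = \<parallel>u\<^sub>t\<parallel>\<^sup>2 + \<parallel>P\<^sub>t\<parallel>\<^sup>2 + \<langle>\<C>. sym (\<nabla>u - P), sym (\<nabla>u - P)\<rangle> + \<langle>\<H>. sym P, sym P\<rangle> + \<langle>\<L>. Curl P, Curl P\<rangle>\<close>,
  twice the energy. The generator of the evolution preserves it: on fields with the boundary conditions of the problem
  the divergence is minus the adjoint of the gradient and the row-wise curl is its own adjoint
  (\<open>generator_conserves_energy\<close>). Hence \<open>E' = 2 (\<langle>f, u\<^sub>t\<rangle> + \<langle>M, P\<^sub>t\<rangle>) \<le> 2 g \<surd>E\<close>, and since \<open>E\<close> starts from zero,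
  \<open>\<surd>E\<close> is at most the integral of \<open>g\<close> (\<open>energy_has_derivative\<close>, \<open>sqrt_growth\<close>).

  It remains to see that \<open>E\<close> dominates the squared norm in the theorem (\<open>energy_coercive\<close>). The energy sees \<open>P\<close> only
  through \<open>sym P\<close> and \<open>Curl P\<close>, so the point is Korn's inequality for incompatible fields,
  \<open>\<parallel>P\<parallel> \<le> c (\<parallel>sym P\<parallel> + \<parallel>Curl P\<parallel>)\<close> on \<open>H\<^sub>0(Curl)\<close>. As elements of this space are limits of test fields, it suffices to
  treat a test field. Pointwise, \<open>\<bar>P\<bar>\<^sup>2 + (tr P)\<^sup>2\<close> equals \<open>2 \<bar>sym P\<bar>\<^sup>2\<close> plus twice the sum of the three principal two by two
  minors of \<open>P\<close>. The minors of a gradient integrate to zero. For a general field, shift one row of the minor along a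
  coordinate axis: once the shift exceeds the diameter the integral is zero, and its derivative with respect to the
  shift involves, after an integration by parts, only entries of \<open>Curl P\<close>. So the integral of a minor is at most a
  multiple of \<open>\<parallel>P\<parallel> \<parallel>Curl P\<parallel>\<close> (\<open>minor_integral_bound\<close>, \<open>Korn_curl_test\<close>). The case of gradients gives the classical
  inequality \<open>\<parallel>\<nabla>u\<parallel> \<le> 2 \<parallel>sym \<nabla>u\<parallel>\<close> on \<open>H\<^sup>1\<^sub>0\<close>.

  The gradient and the curl of a field in a Sobolev space are chosen representatives. That they depend linearly on the
  field, almost everywhere, rests on the uniqueness of weak derivatives, that is, on the supply of test functions that
  approximate indicators of boxes (\<open>box_bump_tendsto\<close>, \<open>fundamental_lemma\<close>).
\<close>

section \<open>Smooth bump functions\<close>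

lemma smooth_on_differentiable: "smooth_on f S \<Longrightarrow> x \<in> S \<Longrightarrow> f differentiable (at x)"
  unfolding smooth_on_def by (drule spec[of _ "Suc 0"]) simp

lemma smooth_on_continuous: "smooth_on f S \<Longrightarrow> continuous_on S f"
  unfolding smooth_on_def by (drule spec[of _ 0]) simp

lemma smooth_on_partial:
  "smooth_on f S \<Longrightarrow> b \<in> Basis \<Longrightarrow> smooth_on (\<lambda>x. frechet_derivative f (at x) b) S"
  unfolding smooth_on_def
proof
  fix k assume "\<forall>k. Ck_on k f S" and b: "b \<in> Basis"
  then have "Ck_on (Suc k) f S" by blast
  then show "Ck_on k (\<lambda>x. frechet_derivative f (at x) b) S" using b by simp
qed

lemma frechet_derivative_has_derivative:
  "(f has_derivative f') (at x) \<Longrightarrow> frechet_derivative f (at x) = f'"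
  by (metis frechet_derivative_at)

lemma Ck_on_bounded_linear:
  assumes "bounded_linear L" "Ck_on k f UNIV"
  shows "Ck_on k (\<lambda>x. L (f x)) UNIV"
  using assms(2)
proof (induction k arbitrary: f)
  case 0
  then show ?case using assms(1) by (auto intro: bounded_linear.continuous_on)
next
  case (Suc k)
  have d: "((\<lambda>x. L (f x)) has_derivative (\<lambda>h. L (frechet_derivative f (at x) h))) (at x)" for x
    by (rule bounded_linear.has_derivative[OF assms(1)])
       (use Suc.prems frechet_derivative_works in auto)
  have "Ck_on k (\<lambda>x. L (frechet_derivative f (at x) b)) UNIV" if "b \<in> Basis" for b
    using Suc.IH[of "\<lambda>x. frechet_derivative f (at x) b"] Suc.prems that by auto
  moreover have "(\<lambda>x. L (f x)) differentiable at x" for x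
    using d unfolding differentiable_def by blast
  ultimately show ?case by (simp add: frechet_derivative_has_derivative[OF d])
qed

lemma smooth_on_bounded_linear:
  "bounded_linear L \<Longrightarrow> smooth_on f UNIV \<Longrightarrow> smooth_on (\<lambda>x. L (f x)) UNIV"
  by (simp add: smooth_on_def Ck_on_bounded_linear)

text \<open>
  Smoothness quantifies over all orders of differentiation. A class of functions that is closed under partial
  derivatives replaces the induction over the order by a single closure step.
\<close>

lemma smooth_on_coinduct:
  fixes \<F> :: "('a::euclidean_space \<Rightarrow> 'b::real_normed_vector) set"
  assumes "f \<in> \<F>"
    and step: "\<And>f b. f \<in> \<F> \<Longrightarrow> b \<in> Basis \<Longrightarrow>
      \<exists>f'. (\<forall>x. (f has_derivative f' x) (at x)) \<and> (\<lambda>x. f' x b) \<in> \<F>"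
  shows "smooth_on f UNIV"
proof -
  obtain b0 :: 'a where b0: "b0 \<in> Basis" using nonempty_Basis by blast
  have "Ck_on k f UNIV" if "f \<in> \<F>" for k f
    using that
  proof (induction k arbitrary: f)
    case 0
    obtain f' where "\<forall>x. (f has_derivative f' x) (at x)" using step[OF 0 b0] by blast
    then show ?case
      using has_derivative_continuous by (simp add: continuous_on_eq_continuous_at) blast
  next
    case (Suc k)
    have "Ck_on k (\<lambda>x. frechet_derivative f (at x) b) UNIV" if b: "b \<in> Basis" for b
    proof -
      obtain f' where f': "\<forall>x. (f has_derivative f' x) (at x)" "(\<lambda>x. f' x b) \<in> \<F>"
        using step[OF Suc.prems b] by blast
      have "(\<lambda>x. frechet_derivative f (at x) b) = (\<lambda>x. f' x b)"
        by (simp add: frechet_derivative_has_derivative[OF f'(1)[rule_format]])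
      then show ?thesis using Suc.IH[OF f'(2)] by simp
    qed
    moreover have "f differentiable (at x)" for x
      using step[OF Suc.prems b0] unfolding differentiable_def by blast
    ultimately show ?case by simp
  qed
  then show ?thesis using assms(1) by (simp add: smooth_on_def)
qed

text \<open>
  The function \<open>exp (- 1 / x)\<close> extended by zero, together with its multiples by powers of \<open>1 / x\<close>: the
  derivative of each member is a linear combination of later members.
\<close>

definition flat :: "nat \<Rightarrow> real \<Rightarrow> real" where
  "flat m x = (if x > 0 then inverse x ^ m * exp (- inverse x) else 0)"

text \<open>
  The term of index \<open>m + 2\<close> of the exponential series at \<open>1 / x\<close> already dominates. Two powers of \<open>x\<close> are
  left over, which is what makes the derivative at the origin vanish.
\<close>

lemma flat_le: "flat m x \<le> fact (m + 2) * x\<^sup>2"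
proof (cases "x > 0")
  case True
  define y where "y = inverse x"
  have y: "y > 0" "y * x = 1" using True by (auto simp: y_def)
  have "(\<Sum>n\<in>{m+2}. y ^ n /\<^sub>R fact n) \<le> exp y"
    unfolding exp_def using y
    by (intro sum_le_suminf summable_exp_generic) auto
  then have "y ^ (m + 2) \<le> exp y * fact (m + 2)"
    by (simp add: divide_le_eq flip: divide_inverse_commute del: fact_Suc power_Suc)
  then have "y ^ (m + 2) * (exp (- y) * x\<^sup>2) \<le> exp y * fact (m + 2) * (exp (- y) * x\<^sup>2)"
    by (rule mult_right_mono) simp
  moreover have "y ^ (m + 2) * (exp (- y) * x\<^sup>2) = y ^ m * exp (- y) * (y * x)\<^sup>2"
    by (simp only: power_add power_mult_distrib mult_ac)
  moreover have "exp y * fact (m + 2) * (exp (- y) * x\<^sup>2) = (exp y * exp (- y)) * (fact (m + 2) * x\<^sup>2)"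
    by (simp only: mult_ac)
  ultimately have "y ^ m * exp (- y) \<le> fact (m + 2) * x\<^sup>2"
    using y(2) by (simp del: fact_Suc add_2_eq_Suc' flip: exp_add)
  then show ?thesis using True by (simp add: flat_def y_def)
qed (simp add: flat_def)

lemma flat_nonneg: "0 \<le> flat m x"
  by (simp add: flat_def)

lemma flat_nonzero_iff: "flat m x \<noteq> 0 \<longleftrightarrow> x > 0"
  by (simp add: flat_def)

lemma flat_deriv: "(flat m has_real_derivative flat (m + 2) x - real m * flat (m + 1) x) (at x)"
proof -
  consider "x > 0" | "x < 0" | "x = 0" by linarith
  then show ?thesis
  proof cases
    case 1
    have p: "((\<lambda>x. inverse x ^ m) has_real_derivative real m * inverse x ^ (m - 1) * - (inverse x ^ 2)) (at x)"
      using DERIV_power[OF DERIV_inverse, of x m UNIV] 1 by (simp add: numeral_2_eq_2 mult_ac)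
    have "real m * inverse x ^ (m - 1) * inverse x ^ 2 = real m * inverse x ^ (m + 1)"
      by (cases m) (simp_all add: power2_eq_square)
    then have "((\<lambda>x. inverse x ^ m * exp (- inverse x)) has_real_derivative
        flat (m + 2) x - real m * flat (m + 1) x) (at x)"
      using 1 by (auto intro!: derivative_eq_intros p simp: flat_def power_add power2_eq_square algebra_simps)
    moreover have ev: "eventually (\<lambda>y. inverse y ^ m * exp (- inverse y) = flat m y) (nhds x)"
      using eventually_nhds_in_open[of "{0<..}" x] 1
      by (auto simp: flat_def elim!: eventually_mono)
    ultimately show ?thesis
      using DERIV_cong_ev[OF refl ev refl] by simp
  next
    case 2
    have "((\<lambda>x. 0::real) has_real_derivative 0) (at x)" by simp
    moreover have ev: "eventually (\<lambda>y. 0 = flat m y) (nhds x)"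
      using eventually_nhds_in_open[of "{..<0}" x] 2
      by (auto simp: flat_def elim!: eventually_mono)
    ultimately have "(flat m has_real_derivative 0) (at x)"
      using DERIV_cong_ev[OF refl ev refl] by simp
    then show ?thesis using 2 by (simp add: flat_def)
  next
    case 3
    have "((\<lambda>h. flat m h / h) \<longlongrightarrow> 0) (at 0)"
    proof (rule Lim_null_comparison)
      show "\<forall>\<^sub>F h in at 0. norm (flat m h / h) \<le> fact (m + 2) * \<bar>h\<bar>"
      proof (rule eventually_at_filter[THEN iffD2], rule always_eventually, safe)
        fix h :: real assume "h \<noteq> 0"
        then show "norm (flat m h / h) \<le> fact (m + 2) * \<bar>h\<bar>"
          using flat_le[of m h] flat_nonneg[of m h]
          by (simp add: divide_le_eq power2_eq_square mult.assoc abs_mult_self_eq)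
      qed
      show "((\<lambda>h. fact (m + 2) * \<bar>h\<bar>) \<longlongrightarrow> 0) (at (0::real))"
        by (auto intro!: tendsto_eq_intros)
    qed
    then have "(flat m has_real_derivative 0) (at 0)"
      by (simp add: DERIV_def flat_def)
    then show ?thesis using 3 by (simp add: flat_def)
  qed
qed

text \<open>
  This algebra is closed under partial derivatives, so all its members are smooth; it is generated by just
  enough functions to contain the bumps below.
\<close>

inductive_set flat_algebra :: "(real^3 \<Rightarrow> real) set" where
  const: "(\<lambda>x. c) \<in> flat_algebra"
| flat: "(\<lambda>x. flat m (c * x $ i + d)) \<in> flat_algebra"
| add: "f \<in> flat_algebra \<Longrightarrow> g \<in> flat_algebra \<Longrightarrow> (\<lambda>x. f x + g x) \<in> flat_algebra"
| mult: "f \<in> flat_algebra \<Longrightarrow> g \<in> flat_algebra \<Longrightarrow> (\<lambda>x. f x * g x) \<in> flat_algebra"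

lemma flat_algebra_smooth:
  assumes "f \<in> flat_algebra" shows "smooth_on f UNIV"
  using assms
proof (rule smooth_on_coinduct)
  fix f and b :: "real^3" assume "f \<in> flat_algebra"
  then show "\<exists>f'. (\<forall>x. (f has_derivative f' x) (at x)) \<and> (\<lambda>x. f' x b) \<in> flat_algebra"
  proof induction
    case (const c)
    show ?case by (rule exI[of _ "\<lambda>x h. 0"]) (auto intro: flat_algebra.intros)
  next
    case (flat m c i d)
    let ?g = "\<lambda>x. flat (m + 2) (c * x $ i + d) - real m * flat (m + 1) (c * x $ i + d)"
    have "((\<lambda>x. flat m (c * x $ i + d)) has_derivative (\<lambda>h. ?g x * (c * h $ i))) (at x)" for x :: "real^3"
      by (rule has_derivative_compose[of "\<lambda>x. c * x $ i + d" _ _ _ "flat m",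
            OF _ flat_deriv[unfolded has_field_derivative_def]])
         (auto intro!: derivative_eq_intros bounded_linear_imp_has_derivative bounded_linear_vec_nth)
    moreover have "(\<lambda>x. (flat (m + 2) (c * x $ i + d) + (- real m) * flat (m + 1) (c * x $ i + d)) * (c * b $ i)) \<in> flat_algebra"
      by (intro flat_algebra.intros)
    ultimately show ?case
      by (intro exI[of _ "\<lambda>x h. ?g x * (c * h $ i)"]) simp
  next
    case (add f g)
    then obtain f' g' where "\<forall>x. (f has_derivative f' x) (at x)" "(\<lambda>x. f' x b) \<in> flat_algebra"
      "\<forall>x. (g has_derivative g' x) (at x)" "(\<lambda>x. g' x b) \<in> flat_algebra" by blast
    then show ?case
      by (intro exI[of _ "\<lambda>x h. f' x h + g' x h"])
         (auto intro!: flat_algebra.intros has_derivative_add)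
  next
    case (mult f g)
    then obtain f' g' where "\<forall>x. (f has_derivative f' x) (at x)" "(\<lambda>x. f' x b) \<in> flat_algebra"
      "\<forall>x. (g has_derivative g' x) (at x)" "(\<lambda>x. g' x b) \<in> flat_algebra" by blast
    then show ?case using mult.hyps
      by (intro exI[of _ "\<lambda>x h. f x * g' x h + f' x h * g x"])
         (auto intro!: flat_algebra.intros has_derivative_mult)
  qed
qed

text \<open>
  As \<open>n\<close> grows these bumps tend to the indicator of the box. The offset \<open>- 1\<close> keeps their supports at distance
  \<open>1 / n\<close> from the boundary, so that the closed support stays in the open box.
\<close>

definition box_bump :: "real^3 \<Rightarrow> real^3 \<Rightarrow> nat \<Rightarrow> real^3 \<Rightarrow> real" where
  "box_bump a b n x =
     (\<Prod>i\<in>UNIV. flat 0 (real n * x $ i + (- real n * a $ i - 1)) * flat 0 ((- real n) * x $ i + (real n * b $ i - 1)))"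

lemma box_bump_smooth: "smooth_on (box_bump a b n) UNIV"
proof (rule flat_algebra_smooth)
  have "(\<lambda>x. \<Prod>i\<in>S. flat 0 (real n * x $ i + (- real n * a $ i - 1))
      * flat 0 ((- real n) * x $ i + (real n * b $ i - 1))) \<in> flat_algebra" if "finite S" for S
    using that
  proof (induction S)
    case empty
    show ?case by (simp add: flat_algebra.const)
  next
    case (insert i S)
    show ?case unfolding prod.insert[OF insert.hyps]
      by (intro flat_algebra.mult flat_algebra.flat insert.IH)
  qed
  from this[OF finite] show "box_bump a b n \<in> flat_algebra"
    unfolding box_bump_def[abs_def] .
qed

lemma flat_0_le_1: "flat 0 x \<le> 1"
  by (simp add: flat_def)

lemma box_bump_bounds: "0 \<le> box_bump a b n x" "box_bump a b n x \<le> 1"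
  unfolding box_bump_def
  by (rule prod_nonneg, simp add: flat_nonneg)
     (rule prod_le_1, simp add: flat_nonneg flat_0_le_1 mult_le_one)

lemma box_bump_nonzeroD:
  assumes "box_bump a b n x \<noteq> 0" "n > 0"
  shows "x \<in> cbox (a + (\<chi> i. 1 / n)) (b - (\<chi> i. 1 / n))"
proof -
  have "flat 0 (real n * x $ i + (- real n * a $ i - 1)) \<noteq> 0"
       "flat 0 ((- real n) * x $ i + (real n * b $ i - 1)) \<noteq> 0" for i
    using assms(1) by (auto simp: box_bump_def prod_zero_iff)
  then have "real n * x $ i + (- real n * a $ i - 1) > 0" "(- real n) * x $ i + (real n * b $ i - 1) > 0" for i
    by (simp_all add: flat_nonzero_iff)
  then show ?thesis using assms(2)
    by (auto simp: mem_box_cart field_simps less_imp_le)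
qed

lemma box_bump_test_function:
  assumes "box a b \<subseteq> \<Omega>" "n > 0"
  shows "box_bump a b n \<in> test_functions \<Omega>"
proof -
  let ?C = "cbox (a + (\<chi> i. 1 / n)) (b - (\<chi> i. 1 / n))"
  have "closure {x. box_bump a b n x \<noteq> 0} \<subseteq> ?C"
    by (rule closure_minimal) (use box_bump_nonzeroD assms(2) in auto)
  moreover have "?C \<subseteq> box a b"
  proof
    fix x assume "x \<in> ?C"
    then have "a $ i + 1 / n \<le> x $ i" "x $ i \<le> b $ i - 1 / n" for i
      by (auto simp: mem_box_cart)
    moreover have "1 / real n > 0" using assms(2) by simp
    ultimately show "x \<in> box a b"
      unfolding mem_box_cart by (smt (verit, best))
  qed
  moreover from calculation have "compact (closure {x. box_bump a b n x \<noteq> 0})"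
    by (meson bounded_cbox bounded_subset closed_closure compact_eq_bounded_closed)
  ultimately show ?thesis
    using assms(1) unfolding test_functions_def by (auto simp: box_bump_smooth)
qed

lemma flat_0_tendsto: 
  assumes "\<delta> > 0" shows "(\<lambda>n. flat 0 (real n * \<delta> - 1)) \<longlonglongrightarrow> 1"
proof -
  have top: "filterlim (\<lambda>n. real n * \<delta> - 1) at_top sequentially"
    using filterlim_tendsto_add_at_top[OF tendsto_const[of "-1::real"]
        filterlim_tendsto_pos_mult_at_top[OF tendsto_const assms filterlim_real_sequentially]]
    by (simp add: mult.commute)
  have "(\<lambda>n. exp (- inverse (real n * \<delta> - 1))) \<longlonglongrightarrow> exp (- 0)"
    by (rule tendsto_exp[OF tendsto_minus[OF tendsto_inverse_0_at_top[OF top]]])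
  moreover have ev: "\<forall>\<^sub>F n in sequentially. exp (- inverse (real n * \<delta> - 1)) = flat 0 (real n * \<delta> - 1)"
    using top[unfolded filterlim_at_top_dense, rule_format, of 0]
    by (rule eventually_mono) (simp add: flat_def)
  ultimately show ?thesis
    by (auto dest: Lim_transform_eventually)
qed

lemma box_bump_tendsto: "(\<lambda>n. box_bump a b (Suc n) x) \<longlonglongrightarrow> indicator (box a b) x"
proof (cases "x \<in> box a b")
  case True
  have "(\<lambda>n. flat 0 (real n * (x $ i - a $ i) - 1) * flat 0 (real n * (b $ i - x $ i) - 1)) \<longlonglongrightarrow> 1 * 1" for i
    using True by (intro tendsto_mult flat_0_tendsto) (auto simp: mem_box_cart)
  then have "(\<lambda>n. box_bump a b n x) \<longlonglongrightarrow> (\<Prod>i\<in>(UNIV::3 set). 1)"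
    unfolding box_bump_def by (intro tendsto_prod) (simp add: algebra_simps)
  then show ?thesis using True LIMSEQ_Suc by simp
next
  case False
  have "box_bump a b (Suc n) x = 0" for n
  proof (rule ccontr)
    assume "box_bump a b (Suc n) x \<noteq> 0"
    then have "x \<in> closure {x. box_bump a b (Suc n) x \<noteq> 0}"
      using closure_subset[of "{x. box_bump a b (Suc n) x \<noteq> 0}"] by auto
    then show False
      using box_bump_test_function[of a b "box a b" "Suc n"] False
      unfolding test_functions_def by blast
  qed
  then show ?thesis using False by simp
qed

section \<open>Square integrable functions\<close>

text \<open>
  The measure is arbitrary because two measures occur: Lebesgue measure on the domain, and the Borel measure of
  the whole space, on which translations act.
\<close>

definition sqint :: "'a measure \<Rightarrow> ('a \<Rightarrow> 'b::euclidean_space) \<Rightarrow> bool" where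
  "sqint M F \<longleftrightarrow> F \<in> borel_measurable M \<and> integrable M (\<lambda>x. (norm (F x))\<^sup>2)"

definition ip :: "'a measure \<Rightarrow> ('a \<Rightarrow> 'b::euclidean_space) \<Rightarrow> ('a \<Rightarrow> 'b) \<Rightarrow> real" where
  "ip M F G = (LINT x|M. F x \<bullet> G x)"

definition l2 :: "'a measure \<Rightarrow> ('a \<Rightarrow> 'b::euclidean_space) \<Rightarrow> real" where
  "l2 M F = sqrt (LINT x|M. (norm (F x))\<^sup>2)"

lemma sqint_measurable [measurable_dest]: "sqint M F \<Longrightarrow> F \<in> borel_measurable M"
  by (simp add: sqint_def)

lemma sqint_integrable_inner:
  assumes "sqint M F" "sqint M G"
  shows "integrable M (\<lambda>x. F x \<bullet> G x)"
proof (rule Bochner_Integration.integrable_bound)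
  show "integrable M (\<lambda>x. (norm (F x))\<^sup>2 + (norm (G x))\<^sup>2)"
    using assms by (simp add: sqint_def)
  show "(\<lambda>x. F x \<bullet> G x) \<in> borel_measurable M"
    using assms by (intro borel_measurable_inner sqint_measurable)
  have "\<bar>a \<bullet> b\<bar> \<le> (norm a)\<^sup>2 + (norm b)\<^sup>2" for a b :: 'b
    using Cauchy_Schwarz_ineq2[of a b] sum_squares_bound[of "norm a" "norm b"]
      mult_nonneg_nonneg[OF norm_ge_zero[of a] norm_ge_zero[of b]] by linarith
  then show "AE x in M. norm (F x \<bullet> G x) \<le> norm ((norm (F x))\<^sup>2 + (norm (G x))\<^sup>2)"
    by (intro AE_I2) simp
qed

lemma sqint_iff: "sqint M F \<longleftrightarrow> F \<in> borel_measurable M \<and> integrable M (\<lambda>x. F x \<bullet> F x)"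
  by (simp add: sqint_def power2_norm_eq_inner)

lemma sqint_scale: "sqint M F \<Longrightarrow> sqint M (\<lambda>x. c *\<^sub>R F x)"
  by (auto simp: sqint_iff intro!: borel_measurable_scaleR)

lemma sqint_add: assumes "sqint M F" "sqint M G" shows "sqint M (\<lambda>x. F x + G x)"
  using assms sqint_integrable_inner[OF assms] sqint_integrable_inner[OF assms(2,1)]
  unfolding sqint_iff by (auto simp: inner_add_left inner_add_right intro!: borel_measurable_add)

lemma sqint_diff: assumes "sqint M F" "sqint M G" shows "sqint M (\<lambda>x. F x - G x)"
  using sqint_add[OF assms(1) sqint_scale[OF assms(2), of "-1"]] by simp

lemma sqint_zero: "sqint M (\<lambda>x. 0)"
  by (simp add: sqint_def)

lemma ip_commute: "ip M F G = ip M G F"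
  by (simp add: ip_def inner_commute)

lemma ip_add:
  assumes "sqint M F" "sqint M G" "sqint M H"
  shows "ip M (\<lambda>x. F x + G x) H = ip M F H + ip M G H"
  unfolding ip_def inner_add_left
  by (rule Bochner_Integration.integral_add) (intro sqint_integrable_inner assms)+

lemma ip_diff:
  assumes "sqint M F" "sqint M G" "sqint M H"
  shows "ip M (\<lambda>x. F x - G x) H = ip M F H - ip M G H"
  unfolding ip_def inner_diff_left
  by (rule Bochner_Integration.integral_diff) (intro sqint_integrable_inner assms)+

lemma ip_scale: "ip M (\<lambda>x. c *\<^sub>R F x) H = c * ip M F H"
  unfolding ip_def by simp

lemma ip_cong_AE:
  assumes "sqint M F" "sqint M F'" "sqint M G" "AE x in M. F x = F' x"
  shows "ip M F G = ip M F' G"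
  unfolding ip_def
  by (rule integral_cong_AE) (use assms sqint_measurable in auto)

lemma l2_nonneg: "0 \<le> l2 M F"
  by (simp add: l2_def)

lemma l2_power2: "(l2 M F)\<^sup>2 = ip M F F"
  by (simp add: l2_def ip_def power2_norm_eq_inner)

lemma l2_cong_AE:
  assumes "sqint M F" "sqint M G" "AE x in M. F x = G x"
  shows "l2 M F = l2 M G"
proof -
  have "(LINT x|M. (norm (F x))\<^sup>2) = (LINT x|M. (norm (G x))\<^sup>2)"
    by (rule integral_cong_AE) (use assms sqint_measurable in auto)
  then show ?thesis by (simp add: l2_def)
qed

text \<open>
  The quadratic form of \<open>s F - t G\<close> is nonnegative for all \<open>s\<close> and \<open>t\<close>; suitable choices of the two
  parameters give the discriminant inequality without division.
\<close>

lemma ip_Cauchy_Schwarz: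
  assumes "sqint M F" "sqint M G"
  shows "\<bar>ip M F G\<bar> \<le> l2 M F * l2 M G"
proof -
  define a b c where "a = ip M F F" and "b = ip M F G" and "c = ip M G G"
  have "0 \<le> s\<^sup>2 * a - 2 * s * t * b + t\<^sup>2 * c" for s t :: real
  proof -
    have 1: "sqint M (\<lambda>x. s *\<^sub>R F x)" "sqint M (\<lambda>x. t *\<^sub>R G x)"
      using assms by (auto intro: sqint_scale)
    have 2: "sqint M (\<lambda>x. s *\<^sub>R F x - t *\<^sub>R G x)" by (intro sqint_diff 1)
    have "0 \<le> ip M (\<lambda>x. s *\<^sub>R F x - t *\<^sub>R G x) (\<lambda>x. s *\<^sub>R F x - t *\<^sub>R G x)"
      unfolding ip_def by (intro integral_nonneg_AE) simp
    also have "\<dots> = s * ip M (\<lambda>x. s *\<^sub>R F x - t *\<^sub>R G x) F - t * ip M (\<lambda>x. s *\<^sub>R F x - t *\<^sub>R G x) G"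
      by (simp only: ip_diff[OF 1 2] ip_scale ip_commute[of M _ "\<lambda>x. s *\<^sub>R F x - t *\<^sub>R G x"])
    also have "\<dots> = s\<^sup>2 * a - 2 * s * t * b + t\<^sup>2 * c"
      by (simp add: ip_diff[OF 1 assms(1)] ip_diff[OF 1 assms(2)] ip_scale a_def b_def c_def
           ip_commute[of M G F] power2_eq_square algebra_simps)
    finally show ?thesis .
  qed
  note quad = this
  have ac: "a \<ge> 0" "c \<ge> 0" unfolding a_def c_def by (simp_all flip: l2_power2)
  have "b\<^sup>2 \<le> a * c"
  proof (cases "a = 0 \<and> c = 0")
    case True
    then show ?thesis using quad[of b 1] quad[of "-b" 1] quad[of b "-1"] by (simp add: power2_eq_square)
  next
    case False
    then consider "a > 0" | "c > 0" using ac by linarith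
    then show ?thesis
    proof cases
      case 1
      have "0 \<le> a * (a * c - b\<^sup>2)" using quad[of b a] by (simp add: power2_eq_square algebra_simps)
      then show ?thesis using 1 by (simp add: zero_le_mult_iff)
    next
      case 2
      have "0 \<le> c * (a * c - b\<^sup>2)" using quad[of c b] by (simp add: power2_eq_square algebra_simps)
      then show ?thesis using 2 by (simp add: zero_le_mult_iff)
    qed
  qed
  also have "\<dots> = (l2 M F * l2 M G)\<^sup>2" by (simp add: a_def c_def power_mult_distrib l2_power2)
  finally have "\<bar>b\<bar> \<le> \<bar>l2 M F * l2 M G\<bar>" by (simp add: abs_le_square_iff)
  then show ?thesis by (simp add: b_def abs_mult l2_nonneg)
qed

lemma l2_scale: "l2 M (\<lambda>x. c *\<^sub>R F x) = \<bar>c\<bar> * l2 M F"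
  by (simp add: l2_def power_mult_distrib real_sqrt_mult)

lemma l2_triangle:
  assumes "sqint M F" "sqint M G"
  shows "l2 M (\<lambda>x. F x + G x) \<le> l2 M F + l2 M G"
proof (rule power2_le_imp_le)
  have s: "sqint M (\<lambda>x. F x + G x)" by (intro sqint_add assms)
  have "(l2 M (\<lambda>x. F x + G x))\<^sup>2 = ip M F F + 2 * ip M F G + ip M G G"
    unfolding l2_power2 ip_add[OF assms s]
    by (subst (1 2) ip_commute) (simp add: ip_add[OF assms assms(1)] ip_add[OF assms assms(2)] ip_commute[of M G F])
  also have "\<dots> \<le> (l2 M F + l2 M G)\<^sup>2"
    using ip_Cauchy_Schwarz[OF assms] by (simp add: power2_sum l2_power2)
  finally show "(l2 M (\<lambda>x. F x + G x))\<^sup>2 \<le> (l2 M F + l2 M G)\<^sup>2" .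
qed (simp add: l2_nonneg)

lemma l2_minus_commute: "l2 M (\<lambda>x. F x - G x) = l2 M (\<lambda>x. G x - F x)"
  by (simp add: l2_def norm_minus_commute)

lemma l2_le_add_diff:
  assumes "sqint M F" "sqint M G"
  shows "l2 M F \<le> l2 M G + l2 M (\<lambda>x. F x - G x)"
  using l2_triangle[OF assms(2) sqint_diff[OF assms]] by simp

lemma l2_dominated:
  assumes F: "F \<in> borel_measurable M" and G: "sqint M G"
    and le: "\<And>x. x \<in> space M \<Longrightarrow> norm (F x) \<le> c * norm (G x)"
  shows "sqint M F" "0 \<le> c \<Longrightarrow> l2 M F \<le> c * l2 M G"
proof -
  have i: "integrable M (\<lambda>x. c\<^sup>2 * (norm (G x))\<^sup>2)" using G by (simp add: sqint_def)
  have sq: "(norm (F x))\<^sup>2 \<le> c\<^sup>2 * (norm (G x))\<^sup>2" if "x \<in> space M" for x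
    using power_mono[OF le[OF that], of 2] by (simp add: power_mult_distrib)
  show s: "sqint M F"
    unfolding sqint_def
  proof
    show "integrable M (\<lambda>x. (norm (F x))\<^sup>2)"
      by (rule Bochner_Integration.integrable_bound[OF i]) (use F sq in auto)
  qed (rule F)
  have "(LINT x|M. (norm (F x))\<^sup>2) \<le> (LINT x|M. c\<^sup>2 * (norm (G x))\<^sup>2)"
    by (rule integral_mono) (use s i sq in \<open>auto simp: sqint_def\<close>)
  then show "l2 M F \<le> c * l2 M G" if "0 \<le> c"
    using that real_sqrt_le_mono by (fastforce simp: l2_def real_sqrt_mult)
qed

section \<open>Test functions\<close>

abbreviation pd :: "3 \<Rightarrow> (real^3 \<Rightarrow> 'b::real_normed_vector) \<Rightarrow> real^3 \<Rightarrow> 'b" where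
  "pd j f \<equiv> \<lambda>x. frechet_derivative f (at x) (axis j 1)"

lemma test_smooth: "\<phi> \<in> test_functions \<Omega> \<Longrightarrow> smooth_on \<phi> UNIV"
  by (simp add: test_functions_def)

lemma test_continuous: "\<phi> \<in> test_functions \<Omega> \<Longrightarrow> continuous_on UNIV \<phi>"
  by (simp add: test_smooth smooth_on_continuous)

lemma test_has_derivative:
  "\<phi> \<in> test_functions \<Omega> \<Longrightarrow> (\<phi> has_derivative frechet_derivative \<phi> (at x)) (at x)"
  using smooth_on_differentiable[OF test_smooth] frechet_derivative_works by blast

lemma test_zero:
  assumes "\<phi> \<in> test_functions \<Omega>" "x \<notin> \<Omega>" shows "\<phi> x = 0"
proof (rule ccontr)
  assume "\<phi> x \<noteq> 0"
  then have "x \<in> closure {x. \<phi> x \<noteq> 0}" using closure_subset[of "{x. \<phi> x \<noteq> 0}"] by auto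
  then show False using assms by (auto simp: test_functions_def)
qed

lemma test_subsupport:
  assumes "\<phi> \<in> test_functions \<Omega>" "smooth_on \<psi> UNIV" "{x. \<psi> x \<noteq> 0} \<subseteq> closure {x. \<phi> x \<noteq> 0}"
  shows "\<psi> \<in> test_functions \<Omega>"
proof -
  have c: "closure {x. \<psi> x \<noteq> 0} \<subseteq> closure {x. \<phi> x \<noteq> 0}"
    using assms(3) by (simp add: closure_minimal)
  then have "compact (closure {x. \<psi> x \<noteq> 0})"
    using assms(1) unfolding test_functions_def
    by (metis (mono_tags, lifting) mem_Collect_eq bounded_subset closed_closure compact_eq_bounded_closed)
  then show ?thesis using assms c by (auto simp: test_functions_def)
qed

lemma test_pd:
  assumes "\<phi> \<in> test_functions \<Omega>" shows "pd j \<phi> \<in> test_functions \<Omega>"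
proof (rule test_subsupport[OF assms])
  show "smooth_on (pd j \<phi>) UNIV"
    by (rule smooth_on_partial[OF test_smooth[OF assms]]) (simp add: axis_in_Basis_iff)
  show "{x. pd j \<phi> x \<noteq> 0} \<subseteq> closure {x. \<phi> x \<noteq> 0}"
  proof (rule subsetI, rule ccontr)
    fix x assume x: "x \<in> {x. pd j \<phi> x \<noteq> 0}" "x \<notin> closure {x. \<phi> x \<noteq> 0}"
    have "((\<lambda>x. 0) has_derivative frechet_derivative \<phi> (at x)) (at x)"
    proof (rule has_derivative_transform_within_open[OF test_has_derivative[OF assms]])
      show "open (- closure {x. \<phi> x \<noteq> 0})" by (rule open_Compl[OF closed_closure])
      show "x \<in> - closure {x. \<phi> x \<noteq> 0}" using x by simp
      show "\<phi> y = 0" if "y \<in> - closure {x. \<phi> x \<noteq> 0}" for y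
        using that closure_subset[of "{x. \<phi> x \<noteq> 0}"] by auto
    qed
    then have "frechet_derivative \<phi> (at x) = (\<lambda>h. 0)"
      by (rule has_derivative_unique[OF _ has_derivative_const])
    then show False using x by simp
  qed
qed

lemma test_bounded_linear:
  assumes "\<phi> \<in> test_functions \<Omega>" "bounded_linear L"
  shows "(\<lambda>x. L (\<phi> x)) \<in> test_functions \<Omega>"
proof (rule test_subsupport[OF assms(1)])
  show "smooth_on (\<lambda>x. L (\<phi> x)) UNIV"
    by (rule smooth_on_bounded_linear[OF assms(2) test_smooth[OF assms(1)]])
  have "{x. L (\<phi> x) \<noteq> 0} \<subseteq> {x. \<phi> x \<noteq> 0}"
    using linear_0[OF bounded_linear.linear[OF assms(2)]] by auto
  then show "{x. L (\<phi> x) \<noteq> 0} \<subseteq> closure {x. \<phi> x \<noteq> 0}"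
    using closure_subset[of "{x. \<phi> x \<noteq> 0}"] by auto
qed

lemma pd_bounded_linear:
  assumes "\<phi> \<in> test_functions \<Omega>" "bounded_linear L"
  shows "pd j (\<lambda>x. L (\<phi> x)) x = L (pd j \<phi> x)"
  by (simp add: frechet_derivative_has_derivative[OF
      bounded_linear.has_derivative[OF assms(2) test_has_derivative[OF assms(1)]]])

lemma test_measurable: "\<phi> \<in> test_functions \<Omega> \<Longrightarrow> \<phi> \<in> borel_measurable borel"
  by (rule borel_measurable_continuous_onI[OF test_continuous])

lemma test_bounded:
  assumes "\<phi> \<in> test_functions \<Omega>" obtains B where "B > 0" "\<And>x. norm (\<phi> x) \<le> B"
proof -
  let ?S = "closure {x. \<phi> x \<noteq> 0}"
  have "compact (\<phi> ` ?S)"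
    using assms continuous_on_subset[OF test_continuous[OF assms]]
    by (intro compact_continuous_image) (auto simp: test_functions_def)
  then obtain B where B: "B > 0" "\<forall>y\<in>\<phi> ` ?S. norm y \<le> B"
    using compact_imp_bounded bounded_pos by blast
  have "norm (\<phi> x) \<le> B" for x
  proof (cases "\<phi> x = 0")
    case False
    then have "x \<in> ?S" using closure_subset[of "{x. \<phi> x \<noteq> 0}"] by auto
    then show ?thesis using B by auto
  qed (use B in simp)
  then show thesis using B that by blast
qed

lemma test_integrable:
  fixes \<phi> :: "real^3 \<Rightarrow> 'b::euclidean_space"
  assumes "\<phi> \<in> test_functions \<Omega>" shows "integrable lborel \<phi>"
proof -
  let ?S = "closure {x. \<phi> x \<noteq> 0}"
  have "integrable lborel (\<lambda>x. indicator ?S x *\<^sub>R \<phi> x)"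
    by (rule borel_integrable_compact)
       (use assms continuous_on_subset[OF test_continuous[OF assms]] in \<open>auto simp: test_functions_def\<close>)
  moreover have "(\<lambda>x. indicator ?S x *\<^sub>R \<phi> x) = \<phi>"
    using closure_subset[of "{x. \<phi> x \<noteq> 0}"] by (auto simp: fun_eq_iff indicator_def)
  ultimately show ?thesis by simp
qed

lemma integrable_bounded_mult:
  fixes p s :: "'a \<Rightarrow> real"
  assumes "p \<in> borel_measurable M" "\<And>x. \<bar>p x\<bar> \<le> B" "integrable M s"
  shows "integrable M (\<lambda>x. p x * s x)"
proof (rule Bochner_Integration.integrable_bound)
  show "integrable M (\<lambda>x. B * s x)" using assms by simp
  show "(\<lambda>x. p x * s x) \<in> borel_measurable M" using assms by simp
  have "norm (p x * s x) \<le> norm (B * s x)" for x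
    using assms(2)[of x] mult_right_mono[of "\<bar>p x\<bar>" "\<bar>B\<bar>" "\<bar>s x\<bar>"] by (simp add: abs_mult)
  then show "AE x in M. norm (p x * s x) \<le> norm (B * s x)" by simp
qed

lemma test_sqint:
  fixes \<phi> :: "real^3 \<Rightarrow> 'b::euclidean_space"
  assumes "\<phi> \<in> test_functions \<Omega>" shows "sqint lborel \<phi>"
  unfolding sqint_def
proof
  show m: "\<phi> \<in> borel_measurable lborel" using test_measurable[OF assms] by simp
  obtain B where B: "B > 0" "\<And>x. norm (\<phi> x) \<le> B" using test_bounded[OF assms] by blast
  show "integrable lborel (\<lambda>x. (norm (\<phi> x))\<^sup>2)"
    unfolding power2_eq_square
    by (rule integrable_bounded_mult[of _ _ B]) (use m B test_integrable[OF assms] in auto)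
qed

section \<open>Integration by parts\<close>

lemma integral_translate:
  fixes f :: "'a::euclidean_space \<Rightarrow> 'b::{banach,second_countable_topology}"
  assumes "f \<in> borel_measurable borel"
  shows "(LINT x|lborel. f (x + c)) = (LINT x|lborel. f x)"
proof -
  have "(LINT x|lborel. f x) = (LINT x|distr lborel borel ((+) c). f x)"
    by (simp add: lborel_distr_plus)
  also have "\<dots> = (LINT x|lborel. f (c + x))"
    by (rule integral_distr) (use assms in auto)
  finally show ?thesis by (simp add: add.commute)
qed

text \<open>
  The difference quotients of \<open>p\<close> are bounded by the supremum of its partial derivative, so dominated
  convergence applies. Integration by parts, the exchange of partial derivatives and the estimate of the minors are
  all read off from derivatives of such integrals.
\<close>

lemma shift_integral_deriv:
  fixes p s :: "real^3 \<Rightarrow> real"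
  assumes p: "p \<in> test_functions \<Omega>" and s: "integrable lborel s"
  shows "((\<lambda>t. LINT x|lborel. p (x + c + t *\<^sub>R axis j 1) * s x) has_real_derivative
          (LINT x|lborel. pd j p (x + c + t *\<^sub>R axis j 1) * s x)) (at t)"
proof -
  let ?e = "axis j 1 :: real^3"
  obtain Bp where Bp: "\<And>x. \<bar>p x\<bar> \<le> Bp" using test_bounded[OF p] by auto
  obtain B where B: "B > 0" "\<And>x. \<bar>pd j p x\<bar> \<le> B" using test_bounded[OF test_pd[OF p, of j]] by auto
  have pm: "(\<lambda>x. p (x + a)) \<in> borel_measurable lborel" for a
    by (rule measurable_compose[OF _ test_measurable[OF p]]) simp
  have i: "integrable lborel (\<lambda>x. p (x + a) * s x)" for a
    by (rule integrable_bounded_mult[OF pm Bp s])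
  have d: "((\<lambda>t. p (a + t *\<^sub>R ?e)) has_real_derivative pd j p (a + t *\<^sub>R ?e)) (at t)" for a t
  proof -
    have "((\<lambda>t. p (a + t *\<^sub>R ?e)) has_derivative (\<lambda>h. frechet_derivative p (at (a + t *\<^sub>R ?e)) (h *\<^sub>R ?e))) (at t)"
      by (rule has_derivative_compose[OF _ test_has_derivative[OF p]]) (auto intro!: derivative_eq_intros)
    moreover have "frechet_derivative p (at (a + t *\<^sub>R ?e)) (h *\<^sub>R ?e) = pd j p (a + t *\<^sub>R ?e) * h" for h
      using linear_scale[OF has_derivative_linear[OF test_has_derivative[OF p]]] by simp
    ultimately show ?thesis by (simp add: has_field_derivative_def)
  qed
  have bd: "\<bar>p (a + (t + h) *\<^sub>R ?e) - p (a + t *\<^sub>R ?e)\<bar> \<le> B * \<bar>h\<bar>" for a h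
    using field_differentiable_bound[of UNIV "\<lambda>t. p (a + t *\<^sub>R ?e)" "\<lambda>t. pd j p (a + t *\<^sub>R ?e)" B "t + h" t] d B
    by simp
  define D where "D = (LINT x|lborel. pd j p (x + c + t *\<^sub>R ?e) * s x)"
  define F where "F = (\<lambda>t. LINT x|lborel. p (x + c + t *\<^sub>R ?e) * s x)"
  have "((\<lambda>h. (F (t + h) - F t) / h) \<longlongrightarrow> D) (at 0)"
  proof (unfold tendsto_at_iff_sequentially, intro allI impI)
    fix X :: "nat \<Rightarrow> real" assume X: "\<forall>i. X i \<in> UNIV - {0}" and X0: "X \<longlonglongrightarrow> 0"
    let ?q = "\<lambda>n x. (p (x + c + (t + X n) *\<^sub>R ?e) - p (x + c + t *\<^sub>R ?e)) / X n * s x"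
    have eq: "(F (t + X n) - F t) / X n = (LINT x|lborel. ?q n x)" for n
    proof -
      have "F (t + X n) - F t = (LINT x|lborel. p (x + c + (t + X n) *\<^sub>R ?e) * s x - p (x + c + t *\<^sub>R ?e) * s x)"
        unfolding F_def
        by (rule Bochner_Integration.integral_diff[symmetric]) (use i[of "c + _"] in \<open>simp_all add: add.assoc\<close>)
      then have "(F (t + X n) - F t) / X n
        = (LINT x|lborel. (p (x + c + (t + X n) *\<^sub>R ?e) * s x - p (x + c + t *\<^sub>R ?e) * s x) / X n)"
        by simp
      then show ?thesis by (simp add: algebra_simps diff_divide_distrib)
    qed
    have "(\<lambda>n. LINT x|lborel. ?q n x) \<longlonglongrightarrow> D"
      unfolding D_def
    proof (rule integral_dominated_convergence)
      show "(\<lambda>x. pd j p (x + c + t *\<^sub>R ?e) * s x) \<in> borel_measurable lborel"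
        using s by (intro borel_measurable_times measurable_compose[OF _ test_measurable[OF test_pd[OF p]]]) auto
      show "?q n \<in> borel_measurable lborel" for n
        using s pm[of "c + _"] by (intro borel_measurable_times borel_measurable_divide borel_measurable_diff) (auto simp: add.assoc)
      show "integrable lborel (\<lambda>x. B * \<bar>s x\<bar>)" using s by simp
      show "AE x in lborel. (\<lambda>n. ?q n x) \<longlonglongrightarrow> pd j p (x + c + t *\<^sub>R ?e) * s x"
      proof (intro AE_I2 tendsto_mult tendsto_const)
        fix x
        have "((\<lambda>h. (p (x + c + (t + h) *\<^sub>R ?e) - p (x + c + t *\<^sub>R ?e)) / h) \<longlongrightarrow> pd j p (x + c + t *\<^sub>R ?e)) (at 0)"
          using d[of "x + c" t] by (simp add: DERIV_def)
        then show "(\<lambda>n. (p (x + c + (t + X n) *\<^sub>R ?e) - p (x + c + t *\<^sub>R ?e)) / X n) \<longlonglongrightarrow> pd j p (x + c + t *\<^sub>R ?e)"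
          unfolding tendsto_at_iff_sequentially using X X0 by (auto simp: o_def)
      qed
      show "AE x in lborel. norm (?q n x) \<le> B * \<bar>s x\<bar>" for n
      proof (intro AE_I2)
        fix x
        have "\<bar>(p (x + c + (t + X n) *\<^sub>R ?e) - p (x + c + t *\<^sub>R ?e)) / X n\<bar> \<le> B"
          using bd[of "x + c" "X n"] X by (simp add: divide_le_eq)
        then show "norm (?q n x) \<le> B * \<bar>s x\<bar>"
          unfolding real_norm_def abs_mult by (rule mult_right_mono) simp
      qed
    qed
    then show "((\<lambda>h. (F (t + h) - F t) / h) \<circ> X) \<longlonglongrightarrow> D" unfolding o_def eq .
  qed
  then show ?thesis by (simp add: DERIV_def F_def D_def)
qed

lemma test_mult_integrable:
  fixes p s :: "real^3 \<Rightarrow> real"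
  assumes p: "p \<in> test_functions \<Omega>" and s: "integrable lborel s"
  shows "integrable lborel (\<lambda>x. p (x + c) * s x)"
proof -
  obtain B where "\<And>x. \<bar>p x\<bar> \<le> B" using test_bounded[OF p] by auto
  moreover have "(\<lambda>x. p (x + c)) \<in> borel_measurable lborel"
    by (rule measurable_compose[OF _ test_measurable[OF p]]) simp
  ultimately show ?thesis
    using s by (intro integrable_bounded_mult[of _ _ B])
qed

lemma test_shift_integrable:
  fixes p :: "real^3 \<Rightarrow> real"
  assumes p: "p \<in> test_functions \<Omega>" 
  shows "integrable lborel (\<lambda>x. p (x + c))"
proof -
  have "integrable (distr lborel borel ((+) c)) p"
    using test_integrable[OF p] by (simp add: lborel_distr_plus)
  then have "integrable lborel (\<lambda>x. p (c + x))"
    by (subst (asm) integrable_distr_eq) (use test_measurable[OF p] in auto)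
  then show ?thesis by (simp add: add.commute)
qed

text \<open>
  By translation invariance the shift in direction \<open>j\<close> can be moved from \<open>p\<close> to \<open>s\<close> with the opposite sign.
  The formula compares the derivatives of the two expressions at \<open>t = 0\<close>. The extra shift \<open>c\<close> is carried along for
  the estimate of the minors.
\<close>

lemma integral_by_parts_shift:
  fixes p s :: "real^3 \<Rightarrow> real"
  assumes p: "p \<in> test_functions \<Omega>" and s: "s \<in> test_functions \<Omega>'"
  shows "(LINT x|lborel. pd j p (x + c) * s x) = - (LINT x|lborel. p (x + c) * pd j s x)"
proof -
  let ?e = "axis j 1 :: real^3"
  have 1: "((\<lambda>t. LINT x|lborel. p (x + c + t *\<^sub>R ?e) * s x) has_real_derivative
      (LINT x|lborel. pd j p (x + c) * s x)) (at 0)"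
    using shift_integral_deriv[OF p test_integrable[OF s], where c = c and j = j and t = 0] by simp
  have "((\<lambda>t. LINT x|lborel. s (x + 0 + t *\<^sub>R ?e) * p (x + c)) has_real_derivative
      (LINT x|lborel. pd j s x * p (x + c))) (at (- 0))"
    using shift_integral_deriv[OF s test_shift_integrable[OF p], where c = 0 and j = j and t = 0] by simp
  then have "((\<lambda>t. LINT x|lborel. s (x + 0 + (- t) *\<^sub>R ?e) * p (x + c)) has_real_derivative
      (LINT x|lborel. pd j s x * p (x + c)) * (- 1)) (at 0)"
    by (rule DERIV_chain2) (auto intro!: derivative_eq_intros)
  moreover have "(LINT x|lborel. s (x + 0 + (- t) *\<^sub>R ?e) * p (x + c)) =
      (LINT x|lborel. p (x + c + t *\<^sub>R ?e) * s x)" for t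
  proof -
    have "(\<lambda>x. s (x - t *\<^sub>R ?e) * p (x + c)) \<in> borel_measurable borel"
      by (intro borel_measurable_times measurable_compose[OF _ test_measurable[OF p]]
            measurable_compose[OF _ test_measurable[OF s]]) auto
    from integral_translate[OF this, of "t *\<^sub>R ?e"] show ?thesis
      by (simp add: algebra_simps)
  qed
  ultimately have "((\<lambda>t. LINT x|lborel. p (x + c + t *\<^sub>R ?e) * s x) has_real_derivative
      (LINT x|lborel. pd j s x * p (x + c)) * (- 1)) (at 0)" by simp
  from DERIV_unique[OF 1 this] show ?thesis by (simp add: mult.commute)
qed

lemma integral_by_parts:
  fixes p s :: "real^3 \<Rightarrow> real"
  assumes "p \<in> test_functions \<Omega>" "s \<in> test_functions \<Omega>'"
  shows "(LINT x|lborel. pd j p x * s x) = - (LINT x|lborel. p x * pd j s x)"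
  using integral_by_parts_shift[OF assms, where c = 0] by simp

text \<open>
  Integrate by parts in direction \<open>j\<close> with \<open>f\<close> shifted along direction \<open>i\<close>, and differentiate in the shift.
  This stands in for the symmetry of second derivatives.
\<close>

lemma integral_pd_swap:
  fixes f g :: "real^3 \<Rightarrow> real"
  assumes f: "f \<in> test_functions \<Omega>" and g: "g \<in> test_functions \<Omega>'"
  shows "(LINT x|lborel. pd i f x * pd j g x) = (LINT x|lborel. pd j f x * pd i g x)"
proof -
  let ?e = "axis i 1 :: real^3"
  have 1: "((\<lambda>t. LINT x|lborel. f (x + 0 + t *\<^sub>R ?e) * pd j g x) has_real_derivative
      (LINT x|lborel. pd i f x * pd j g x)) (at 0)"
    using shift_integral_deriv[OF f test_integrable[OF test_pd[OF g]], where c = 0 and j = i and t = 0] by simp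
  have 2: "((\<lambda>t. LINT x|lborel. pd j f (x + 0 + t *\<^sub>R ?e) * g x) has_real_derivative
      (LINT x|lborel. pd i (pd j f) x * g x)) (at 0)"
    using shift_integral_deriv[OF test_pd[OF f] test_integrable[OF g], where c = 0 and j = i and t = 0] by simp
  have "(LINT x|lborel. f (x + 0 + t *\<^sub>R ?e) * pd j g x) = - (LINT x|lborel. pd j f (x + 0 + t *\<^sub>R ?e) * g x)" for t
    using integral_by_parts_shift[OF f g, where j = j and c = "t *\<^sub>R ?e"] by simp
  then have "(LINT x|lborel. pd i f x * pd j g x) = - (LINT x|lborel. pd i (pd j f) x * g x)"
    using DERIV_unique[OF 1] DERIV_minus[OF 2] by simp
  also have "\<dots> = (LINT x|lborel. pd j f x * pd i g x)"
    using integral_by_parts[OF test_pd[OF f] g] by simp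
  finally show ?thesis .
qed

lemma l2_shift:
  fixes p :: "real^3 \<Rightarrow> real"
  assumes "p \<in> test_functions \<Omega>"
  shows "sqint lborel (\<lambda>x. p (x + c))" "l2 lborel (\<lambda>x. p (x + c)) = l2 lborel p"
proof -
  have m: "(\<lambda>x. (norm (p x))\<^sup>2) \<in> borel_measurable borel"
    using test_measurable[OF assms] by simp
  have "integrable lborel (\<lambda>x. p (x + c) * p (x + c))"
    by (rule test_mult_integrable[OF assms test_shift_integrable[OF assms]])
  moreover have "(\<lambda>x. p (x + c)) \<in> borel_measurable lborel"
    by (rule measurable_compose[OF _ test_measurable[OF assms]]) simp
  ultimately show "sqint lborel (\<lambda>x. p (x + c))" by (simp add: sqint_def power2_eq_square)
  show "l2 lborel (\<lambda>x. p (x + c)) = l2 lborel p"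
    unfolding l2_def using integral_translate[OF m, of c] by simp
qed

section \<open>Integrals of principal minors\<close>

text \<open>
  Shift the first row \<open>(p, q)\<close> of the matrix by \<open>t\<close> along direction \<open>i\<close> and consider the integral of
  \<open>p s - q r\<close> as a function of \<open>t\<close>. It vanishes for \<open>t = d\<close>, because then the supports of the two rows are
  disjoint. Its derivative contains \<open>\<partial>\<^sub>i p\<close> and \<open>\<partial>\<^sub>i q\<close>; moving one derivative to the second row by parts, and trading
  \<open>\<partial>\<^sub>i q\<close> for \<open>\<partial>\<^sub>j p\<close> plus the curl of the first row, leaves only terms that contain the curl of one of the rows.
  For gradients this says that the determinant is a null Lagrangian.
\<close>

lemma minor_integral_bound:
  fixes p q r s :: "real^3 \<Rightarrow> real"
  assumes t: "p \<in> test_functions \<Omega>" "q \<in> test_functions \<Omega>" "r \<in> test_functions \<Omega>" "s \<in> test_functions \<Omega>"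
    and diam: "\<And>x y. x \<in> \<Omega> \<Longrightarrow> y \<in> \<Omega> \<Longrightarrow> dist x y < d" and d: "d \<ge> 0"
  shows "\<bar>LINT x|lborel. p x * s x - q x * r x\<bar> \<le>
    d * (l2 lborel p * l2 lborel (\<lambda>x. pd i s x - pd j r x)
       + l2 lborel (\<lambda>x. pd i q x - pd j p x) * l2 lborel r)"
proof -
  let ?e = "axis i 1 :: real^3"
  let ?c1 = "\<lambda>x. pd i q x - pd j p x" and ?c2 = "\<lambda>x. pd i s x - pd j r x"
  define \<Psi> where "\<Psi> = (\<lambda>t. (LINT x|lborel. p (x + 0 + t *\<^sub>R ?e) * s x) - (LINT x|lborel. q (x + 0 + t *\<^sub>R ?e) * r x))"
  define \<Psi>' where "\<Psi>' = (\<lambda>t. (LINT x|lborel. pd i p (x + 0 + t *\<^sub>R ?e) * s x) - (LINT x|lborel. pd i q (x + 0 + t *\<^sub>R ?e) * r x))"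
  define K where "K = l2 lborel p * l2 lborel ?c2 + l2 lborel ?c1 * l2 lborel r"
  have der: "(\<Psi> has_real_derivative \<Psi>' t) (at t)" for t
    unfolding \<Psi>_def \<Psi>'_def
    by (intro DERIV_diff shift_integral_deriv[OF t(1) test_integrable[OF t(4)]]
          shift_integral_deriv[OF t(2) test_integrable[OF t(3)]])
  have bound: "\<bar>\<Psi>' t\<bar> \<le> K" for t
  proof -
    define c where "c = t *\<^sub>R ?e"
    have a: "\<And>c. x + 0 + c = x + c" for x :: "real^3" by simp
    have ii: "integrable lborel (\<lambda>x. f (x + c) * g x)" if "f \<in> test_functions \<Omega>" "g \<in> test_functions \<Omega>" for f g :: "real^3 \<Rightarrow> real"
      by (rule test_mult_integrable[OF that(1) test_integrable[OF that(2)]])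
    have pt: "pd i q \<in> test_functions \<Omega>" "pd j p \<in> test_functions \<Omega>" "pd i s \<in> test_functions \<Omega>" "pd j r \<in> test_functions \<Omega>"
      by (intro test_pd t)+
    have s1: "sqint lborel (\<lambda>x. ?c1 (x + c))"
      using l2_shift(1)[OF pt(1), of c] l2_shift(1)[OF pt(2), of c] by (rule sqint_diff)
    have s2: "sqint lborel ?c2"
      by (intro sqint_diff test_sqint[OF pt(3)] test_sqint[OF pt(4)])
    have "\<Psi>' t = - (LINT x|lborel. p (x + c) * pd i s x) - (LINT x|lborel. pd i q (x + c) * r x)"
      unfolding \<Psi>'_def a c_def[symmetric] using integral_by_parts_shift[OF t(1,4)] by simp
    also have "(LINT x|lborel. pd i q (x + c) * r x) = (LINT x|lborel. ?c1 (x + c) * r x) + (LINT x|lborel. pd j p (x + c) * r x)"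
      using ii[OF pt(1) t(3)] ii[OF pt(2) t(3)] by (simp add: left_diff_distrib)
    also have "(LINT x|lborel. pd j p (x + c) * r x) = - (LINT x|lborel. p (x + c) * pd j r x)"
      by (rule integral_by_parts_shift[OF t(1,3)])
    also have "- (LINT x|lborel. p (x + c) * pd i s x) - ((LINT x|lborel. ?c1 (x + c) * r x) + - (LINT x|lborel. p (x + c) * pd j r x))
       = - (LINT x|lborel. p (x + c) * ?c2 x) - (LINT x|lborel. ?c1 (x + c) * r x)"
      using ii[OF t(1) pt(3)] ii[OF t(1) pt(4)] by (simp add: right_diff_distrib)
    also have "\<dots> = - ip lborel (\<lambda>x. p (x + c)) ?c2 - ip lborel (\<lambda>x. ?c1 (x + c)) r"
      by (simp add: ip_def)
    finally have "\<bar>\<Psi>' t\<bar> \<le> \<bar>ip lborel (\<lambda>x. p (x + c)) ?c2\<bar> + \<bar>ip lborel (\<lambda>x. ?c1 (x + c)) r\<bar>" by simp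
    also have "\<dots> \<le> l2 lborel (\<lambda>x. p (x + c)) * l2 lborel ?c2 + l2 lborel (\<lambda>x. ?c1 (x + c)) * l2 lborel r"
      by (intro add_mono ip_Cauchy_Schwarz l2_shift(1)[OF t(1)] s1 s2 test_sqint[OF t(3)])
    also have "l2 lborel (\<lambda>x. ?c1 (x + c)) = l2 lborel ?c1"
    proof -
      have "(\<lambda>x. (norm (?c1 x))\<^sup>2) \<in> borel_measurable borel"
        using test_measurable[OF pt(1)] test_measurable[OF pt(2)] by simp
      from integral_translate[OF this, of c] show ?thesis by (simp add: l2_def)
    qed
    also have "l2 lborel (\<lambda>x. p (x + c)) = l2 lborel p" by (rule l2_shift(2)[OF t(1)])
    finally show ?thesis by (simp add: K_def)
  qed
  have far: "f (x + 0 + d *\<^sub>R ?e) * g x = 0" if "f \<in> test_functions \<Omega>" "g \<in> test_functions \<Omega>" for f g :: "real^3 \<Rightarrow> real" and x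
  proof (rule ccontr)
    assume "\<not> ?thesis"
    then have "x + d *\<^sub>R ?e \<in> \<Omega>" "x \<in> \<Omega>" using test_zero that by fastforce+
    then have "dist (x + d *\<^sub>R ?e) x < d" by (rule diam)
    then show False using d by (simp add: dist_norm)
  qed
  \<comment> \<open>The support of the shifted row has left \<open>\<Omega>\<close>.\<close>
  have "\<Psi> d = 0" unfolding \<Psi>_def by (simp only: far[OF t(1,4)] far[OF t(2,3)])
  moreover have "norm (\<Psi> d - \<Psi> 0) \<le> K * norm (d - 0)"
    by (rule field_differentiable_bound[of UNIV \<Psi> \<Psi>']) (use der bound in auto)
  moreover have "\<Psi> 0 = (LINT x|lborel. p x * s x - q x * r x)"
    unfolding \<Psi>_def
    using test_mult_integrable[OF t(1) test_integrable[OF t(4)], of 0] test_mult_integrable[OF t(2) test_integrable[OF t(3)], of 0]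
    by simp
  ultimately show ?thesis using d by (simp add: K_def mult.commute)
qed

section \<open>Fields with vanishing integrals\<close>

lemma indicator_mult_integrable:
  fixes G :: "real^3 \<Rightarrow> real"
  shows "integrable lborel G \<Longrightarrow> A \<in> sets borel \<Longrightarrow> integrable lborel (\<lambda>x. indicator A x * G x)"
  using integrable_mult_indicator[of A lborel G] by simp

lemma integral_zero_on_box:
  fixes G :: "real^3 \<Rightarrow> real"
  assumes G: "integrable lborel G"
    and zero: "\<And>\<phi>. \<phi> \<in> test_functions \<Omega> \<Longrightarrow> (LINT x|lborel. \<phi> x * G x) = 0"
    and sub: "box a b \<subseteq> \<Omega>"
  shows "(LINT x|lborel. indicator (box a b) x * G x) = 0"
proof -
  have "(\<lambda>n. LINT x|lborel. box_bump a b (Suc n) x * G x) \<longlonglongrightarrow> (LINT x|lborel. indicator (box a b) x * G x)"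
  proof (rule integral_dominated_convergence)
    show "(\<lambda>x. indicator (box a b) x * G x) \<in> borel_measurable lborel"
      using G by (intro borel_measurable_integrable indicator_mult_integrable) auto
    show "(\<lambda>x. box_bump a b (Suc n) x * G x) \<in> borel_measurable lborel" for n
      using G test_measurable[OF box_bump_test_function[OF sub, of "Suc n"]]
      by (intro borel_measurable_times) auto
    show "integrable lborel (\<lambda>x. \<bar>G x\<bar>)" using G by simp
    show "AE x in lborel. (\<lambda>n. box_bump a b (Suc n) x * G x) \<longlonglongrightarrow> indicator (box a b) x * G x"
      by (intro AE_I2 tendsto_mult box_bump_tendsto tendsto_const)
    show "AE x in lborel. norm (box_bump a b (Suc n) x * G x) \<le> \<bar>G x\<bar>" for n
      using box_bump_bounds by (intro AE_I2) (simp add: abs_mult mult_left_le_one_le)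
  qed
  moreover have "(LINT x|lborel. box_bump a b (Suc n) x * G x) = 0" for n
    by (rule zero[OF box_bump_test_function[OF sub]]) simp
  ultimately show ?thesis by (simp add: LIMSEQ_const_iff)
qed

lemma box_Int_box_cart:
  fixes a b c d :: "real^'n"
  shows "box a b \<inter> box c d = box (\<chi> i. max (a $ i) (c $ i)) (\<chi> i. min (b $ i) (d $ i))"
  by (auto simp: mem_box_cart)

lemma open_Union_boxes: "\<forall>k<n. \<exists>a b. S k = box a b \<and> S k \<subseteq> \<Omega> \<Longrightarrow> open (\<Union>k<(n::nat). S k)"
proof (intro open_UN ballI)
  fix k assume S: "\<forall>k<n. \<exists>a b. S k = box a b \<and> S k \<subseteq> \<Omega>" and "k \<in> {..<n}"
  then have "\<exists>a b. S k = box a b" by blast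
  then show "open (S k)" using open_box by force
qed

text \<open>
  Inclusion and exclusion for the last box: its intersections with the other boxes are again boxes in \<open>\<Omega>\<close>,
  and there is one fewer of them.
\<close>

lemma integral_zero_on_finite_union:
  fixes G :: "real^3 \<Rightarrow> real" and n :: nat
  assumes G: "integrable lborel G"
    and zero: "\<And>a b. box a b \<subseteq> \<Omega> \<Longrightarrow> (LINT x|lborel. indicator (box a b) x * G x) = 0"
    and S: "\<forall>k<n. \<exists>a b. S k = box a b \<and> S k \<subseteq> \<Omega>"
  shows "(LINT x|lborel. indicator (\<Union>k<n. S k) x * G x) = 0"
  using S
proof (induction n arbitrary: S)
  case 0
  then show ?case by simp
next
  case (Suc n)
  obtain a b where ab: "S n = box a b" "S n \<subseteq> \<Omega>" using Suc.prems by auto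
  have S': "\<forall>k<n. \<exists>a b. S k = box a b \<and> S k \<subseteq> \<Omega>" using Suc.prems by simp
  have SI: "\<forall>k<n. \<exists>a b. S k \<inter> S n = box a b \<and> S k \<inter> S n \<subseteq> \<Omega>"
  proof (intro allI impI)
    fix k assume "k < n"
    then obtain c d where "S k = box c d" "S k \<subseteq> \<Omega>" using S' by blast
    then show "\<exists>a b. S k \<inter> S n = box a b \<and> S k \<inter> S n \<subseteq> \<Omega>"
      unfolding ab(1) using box_Int_box_cart[of c d a b] by auto
  qed
  note op = open_Union_boxes[OF S'] open_Union_boxes[OF SI]
  have "indicator (\<Union>k<Suc n. S k) x * G x = indicator (\<Union>k<n. S k) x * G x + indicator (S n) x * G x
      - indicator (\<Union>k<n. S k \<inter> S n) x * G x" for x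
    by (auto simp: indicator_def lessThan_Suc)
  then have "(LINT x|lborel. indicator (\<Union>k<Suc n. S k) x * G x) = 
      (LINT x|lborel. indicator (\<Union>k<n. S k) x * G x) + (LINT x|lborel. indicator (S n) x * G x)
      - (LINT x|lborel. indicator (\<Union>k<n. S k \<inter> S n) x * G x)"
    using op ab(1) by (simp add: indicator_mult_integrable[OF G] borel_open)
  also have "\<dots> = 0"
    using Suc.IH[OF S'] Suc.IH[OF SI] zero[of a b] ab by simp
  finally show ?case .
qed

lemma integral_zero_on_open:
  fixes G :: "real^3 \<Rightarrow> real"
  assumes G: "integrable lborel G"
    and zero: "\<And>a b. box a b \<subseteq> \<Omega> \<Longrightarrow> (LINT x|lborel. indicator (box a b) x * G x) = 0"
    and V: "open V" "V \<subseteq> \<Omega>"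
  shows "(LINT x|lborel. indicator V x * G x) = 0"
proof -
  obtain \<D> where D: "countable \<D>" "\<D> \<subseteq> Pow V" "\<And>X. X \<in> \<D> \<Longrightarrow> \<exists>a b. X = box a b" "\<Union>\<D> = V"
    using open_countable_Union_open_box[OF V(1)] by blast
  show ?thesis
  proof (cases "\<D> = {}")
    case True
    then show ?thesis using D by auto
  next
    case False
    define S where "S = from_nat_into \<D>"
    have SD: "S k \<in> \<D>" for k unfolding S_def using False by (rule from_nat_into)
    have UN: "(\<Union>k. S k) = V" using range_from_nat_into[OF False D(1)] D(4) by (simp add: S_def)
    have S: "\<forall>k<n. \<exists>a b. S k = box a b \<and> S k \<subseteq> \<Omega>" for n :: nat
      proof (intro allI impI)
      fix k
      have "S k \<subseteq> \<Omega>" using D(2) SD[of k] V(2) by auto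
      then show "\<exists>a b. S k = box a b \<and> S k \<subseteq> \<Omega>" using D(3)[OF SD[of k]] by simp
    qed
    note op = open_Union_boxes[OF S]
    have "(\<lambda>n. LINT x|lborel. indicator (\<Union>k<n. S k) x * G x) \<longlonglongrightarrow> (LINT x|lborel. indicator V x * G x)"
    proof (rule integral_dominated_convergence)
      show "(\<lambda>x. indicator V x * G x) \<in> borel_measurable lborel"
        using G V by (intro borel_measurable_integrable indicator_mult_integrable) (auto simp: borel_open)
      show "(\<lambda>x. indicator (\<Union>k<n. S k) x * G x) \<in> borel_measurable lborel" for n
        by (intro borel_measurable_integrable indicator_mult_integrable G borel_open op)
      show "integrable lborel (\<lambda>x. \<bar>G x\<bar>)" using G by simp
      show "AE x in lborel. (\<lambda>n. indicator (\<Union>k<n. S k) x * G x) \<longlonglongrightarrow> indicator V x * G x"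
        using LIMSEQ_indicator_UN[of S] UN by (intro AE_I2 tendsto_mult tendsto_const) auto
      show "AE x in lborel. norm (indicator (\<Union>k<n. S k) x * G x) \<le> \<bar>G x\<bar>" for n
        by (intro AE_I2) (simp add: abs_mult indicator_def)
    qed
    moreover have "(LINT x|lborel. indicator (\<Union>k<n. S k) x * G x) = 0" for n
      by (rule integral_zero_on_finite_union[OF G zero S])
    ultimately show ?thesis by (simp add: LIMSEQ_const_iff)
  qed
qed

text \<open>
  The Borel sets over which \<open>G\<close> integrates to zero form a Dynkin system that contains the open sets, and a
  function whose integral vanishes over every measurable set is zero almost everywhere.
\<close>

lemma fundamental_lemma_borel:
  fixes G :: "real^3 \<Rightarrow> real"
  assumes G: "integrable lborel G" and \<Omega>: "open \<Omega>" and supp: "\<And>x. x \<notin> \<Omega> \<Longrightarrow> G x = 0"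
    and zero: "\<And>\<phi>. \<phi> \<in> test_functions \<Omega> \<Longrightarrow> (LINT x|lborel. \<phi> x * G x) = 0"
  shows "AE x in lborel. G x = 0"
proof -
  have opn: "(LINT x|lborel. indicator V x * G x) = 0" if "open V" for V
  proof -
    have "(LINT x|lborel. indicator (V \<inter> \<Omega>) x * G x) = 0"
      by (rule integral_zero_on_open[OF G integral_zero_on_box[OF G zero]]) (use that \<Omega> in auto)
    moreover have "indicator (V \<inter> \<Omega>) x * G x = indicator V x * G x" for x
      using supp by (auto simp: indicator_def)
    ultimately show ?thesis by simp
  qed
  have brl: "(LINT x|lborel. indicator A x * G x) = 0" if "A \<in> sets borel" for A
  proof -
    have A: "A \<in> sigma_sets UNIV {S. open S}" using that by (simp add: borel_def)
    have int: "Int_stable {S::(real^3) set. open S}" by (auto simp: Int_stable_def)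
    have sub: "{S::(real^3) set. open S} \<subseteq> Pow UNIV" by simp
    from int sub A show ?thesis
    proof (induction rule: sigma_sets_induct_disjoint)
      case (basic A)
      then show ?case using opn by simp
    next
      case empty
      show ?case by simp
    next
      case (compl A)
      then have A: "A \<in> sets borel" by (simp add: borel_def)
      have "indicator (UNIV - A) x * G x = indicator UNIV x * G x - indicator A x * G x" for x
        by (simp add: indicator_def)
      then show ?case
        using compl.IH opn[OF open_UNIV] indicator_mult_integrable[OF G A] G by simp
    next
      case (union A)
      then have A: "A i \<in> sets borel" for i by (auto simp: borel_def)
      have "(LINT x:(\<Union>i. A i)|lborel. G x) = (\<Sum>i. (LINT x:(A i)|lborel. G x))"
        by (rule lebesgue_integral_countable_add)
           (use A union.hyps indicator_mult_integrable[OF G, of "\<Union>i. A i"]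
            in \<open>auto simp: disjoint_family_on_def set_integrable_def\<close>)
      then show ?case using union.IH by (simp add: set_lebesgue_integral_def)
    qed
  qed
  show ?thesis
    by (rule sigma_finite_measure.density_zero[OF lborel.sigma_finite_measure_axioms G]) (use brl in \<open>simp add: set_lebesgue_integral_def\<close>)
qed

section \<open>Square integrable fields on a domain\<close>

lemma L2_iff: "F \<in> L2 \<Omega> \<longleftrightarrow> sqint (lebesgue_on \<Omega>) F"
  by (simp add: L2_def sqint_def)

lemma L2_norm_eq: "L2_norm \<Omega> F = l2 (lebesgue_on \<Omega>) F"
  by (simp add: L2_norm_def l2_def)

lemma lebesgue_on_integrable_extend:
  fixes f :: "real^3 \<Rightarrow> 'b::{banach,second_countable_topology}"
  assumes "\<Omega> \<in> sets lebesgue" "f \<in> borel_measurable borel" "\<And>x. x \<notin> \<Omega> \<Longrightarrow> f x = 0"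
  shows "integrable (lebesgue_on \<Omega>) f \<longleftrightarrow> integrable lborel f"
    "(LINT x|lebesgue_on \<Omega>. f x) = (LINT x|lborel. f x)"
proof -
  have e: "(\<lambda>x. indicator \<Omega> x *\<^sub>R f x) = f" using assms(3) by (auto simp: indicator_def fun_eq_iff)
  show "integrable (lebesgue_on \<Omega>) f \<longleftrightarrow> integrable lborel f"
    using assms by (simp add: integrable_restrict_space e integrable_completion)
  show "(LINT x|lebesgue_on \<Omega>. f x) = (LINT x|lborel. f x)"
    using assms by (simp add: integral_restrict_space e integral_completion)
qed

lemma borel_measurable_lebesgue_on:
  "f \<in> borel_measurable borel \<Longrightarrow> f \<in> borel_measurable (lebesgue_on \<Omega>)"
  by (simp add: measurable_completion measurable_restrict_space1)

lemma L2_integrable: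
  fixes F :: "real^3 \<Rightarrow> 'b::euclidean_space"
  assumes "bounded \<Omega>" "\<Omega> \<in> sets lebesgue" "F \<in> L2 \<Omega>"
  shows "integrable (lebesgue_on \<Omega>) F"
proof (rule Bochner_Integration.integrable_bound)
  have "finite_measure (lebesgue_on \<Omega>)"
    using assms by (intro finite_measure_lebesgue_on bounded_set_imp_lmeasurable)
  then show "integrable (lebesgue_on \<Omega>) (\<lambda>x. 1 + (norm (F x))\<^sup>2)"
    using assms(3) by (simp add: L2_def finite_measure.integrable_const)
  show "F \<in> borel_measurable (lebesgue_on \<Omega>)" using assms by (simp add: L2_def)
  have "s \<le> 1 + s\<^sup>2" if "0 \<le> s" for s :: real
    using sum_squares_bound[of s 1] that by simp
  then show "AE x in lebesgue_on \<Omega>. norm (F x) \<le> norm (1 + (norm (F x))\<^sup>2)" by simp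
qed

lemma test_mult_L2_integrable:
  fixes F :: "real^3 \<Rightarrow> 'b::euclidean_space"
  assumes "\<phi> \<in> test_functions \<Omega>'" "bounded \<Omega>" "\<Omega> \<in> sets lebesgue" "F \<in> L2 \<Omega>"
  shows "integrable (lebesgue_on \<Omega>) (\<lambda>x. \<phi> x *\<^sub>R F x)"
proof -
  obtain B where B: "\<And>x. \<bar>\<phi> x\<bar> \<le> B" using test_bounded[OF assms(1)] by auto
  show ?thesis
  proof (rule Bochner_Integration.integrable_bound)
  show "integrable (lebesgue_on \<Omega>) (\<lambda>x. B *\<^sub>R F x)"
    using L2_integrable[OF assms(2-4)] by simp
  show "(\<lambda>x. \<phi> x *\<^sub>R F x) \<in> borel_measurable (lebesgue_on \<Omega>)"
    using assms borel_measurable_lebesgue_on[OF test_measurable[OF assms(1)]]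
    by (intro borel_measurable_scaleR) (auto simp: L2_def)
  have "norm (\<phi> x *\<^sub>R F x) \<le> norm (B *\<^sub>R F x)" for x
    using mult_right_mono[of "\<bar>\<phi> x\<bar>" "\<bar>B\<bar>" "norm (F x)"] B[of x] by simp
  then show "AE x in lebesgue_on \<Omega>. norm (\<phi> x *\<^sub>R F x) \<le> norm (B *\<^sub>R F x)" by simp
  qed
qed

text \<open>
  A component of \<open>F\<close>, extended by zero, is Lebesgue measurable only; it agrees almost everywhere with a Borel
  function, to which the previous lemma applies.
\<close>

lemma fundamental_lemma:
  fixes F :: "real^3 \<Rightarrow> 'b::euclidean_space"
  assumes "bounded \<Omega>" "open \<Omega>" "F \<in> L2 \<Omega>"
    and zero: "\<And>\<phi>. \<phi> \<in> test_functions \<Omega> \<Longrightarrow> (LINT x|lebesgue_on \<Omega>. \<phi> x *\<^sub>R F x) = 0"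
  shows "AE x in lebesgue_on \<Omega>. F x = 0"
proof -
  have \<Omega>: "\<Omega> \<in> sets lebesgue" using assms by (simp add: borel_open)
  have "AE x in lebesgue_on \<Omega>. F x \<bullet> b = 0" if b: "b \<in> Basis" for b
  proof -
    define g where "g = (\<lambda>x. indicator \<Omega> x * (F x \<bullet> b))"
    have "integrable lebesgue (\<lambda>x. indicator \<Omega> x *\<^sub>R F x)"
      using L2_integrable[OF assms(1) \<Omega> assms(3)] \<Omega> by (simp add: integrable_restrict_space)
    then have gi: "integrable lebesgue g"
      using integrable_inner_left[of b lebesgue "\<lambda>x. indicator \<Omega> x *\<^sub>R F x"] by (simp add: g_def)
    obtain g' where g': "g' \<in> borel_measurable lborel" "AE x in lborel. g x = g' x"
      using completion_ex_borel_measurable_real[of g lborel] gi by auto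
    define G where "G = (\<lambda>x. indicator \<Omega> x * g' x)"
    have Gm: "G \<in> borel_measurable lborel"
      unfolding G_def using g' \<open>open \<Omega>\<close> by (intro borel_measurable_times borel_measurable_indicator) auto
    have gG: "AE x in lborel. g x = G x"
      using g'(2) by eventually_elim (auto simp: G_def g_def indicator_def)
    have gGc: "AE x in lebesgue. g x = G x" by (rule AE_completion[OF gG])
    have Gm': "G \<in> borel_measurable lebesgue" by (rule measurable_completion[OF Gm])
    have "integrable lebesgue G"
      using gi integrable_cong_AE[OF borel_measurable_integrable[OF gi] Gm' gGc] by simp
    then have Gi: "integrable lborel G" using Gm by (simp add: integrable_completion)
    have "AE x in lborel. G x = 0"
    proof (rule fundamental_lemma_borel[OF Gi \<open>open \<Omega>\<close>])
      show "G x = 0" if "x \<notin> \<Omega>" for x using that by (simp add: G_def)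
      fix \<phi> :: "real^3 \<Rightarrow> real" assume \<phi>: "\<phi> \<in> test_functions \<Omega>"
      have m: "\<phi> \<in> borel_measurable lebesgue"
        using test_measurable[OF \<phi>] by (simp add: measurable_completion)
      have "(LINT x|lborel. \<phi> x * G x) = (LINT x|lebesgue. \<phi> x * G x)"
        using Gm test_measurable[OF \<phi>] by (intro integral_completion[symmetric]) simp
      also have "\<dots> = (LINT x|lebesgue. \<phi> x * g x)"
        by (rule integral_cong_AE) (use gGc Gm' gi m in auto)
      also have "\<dots> = (LINT x|lebesgue. indicator \<Omega> x *\<^sub>R ((\<phi> x *\<^sub>R F x) \<bullet> b))"
        by (simp add: g_def mult_ac)
      also have "\<dots> = (LINT x|lebesgue_on \<Omega>. (\<phi> x *\<^sub>R F x) \<bullet> b)"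
        using \<Omega> by (simp add: integral_restrict_space)
      also have "\<dots> = (LINT x|lebesgue_on \<Omega>. \<phi> x *\<^sub>R F x) \<bullet> b"
        by (rule integral_inner_left) (use test_mult_L2_integrable[OF \<phi> assms(1) \<Omega> assms(3)] in simp)
      also have "\<dots> = 0" by (simp add: zero[OF \<phi>])
      finally show "(LINT x|lborel. \<phi> x * G x) = 0" .
    qed
    then have "AE x in lebesgue. g x = 0"
      using gGc AE_completion[of "\<lambda>x. G x = 0" lborel] by auto
    then have "AE x in lebesgue. x \<in> \<Omega> \<longrightarrow> F x \<bullet> b = 0"
      by eventually_elim (auto simp: g_def)
    then show ?thesis using \<Omega> by (simp add: AE_restrict_space_iff)
  qed
  then have "AE x in lebesgue_on \<Omega>. \<forall>b\<in>Basis. F x \<bullet> b = 0"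
    by (simp add: AE_finite_allI)
  then show ?thesis by eventually_elim (simp add: euclidean_all_zero_iff)
qed

section \<open>First-order operators with constant coefficients\<close>

text \<open>
  The operator \<open>\<Sum>\<^sub>j \<sigma> j \<circ> \<partial>\<^sub>j\<close>, acting on distributions. Gradient, divergence and curl are given by three such
  symbols \<open>\<sigma>\<close>, so linearity, uniqueness and duality are proved once for all of them.
\<close>

definition fo_op_distr :: "(3 \<Rightarrow> 'b::real_normed_vector \<Rightarrow> 'c::real_normed_vector) \<Rightarrow> 'b distr \<Rightarrow> 'c distr" where
  "fo_op_distr \<sigma> D = (\<lambda>\<phi>. \<Sum>j\<in>UNIV. \<sigma> j (distr_deriv j D \<phi>))"

definition fo_op :: "(3 \<Rightarrow> 'b::real_normed_vector \<Rightarrow> 'c::real_normed_vector) \<Rightarrow> (real^3 \<Rightarrow> 'b) \<Rightarrow> real^3 \<Rightarrow> 'c" where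
  "fo_op \<sigma> u = (\<lambda>x. \<Sum>j\<in>UNIV. \<sigma> j (pd j u x))"

definition grad_symbol :: "3 \<Rightarrow> real^3 \<Rightarrow> real^3^3" where
  "grad_symbol j v = (\<chi> i k. if k = j then v $ i else 0)"

definition div_symbol :: "3 \<Rightarrow> real^3^3 \<Rightarrow> real^3" where
  "div_symbol j X = (\<chi> i. X $ i $ j)"

definition curl_symbol :: "3 \<Rightarrow> real^3^3 \<Rightarrow> real^3^3" where
  "curl_symbol j X = (\<chi> i. vector
     [(if j = 2 then X $ i $ 3 else 0) - (if j = 3 then X $ i $ 2 else 0),
      (if j = 3 then X $ i $ 1 else 0) - (if j = 1 then X $ i $ 3 else 0),
      (if j = 1 then X $ i $ 2 else 0) - (if j = 2 then X $ i $ 1 else 0)])"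

lemma grad_distr_fo: "grad_distr = fo_op_distr grad_symbol"
  by (auto simp: fun_eq_iff grad_distr_def fo_op_distr_def grad_symbol_def vec_eq_iff sum.delta)

lemma div_distr_fo: "div_distr = fo_op_distr div_symbol"
  by (auto simp: fun_eq_iff div_distr_def fo_op_distr_def div_symbol_def vec_eq_iff)

lemma curl_distr_fo: "curl_distr = fo_op_distr curl_symbol"
  by (auto simp: fun_eq_iff curl_distr_def fo_op_distr_def curl_symbol_def vec_eq_iff forall_3 sum_3)

lemma linear_grad_symbol: "linear (grad_symbol j)"
  by (rule linearI) (auto simp: grad_symbol_def vec_eq_iff)

lemma linear_curl_symbol: "linear (curl_symbol j)"
  by (rule linearI) (auto simp: curl_symbol_def vec_eq_iff forall_3 algebra_simps)

lemma div_grad_adjoint: "div_symbol j X \<bullet> v = X \<bullet> grad_symbol j v"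
  by (simp add: div_symbol_def grad_symbol_def inner_vec_def if_distrib[of "\<lambda>z. _ * z"] sum.delta cong: if_cong)

lemma curl_adjoint: "curl_symbol j X \<bullet> Y = X \<bullet> - curl_symbol j Y"
  using exhaust_3[of j] by (auto simp: curl_symbol_def inner_vec_def sum_3)

lemma fo_test:
  fixes \<sigma> :: "3 \<Rightarrow> 'b::euclidean_space \<Rightarrow> 'c::euclidean_space"
  assumes \<sigma>: "\<And>j. linear (\<sigma> j)" and u: "u \<in> test_functions \<Omega>"
  shows "sqint lborel (fo_op \<sigma> u)" "fo_op \<sigma> u \<in> borel_measurable borel" "x \<notin> \<Omega> \<Longrightarrow> fo_op \<sigma> u x = 0"
proof -
  have t: "(\<lambda>x. \<sigma> j (pd j u x)) \<in> test_functions \<Omega>" for j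
    by (rule test_bounded_linear[OF test_pd[OF u] linear_conv_bounded_linear[THEN iffD1, OF \<sigma>]])
  have "sqint lborel (\<lambda>x. \<sigma> j (pd j u x))" for j by (rule test_sqint[OF t])
  then show s: "sqint lborel (fo_op \<sigma> u)"
    unfolding fo_op_def sum_3 by (intro sqint_add)
  then show "fo_op \<sigma> u \<in> borel_measurable borel" using sqint_measurable by fastforce
  show "fo_op \<sigma> u x = 0" if "x \<notin> \<Omega>"
    using test_zero[OF t that] by (simp add: fo_op_def)
qed

lemma zero_extension_L2:
  fixes F G :: "real^3 \<Rightarrow> 'b::euclidean_space"
  assumes \<Omega>: "open \<Omega>" and F: "sqint lborel F" "\<And>x. x \<notin> \<Omega> \<Longrightarrow> F x = 0"
  shows "F \<in> L2 \<Omega>" "l2 (lebesgue_on \<Omega>) F = l2 lborel F"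
proof -
  have s: "\<Omega> \<in> sets lebesgue" using \<Omega> by (simp add: borel_open)
  have m: "F \<in> borel_measurable borel" using sqint_measurable[OF F(1)] by simp
  have m2: "(\<lambda>x. (norm (F x))\<^sup>2) \<in> borel_measurable borel" using m by simp
  have z: "(norm (F x))\<^sup>2 = 0" if "x \<notin> \<Omega>" for x using F(2)[OF that] by simp
  show "F \<in> L2 \<Omega>" using F(1) lebesgue_on_integrable_extend(1)[OF s m2 z]
    by (simp add: L2_def sqint_def borel_measurable_lebesgue_on[OF m])
  show "l2 (lebesgue_on \<Omega>) F = l2 lborel F"
    unfolding l2_def using lebesgue_on_integrable_extend(2)[OF s m2 z] by simp
qed

lemma test_L2:
  fixes u :: "real^3 \<Rightarrow> 'b::euclidean_space"
  assumes "open \<Omega>" "u \<in> test_functions \<Omega>"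
  shows "u \<in> L2 \<Omega>" "l2 (lebesgue_on \<Omega>) u = l2 lborel u"
  using zero_extension_L2[OF assms(1) test_sqint[OF assms(2)] test_zero[OF assms(2)]] by auto

lemma fo_L2:
  fixes \<sigma> :: "3 \<Rightarrow> 'b::euclidean_space \<Rightarrow> 'c::euclidean_space"
  assumes "open \<Omega>" "\<And>j. linear (\<sigma> j)" "u \<in> test_functions \<Omega>"
  shows "fo_op \<sigma> u \<in> L2 \<Omega>" "l2 (lebesgue_on \<Omega>) (fo_op \<sigma> u) = l2 lborel (fo_op \<sigma> u)"
  using zero_extension_L2[OF assms(1) fo_test(1)[OF assms(2,3)] fo_test(3)[OF assms(2,3)]] by auto

definition weak_fo :: "(real^3) set \<Rightarrow> (3 \<Rightarrow> 'b::euclidean_space \<Rightarrow> 'c::euclidean_space) \<Rightarrow>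
    (real^3 \<Rightarrow> 'b) \<Rightarrow> (real^3 \<Rightarrow> 'c) \<Rightarrow> bool" where
  "weak_fo \<Omega> \<sigma> u G \<longleftrightarrow> u \<in> L2 \<Omega> \<and> G \<in> L2 \<Omega> \<and>
     distr_eq \<Omega> (fo_op_distr \<sigma> (distr_of \<Omega> u)) (distr_of \<Omega> G)"

lemma distr_of_lincomb:
  fixes u v :: "real^3 \<Rightarrow> 'b::euclidean_space"
  assumes "open \<Omega>" "bounded \<Omega>" "u \<in> L2 \<Omega>" "v \<in> L2 \<Omega>" "\<phi> \<in> test_functions \<Omega>"
  shows "distr_of \<Omega> (\<lambda>x. a *\<^sub>R u x + b *\<^sub>R v x) \<phi> = a *\<^sub>R distr_of \<Omega> u \<phi> + b *\<^sub>R distr_of \<Omega> v \<phi>"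
proof -
  have s: "\<Omega> \<in> sets lebesgue" using assms by (simp add: borel_open)
  note i = test_mult_L2_integrable[OF assms(5,2) s]
  have "(\<lambda>x. \<phi> x *\<^sub>R (a *\<^sub>R u x + b *\<^sub>R v x)) = (\<lambda>x. a *\<^sub>R (\<phi> x *\<^sub>R u x) + b *\<^sub>R (\<phi> x *\<^sub>R v x))"
    by (simp add: fun_eq_iff algebra_simps)
  then show ?thesis
    unfolding distr_of_def using i[OF assms(3)] i[OF assms(4)] by (simp del: scaleR_scaleR)
qed

lemma L2_lincomb: "u \<in> L2 \<Omega> \<Longrightarrow> v \<in> L2 \<Omega> \<Longrightarrow> (\<lambda>x. a *\<^sub>R u x + b *\<^sub>R v x) \<in> L2 \<Omega>"
  unfolding L2_iff by (intro sqint_add sqint_scale)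

lemma weak_fo_lincomb:
  assumes \<Omega>: "open \<Omega>" "bounded \<Omega>" and \<sigma>: "\<And>j. linear (\<sigma> j)"
    and u: "weak_fo \<Omega> \<sigma> u G" and v: "weak_fo \<Omega> \<sigma> v H"
  shows "weak_fo \<Omega> \<sigma> (\<lambda>x. a *\<^sub>R u x + b *\<^sub>R v x) (\<lambda>x. a *\<^sub>R G x + b *\<^sub>R H x)"
  unfolding weak_fo_def
proof (intro conjI)
  have L: "u \<in> L2 \<Omega>" "v \<in> L2 \<Omega>" "G \<in> L2 \<Omega>" "H \<in> L2 \<Omega>" using u v by (auto simp: weak_fo_def)
  then show "(\<lambda>x. a *\<^sub>R u x + b *\<^sub>R v x) \<in> L2 \<Omega>" "(\<lambda>x. a *\<^sub>R G x + b *\<^sub>R H x) \<in> L2 \<Omega>"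
    by (auto intro: L2_lincomb)
  show "distr_eq \<Omega> (fo_op_distr \<sigma> (distr_of \<Omega> (\<lambda>x. a *\<^sub>R u x + b *\<^sub>R v x)))
     (distr_of \<Omega> (\<lambda>x. a *\<^sub>R G x + b *\<^sub>R H x))"
    unfolding distr_eq_def
  proof
    fix \<phi> :: "real^3 \<Rightarrow> real" assume \<phi>: "\<phi> \<in> test_functions \<Omega>"
    have e: "distr_deriv j (distr_of \<Omega> (\<lambda>x. a *\<^sub>R u x + b *\<^sub>R v x)) \<phi> =
        a *\<^sub>R distr_deriv j (distr_of \<Omega> u) \<phi> + b *\<^sub>R distr_deriv j (distr_of \<Omega> v) \<phi>" for j
      by (simp add: distr_deriv_def distr_of_lincomb[OF \<Omega> L(1,2) test_pd[OF \<phi>]])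
    have "fo_op_distr \<sigma> (distr_of \<Omega> (\<lambda>x. a *\<^sub>R u x + b *\<^sub>R v x)) \<phi> =
        a *\<^sub>R fo_op_distr \<sigma> (distr_of \<Omega> u) \<phi> + b *\<^sub>R fo_op_distr \<sigma> (distr_of \<Omega> v) \<phi>"
      by (simp add: fo_op_distr_def e linear_add[OF \<sigma>] linear_scale[OF \<sigma>] sum.distrib scaleR_sum_right)
    also have "\<dots> = a *\<^sub>R distr_of \<Omega> G \<phi> + b *\<^sub>R distr_of \<Omega> H \<phi>"
      using u v \<phi> by (simp add: weak_fo_def distr_eq_def)
    also have "\<dots> = distr_of \<Omega> (\<lambda>x. a *\<^sub>R G x + b *\<^sub>R H x) \<phi>"
      by (simp add: distr_of_lincomb[OF \<Omega> L(3,4) \<phi>])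
    finally show "fo_op_distr \<sigma> (distr_of \<Omega> (\<lambda>x. a *\<^sub>R u x + b *\<^sub>R v x)) \<phi> =
      distr_of \<Omega> (\<lambda>x. a *\<^sub>R G x + b *\<^sub>R H x) \<phi>" .
  qed
qed

lemma distr_of_cong_AE:
  fixes u v :: "real^3 \<Rightarrow> 'b::euclidean_space"
  assumes "u \<in> L2 \<Omega>" "v \<in> L2 \<Omega>" "AE x in lebesgue_on \<Omega>. u x = v x" "\<phi> \<in> test_functions \<Omega>"
  shows "distr_of \<Omega> u \<phi> = distr_of \<Omega> v \<phi>"
  unfolding distr_of_def
  by (rule integral_cong_AE)
     (use assms borel_measurable_lebesgue_on[OF test_measurable[OF assms(4)]] in \<open>auto simp: L2_def\<close>)

text \<open>
  This makes the representatives chosen by \<^const>\<open>Grad\<close> and \<^const>\<open>Curl\<close> usable: they are linear and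
  independent of the representative of the argument, up to null sets.
\<close>

lemma weak_fo_unique:
  assumes \<Omega>: "open \<Omega>" "bounded \<Omega>"
    and u: "weak_fo \<Omega> \<sigma> u G" and v: "weak_fo \<Omega> \<sigma> v H" and uv: "AE x in lebesgue_on \<Omega>. u x = v x"
  shows "AE x in lebesgue_on \<Omega>. G x = H x"
proof -
  have L: "u \<in> L2 \<Omega>" "v \<in> L2 \<Omega>" "G \<in> L2 \<Omega>" "H \<in> L2 \<Omega>" using u v by (auto simp: weak_fo_def)
  have "AE x in lebesgue_on \<Omega>. 1 *\<^sub>R G x + (-1) *\<^sub>R H x = 0"
  proof (rule fundamental_lemma[OF \<Omega>(2,1) L2_lincomb[OF L(3,4)]])
    fix \<phi> :: "real^3 \<Rightarrow> real" assume \<phi>: "\<phi> \<in> test_functions \<Omega>"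
    have "fo_op_distr \<sigma> (distr_of \<Omega> u) \<phi> = fo_op_distr \<sigma> (distr_of \<Omega> v) \<phi>"
      using distr_of_cong_AE[OF L(1,2) uv test_pd[OF \<phi>]]
      by (simp add: fo_op_distr_def distr_deriv_def)
    then have "distr_of \<Omega> G \<phi> = distr_of \<Omega> H \<phi>"
      using u v \<phi> by (simp add: weak_fo_def distr_eq_def)
    then show "(LINT x|lebesgue_on \<Omega>. \<phi> x *\<^sub>R (1 *\<^sub>R G x + (-1) *\<^sub>R H x)) = 0"
      using distr_of_lincomb[OF \<Omega> L(3,4) \<phi>, of 1 "-1"] by (simp add: distr_of_def)
  qed
  then show ?thesis by eventually_elim simp
qed

text \<open>
  Scalar components \<open>v \<bullet> b\<close> of the test field are inserted into the distributional identity and the results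
  are summed over the basis; the pointwise adjointness of the symbols reassembles \<open>fo_op \<tau> v\<close>.
\<close>

lemma weak_fo_duality_test:
  fixes \<sigma> :: "3 \<Rightarrow> 'b::euclidean_space \<Rightarrow> 'c::euclidean_space"
  assumes \<Omega>: "open \<Omega>" "bounded \<Omega>"
    and \<tau>: "\<And>j. linear (\<tau> j)" and adj: "\<And>j X Y. \<sigma> j X \<bullet> Y = X \<bullet> \<tau> j Y"
    and F: "weak_fo \<Omega> \<sigma> F Z" and v: "v \<in> test_functions \<Omega>"
  shows "ip (lebesgue_on \<Omega>) Z v = - ip (lebesgue_on \<Omega>) F (fo_op \<tau> v)"
proof -
  have s: "\<Omega> \<in> sets lebesgue" using \<Omega> by (simp add: borel_open)
  have L: "F \<in> L2 \<Omega>" "Z \<in> L2 \<Omega>" using F by (auto simp: weak_fo_def)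
  have vb: "(\<lambda>x. v x \<bullet> b) \<in> test_functions \<Omega>" for b
    by (rule test_bounded_linear[OF v bounded_linear_inner_left])
  have pdb: "pd j (\<lambda>x. v x \<bullet> b) x = pd j v x \<bullet> b" for j b x
    by (rule pd_bounded_linear[OF v bounded_linear_inner_left])
  have i1: "integrable (lebesgue_on \<Omega>) (\<lambda>x. (v x \<bullet> b) *\<^sub>R Z x)" for b
    by (rule test_mult_L2_integrable[OF vb \<Omega>(2) s L(2)])
  have i2: "integrable (lebesgue_on \<Omega>) (\<lambda>x. (pd j v x \<bullet> b) *\<^sub>R F x)" for j b
    using test_mult_L2_integrable[OF test_pd[OF vb] \<Omega>(2) s L(1)] unfolding pdb .
  have "ip (lebesgue_on \<Omega>) Z v = (LINT x|lebesgue_on \<Omega>. (\<Sum>b\<in>Basis. ((v x \<bullet> b) *\<^sub>R Z x) \<bullet> b))"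
    unfolding ip_def by (subst euclidean_inner) (simp add: mult.commute)
  also have "\<dots> = (\<Sum>b\<in>Basis. (LINT x|lebesgue_on \<Omega>. (v x \<bullet> b) *\<^sub>R Z x) \<bullet> b)"
    using i1 by (simp add: integral_sum integral_inner_left del: inner_scaleR_left)
  also have "\<dots> = (\<Sum>b\<in>Basis. fo_op_distr \<sigma> (distr_of \<Omega> F) (\<lambda>x. v x \<bullet> b) \<bullet> b)"
    using F vb by (simp add: weak_fo_def distr_eq_def distr_of_def)
  also have "\<dots> = (\<Sum>b\<in>Basis. \<Sum>j\<in>UNIV. - (LINT x|lebesgue_on \<Omega>. (pd j v x \<bullet> b) *\<^sub>R F x) \<bullet> \<tau> j b)"
    by (simp add: fo_op_distr_def distr_deriv_def distr_of_def pdb inner_sum_left adj)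
  also have "\<dots> = (\<Sum>b\<in>Basis. \<Sum>j\<in>UNIV. - (LINT x|lebesgue_on \<Omega>. ((pd j v x \<bullet> b) *\<^sub>R F x) \<bullet> \<tau> j b))"
    using i2 by (simp add: integral_inner_left del: inner_scaleR_left)
  also have "\<dots> = - (LINT x|lebesgue_on \<Omega>. (\<Sum>b\<in>Basis. \<Sum>j\<in>UNIV. ((pd j v x \<bullet> b) *\<^sub>R F x) \<bullet> \<tau> j b))"
    using i2 by (simp add: integral_sum sum_negf del: inner_scaleR_left)
  also have "(\<lambda>x. \<Sum>b\<in>Basis. \<Sum>j\<in>UNIV. ((pd j v x \<bullet> b) *\<^sub>R F x) \<bullet> \<tau> j b) = (\<lambda>x. F x \<bullet> fo_op \<tau> v x)"
  proof
    fix x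
    have "\<tau> j (pd j v x) = (\<Sum>b\<in>Basis. (pd j v x \<bullet> b) *\<^sub>R \<tau> j b)" for j
    proof -
      have "\<tau> j (pd j v x) = \<tau> j (\<Sum>b\<in>Basis. (pd j v x \<bullet> b) *\<^sub>R b)"
        by (simp add: euclidean_representation)
      then show ?thesis by (simp add: linear_sum[OF \<tau>] linear_scale[OF \<tau>])
    qed
    then have "F x \<bullet> fo_op \<tau> v x = (\<Sum>j\<in>UNIV. \<Sum>b\<in>Basis. (pd j v x \<bullet> b) * (F x \<bullet> \<tau> j b))"
      by (simp add: fo_op_def inner_sum_right)
    then show "(\<Sum>b\<in>Basis. \<Sum>j\<in>UNIV. ((pd j v x \<bullet> b) *\<^sub>R F x) \<bullet> \<tau> j b) = F x \<bullet> fo_op \<tau> v x"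
      by (simp add: sum.swap[of _ Basis])
  qed
  finally show ?thesis by (simp add: ip_def)
qed

lemma weak_fo_test:
  fixes \<sigma> :: "3 \<Rightarrow> 'b::euclidean_space \<Rightarrow> 'c::euclidean_space"
  assumes \<Omega>: "open \<Omega>" and \<sigma>: "\<And>j. linear (\<sigma> j)" and u: "u \<in> test_functions \<Omega>"
  shows "weak_fo \<Omega> \<sigma> u (fo_op \<sigma> u)"
  unfolding weak_fo_def distr_eq_def
proof (intro conjI ballI)
  show "u \<in> L2 \<Omega>" "fo_op \<sigma> u \<in> L2 \<Omega>" using test_L2[OF \<Omega> u] fo_L2[OF \<Omega> \<sigma> u] by auto
  fix \<phi> :: "real^3 \<Rightarrow> real" assume \<phi>: "\<phi> \<in> test_functions \<Omega>"
  have s: "\<Omega> \<in> sets lebesgue" using \<Omega> by (simp add: borel_open)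
  have pm: "integrable lborel (\<lambda>x. p x *\<^sub>R w x)" if pw: "p \<in> test_functions \<Omega>" "w \<in> test_functions \<Omega>"
    for p :: "real^3 \<Rightarrow> real" and w :: "real^3 \<Rightarrow> 'b"
  proof -
    obtain B where B: "\<And>x. \<bar>p x\<bar> \<le> B" using test_bounded[OF pw(1)] by auto
    show ?thesis
    proof (rule Bochner_Integration.integrable_bound)
      show "integrable lborel (\<lambda>x. B *\<^sub>R w x)" using test_integrable[OF pw(2)] by simp
      show "(\<lambda>x. p x *\<^sub>R w x) \<in> borel_measurable lborel"
        using test_measurable[OF pw(1)] test_measurable[OF pw(2)] by simp
      have "norm (p x *\<^sub>R w x) \<le> norm (B *\<^sub>R w x)" for x
        using mult_right_mono[of "\<bar>p x\<bar>" "\<bar>B\<bar>" "norm (w x)"] B[of x] by simp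
      then show "AE x in lborel. norm (p x *\<^sub>R w x) \<le> norm (B *\<^sub>R w x)" by simp
    qed
  qed
  have toL: "distr_of \<Omega> w p = (LINT x|lborel. p x *\<^sub>R w x)"
    if "p \<in> borel_measurable borel" "w \<in> borel_measurable borel" "\<And>x. x \<notin> \<Omega> \<Longrightarrow> w x = 0"
    for p :: "real^3 \<Rightarrow> real" and w :: "real^3 \<Rightarrow> 'd::euclidean_space"
    unfolding distr_of_def by (rule lebesgue_on_integrable_extend(2)[OF s]) (use that in auto)
  have d: "distr_deriv j (distr_of \<Omega> u) \<phi> = (LINT x|lborel. \<phi> x *\<^sub>R pd j u x)" for j
  proof (rule euclidean_eqI)
    fix b :: 'b
    have ub: "(\<lambda>x. u x \<bullet> b) \<in> test_functions \<Omega>"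
      by (rule test_bounded_linear[OF u bounded_linear_inner_left])
    have "distr_deriv j (distr_of \<Omega> u) \<phi> \<bullet> b = - (LINT x|lborel. pd j \<phi> x *\<^sub>R u x) \<bullet> b"
      unfolding distr_deriv_def
      by (subst toL[OF test_measurable[OF test_pd[OF \<phi>]] test_measurable[OF u] test_zero[OF u]]) auto
    also have "\<dots> = - (LINT x|lborel. (pd j \<phi> x *\<^sub>R u x) \<bullet> b)"
      using pm[OF test_pd[OF \<phi>] u] by (simp add: integral_inner_left del: inner_scaleR_left)
    also have "\<dots> = (LINT x|lborel. \<phi> x * pd j (\<lambda>x. u x \<bullet> b) x)"
      using integral_by_parts[OF \<phi> ub, of j] by simp
    also have "\<dots> = (LINT x|lborel. (\<phi> x *\<^sub>R pd j u x) \<bullet> b)"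
      by (simp add: pd_bounded_linear[OF u bounded_linear_inner_left])
    also have "\<dots> = (LINT x|lborel. \<phi> x *\<^sub>R pd j u x) \<bullet> b"
      using pm[OF \<phi> test_pd[OF u]] by (simp add: integral_inner_left del: inner_scaleR_left)
    finally show "distr_deriv j (distr_of \<Omega> u) \<phi> \<bullet> b = (LINT x|lborel. \<phi> x *\<^sub>R pd j u x) \<bullet> b" .
  qed
  have bl: "bounded_linear (\<sigma> j)" for j using \<sigma> linear_conv_bounded_linear by blast
  have "fo_op_distr \<sigma> (distr_of \<Omega> u) \<phi> = (\<Sum>j\<in>UNIV. LINT x|lborel. \<sigma> j (\<phi> x *\<^sub>R pd j u x))"
    using integral_bounded_linear[OF bl pm[OF \<phi> test_pd[OF u]]] by (simp add: fo_op_distr_def d)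
  also have "\<dots> = (LINT x|lborel. (\<Sum>j\<in>UNIV. \<sigma> j (\<phi> x *\<^sub>R pd j u x)))"
    by (rule Bochner_Integration.integral_sum[symmetric]) (rule integrable_bounded_linear[OF bl pm[OF \<phi> test_pd[OF u]]])
  also have "\<dots> = (LINT x|lborel. \<phi> x *\<^sub>R fo_op \<sigma> u x)"
    by (simp add: linear_scale[OF \<sigma>] fo_op_def scaleR_sum_right)
  also have "\<dots> = distr_of \<Omega> (fo_op \<sigma> u) \<phi>"
    by (rule toL[OF test_measurable[OF \<phi>] fo_test(2,3)[OF \<sigma> u], symmetric])
  finally show "fo_op_distr \<sigma> (distr_of \<Omega> u) \<phi> = distr_of \<Omega> (fo_op \<sigma> u) \<phi>" .
qed

section \<open>Korn inequalities\<close>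

definition principal_minor :: "3 \<Rightarrow> 3 \<Rightarrow> real^3^3 \<Rightarrow> real" where
  "principal_minor i j X = X $ i $ i * X $ j $ j - X $ i $ j * X $ j $ i"

text \<open>
  Since \<open>2 \<bar>sym X\<bar>\<^sup>2 = \<bar>X\<bar>\<^sup>2 + tr (X X)\<close>, and \<open>tr (X X)\<close> differs from the squared trace by twice the sum of the
  principal minors.
\<close>

lemma norm_sym_part_identity:
  "(norm X)\<^sup>2 + (X $ 1 $ 1 + X $ 2 $ 2 + X $ 3 $ 3)\<^sup>2 =
    2 * (norm (sym_part X))\<^sup>2 + 2 * (principal_minor 1 2 X + principal_minor 1 3 X + principal_minor 2 3 X)"
  unfolding power2_norm_eq_inner sym_part_def principal_minor_def inner_vec_def
  by (simp add: sum_3 transpose_def power2_eq_square field_simps)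

lemma linear_sym_part: "linear sym_part"
  by (rule linearI) (auto simp: sym_part_def vec_eq_iff transpose_def algebra_simps)

lemma norm_component2_le: "\<bar>X $ i $ j\<bar> \<le> norm (X :: real^3^3)"
  by (rule order_trans[OF component_le_norm_cart Finite_Cartesian_Product.norm_nth_le])

lemma norm_sym_part_le: "norm (sym_part X) \<le> norm X"
proof -
  have t: "norm (transpose X) = norm X"
    unfolding norm_eq_sqrt_inner by (simp add: inner_vec_def sum_3 transpose_def algebra_simps)
  have "norm (X + transpose X) \<le> 2 * norm X"
    using norm_triangle_ineq[of X "transpose X"] t by simp
  then show ?thesis by (simp add: sym_part_def)
qed

lemma bounded_linear_measurable:
  "bounded_linear L \<Longrightarrow> F \<in> borel_measurable M \<Longrightarrow> (\<lambda>x. L (F x)) \<in> borel_measurable M"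
  by (rule measurable_compose[OF _ borel_measurable_continuous_onI[OF linear_continuous_on]])

lemma sym_part_measurable:
  "F \<in> borel_measurable M \<Longrightarrow> (\<lambda>x. sym_part (F x)) \<in> borel_measurable M"
  by (rule bounded_linear_measurable[OF linear_conv_bounded_linear[THEN iffD1, OF linear_sym_part]])

lemma sqint_sym_part: "sqint M F \<Longrightarrow> sqint M (\<lambda>x. sym_part (F x))"
  and l2_sym_part_le: "sqint M F \<Longrightarrow> l2 M (\<lambda>x. sym_part (F x)) \<le> l2 M F"
  using l2_dominated[OF sym_part_measurable[OF sqint_measurable], of M F F 1]
  by (simp_all add: norm_sym_part_le)

lemma component_test:
  fixes \<Phi> :: mfield
  assumes "\<Phi> \<in> test_functions \<Omega>"
  shows "(\<lambda>x. \<Phi> x $ i $ j) \<in> test_functions \<Omega>" "pd k (\<lambda>x. \<Phi> x $ i $ j) x = pd k \<Phi> x $ i $ j"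
  using test_bounded_linear[OF assms, of "\<lambda>X. X $ i $ j"] pd_bounded_linear[OF assms, of "\<lambda>X. X $ i $ j"]
    bounded_linear_compose[OF bounded_linear_vec_nth bounded_linear_vec_nth, of i j]
  by (auto simp: o_def)

lemma component_sqint:
  fixes F :: "'a \<Rightarrow> real^3^3"
  assumes "sqint M F" shows "sqint M (\<lambda>x. F x $ i $ j)" "l2 M (\<lambda>x. F x $ i $ j) \<le> l2 M F"
proof -
  have "(\<lambda>x. F x $ i $ j) \<in> borel_measurable M"
    by (rule bounded_linear_measurable[OF bounded_linear_compose[OF bounded_linear_vec_nth bounded_linear_vec_nth]
          sqint_measurable[OF assms]])
  note l2_dominated[OF this assms, of 1]
  then show "sqint M (\<lambda>x. F x $ i $ j)" "l2 M (\<lambda>x. F x $ i $ j) \<le> l2 M F"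
    by (simp_all add: norm_component2_le)
qed

lemma principal_minor_integrable:
  assumes "sqint M F" shows "integrable M (\<lambda>x. principal_minor i j (F x))"
  using sqint_integrable_inner[OF component_sqint(1)[OF assms, of i i] component_sqint(1)[OF assms, of j j]]
    sqint_integrable_inner[OF component_sqint(1)[OF assms, of i j] component_sqint(1)[OF assms, of j i]]
  by (simp add: principal_minor_def)

lemma l2_le_sym_part_minors:
  assumes "sqint M F"
  shows "(l2 M F)\<^sup>2 \<le> 2 * (l2 M (\<lambda>x. sym_part (F x)))\<^sup>2 + 2 * ((LINT x|M. principal_minor 1 2 (F x)) +
    (LINT x|M. principal_minor 1 3 (F x)) + (LINT x|M. principal_minor 2 3 (F x)))"
proof -
  have i: "integrable M (\<lambda>x. (norm (F x))\<^sup>2)" "integrable M (\<lambda>x. (norm (sym_part (F x)))\<^sup>2)"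
    using assms sqint_sym_part[OF assms] by (auto simp: sqint_def)
  note m = principal_minor_integrable[OF assms]
  have "(LINT x|M. (norm (F x))\<^sup>2) \<le> (LINT x|M. 2 * (norm (sym_part (F x)))\<^sup>2 +
      2 * (principal_minor 1 2 (F x) + principal_minor 1 3 (F x) + principal_minor 2 3 (F x)))"
  proof (rule integral_mono)
    show "(norm (F x))\<^sup>2 \<le> 2 * (norm (sym_part (F x)))\<^sup>2 +
      2 * (principal_minor 1 2 (F x) + principal_minor 1 3 (F x) + principal_minor 2 3 (F x))" for x
      unfolding norm_sym_part_identity[symmetric] by simp
  qed (use i m in auto)
  also have "\<dots> = 2 * (LINT x|M. (norm (sym_part (F x)))\<^sup>2) + 2 * ((LINT x|M. principal_minor 1 2 (F x)) +
    (LINT x|M. principal_minor 1 3 (F x)) + (LINT x|M. principal_minor 2 3 (F x)))"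
    using i m by simp
  finally show ?thesis by (simp add: l2_def)
qed

text \<open>
  The principal minors of a gradient integrate to zero.
\<close>

lemma Korn_gradient_test:
  assumes u: "u \<in> test_functions \<Omega>"
  shows "l2 lborel (fo_op grad_symbol u) \<le> 2 * l2 lborel (\<lambda>x. sym_part (fo_op grad_symbol u x))"
proof -
  have uc: "(\<lambda>x. u x $ i) \<in> test_functions \<Omega>" "pd k (\<lambda>x. u x $ i) x = pd k u x $ i" for i k x
    using test_bounded_linear[OF u bounded_linear_vec_nth] pd_bounded_linear[OF u bounded_linear_vec_nth] by auto
  have g: "fo_op grad_symbol u x $ i $ k = pd k u x $ i" for i k x
    by (simp add: fo_op_def grad_symbol_def sum.delta)
  have i: "integrable lborel (\<lambda>x. pd k u x $ i * pd l u x $ j)" for i j k l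
    using test_mult_integrable[OF test_pd[OF uc(1)[of i]] test_integrable[OF test_pd[OF uc(1)[of j]]],
      where c = 0] by (simp add: uc(2))
  have m: "(LINT x|lborel. principal_minor i j (fo_op grad_symbol u x)) = 0" for i j
    using integral_pd_swap[OF uc(1)[of i] uc(1)[of j], where i = i and j = j] i
    by (simp add: principal_minor_def g uc(2))
  have s: "sqint lborel (fo_op grad_symbol u)" by (rule fo_test(1)[OF linear_grad_symbol u])
  have "(l2 lborel (fo_op grad_symbol u))\<^sup>2 \<le> 2 * (l2 lborel (\<lambda>x. sym_part (fo_op grad_symbol u x)))\<^sup>2"
    using l2_le_sym_part_minors[OF s] m by simp
  also have "\<dots> \<le> (2 * l2 lborel (\<lambda>x. sym_part (fo_op grad_symbol u x)))\<^sup>2"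
    by (simp add: power_mult_distrib)
  finally show ?thesis
    by (rule power2_le_imp_le) (simp add: l2_nonneg)
qed

text \<open>
  Each principal minor integrates to at most \<open>2 d \<parallel>\<Phi>\<parallel> \<parallel>Curl \<Phi>\<parallel>\<close>, as the curls of the two rows involved are
  entries of \<open>Curl \<Phi>\<close> up to sign. The resulting quadratic inequality for \<open>\<parallel>\<Phi>\<parallel>\<close> is solved for \<open>\<parallel>\<Phi>\<parallel>\<close>.
\<close>

lemma Korn_curl_test:
  assumes \<Phi>: "\<Phi> \<in> test_functions \<Omega>"
    and diam: "\<And>x y. x \<in> \<Omega> \<Longrightarrow> y \<in> \<Omega> \<Longrightarrow> dist x y < d" and d: "d \<ge> 0"
  shows "l2 lborel \<Phi> \<le> 2 * l2 lborel (\<lambda>x. sym_part (\<Phi> x)) + 12 * d * l2 lborel (fo_op curl_symbol \<Phi>)"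
proof -
  let ?C = "fo_op curl_symbol \<Phi>"
  define a s c where "a = l2 lborel \<Phi>" and "s = l2 lborel (\<lambda>x. sym_part (\<Phi> x))" and "c = l2 lborel ?C"
  have nn: "0 \<le> a" "0 \<le> s" "0 \<le> c" by (simp_all add: a_def s_def c_def l2_nonneg)
  note P = component_test[OF \<Phi>]
  have sP: "sqint lborel \<Phi>" by (rule test_sqint[OF \<Phi>])
  have sC: "sqint lborel ?C" by (rule fo_test(1)[OF linear_curl_symbol \<Phi>])
  have C: "?C x $ i $ 1 = pd 2 \<Phi> x $ i $ 3 - pd 3 \<Phi> x $ i $ 2"
    "?C x $ i $ 2 = pd 3 \<Phi> x $ i $ 1 - pd 1 \<Phi> x $ i $ 3"
    "?C x $ i $ 3 = pd 1 \<Phi> x $ i $ 2 - pd 2 \<Phi> x $ i $ 1" for i x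
    by (simp_all add: fo_op_def curl_symbol_def sum_3)
  have key: "(LINT x|lborel. principal_minor i j (\<Phi> x)) \<le> 2 * d * a * c"
    if "l2 lborel (\<lambda>x. pd i \<Phi> x $ j $ j - pd j \<Phi> x $ j $ i) \<le> c"
       "l2 lborel (\<lambda>x. pd i \<Phi> x $ i $ j - pd j \<Phi> x $ i $ i) \<le> c" for i j
  proof -
    have "(LINT x|lborel. principal_minor i j (\<Phi> x)) \<le> d * (l2 lborel (\<lambda>x. \<Phi> x $ i $ i) * l2 lborel (\<lambda>x. pd i \<Phi> x $ j $ j - pd j \<Phi> x $ j $ i)
       + l2 lborel (\<lambda>x. pd i \<Phi> x $ i $ j - pd j \<Phi> x $ i $ i) * l2 lborel (\<lambda>x. \<Phi> x $ j $ i))"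
      using minor_integral_bound[OF P(1)[of i i] P(1)[of i j] P(1)[of j i] P(1)[of j j] diam d, of i j]
      by (simp add: P(2) principal_minor_def)
    also have "\<dots> \<le> d * (a * c + c * a)"
      using component_sqint(2)[OF sP] that nn d unfolding a_def[symmetric]
      by (intro mult_left_mono add_mono mult_mono) (auto simp: l2_nonneg)
    finally show ?thesis by (simp add: algebra_simps)
  qed
  have cc: "l2 lborel (\<lambda>x. ?C x $ i $ j) \<le> c" for i j
    unfolding c_def by (rule component_sqint(2)[OF sC])
  have "(LINT x|lborel. principal_minor 1 2 (\<Phi> x)) \<le> 2 * d * a * c"
    by (rule key) (use cc[of 2 3] cc[of 1 3] in \<open>simp_all add: C\<close>)
  moreover have "(LINT x|lborel. principal_minor 1 3 (\<Phi> x)) \<le> 2 * d * a * c"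
    by (rule key; subst l2_minus_commute) (use cc[of 3 2] cc[of 1 2] in \<open>simp_all add: C\<close>)
  moreover have "(LINT x|lborel. principal_minor 2 3 (\<Phi> x)) \<le> 2 * d * a * c"
    by (rule key) (use cc[of 3 1] cc[of 2 1] in \<open>simp_all add: C\<close>)
  ultimately have "a\<^sup>2 \<le> 2 * s\<^sup>2 + 12 * d * a * c"
    using l2_le_sym_part_minors[OF sP] by (simp add: a_def s_def)
  have "a \<le> 2 * s + 12 * d * c"
  proof (rule ccontr)
    assume "\<not> ?thesis"
    then have lt: "2 * s + 12 * d * c < a" by simp
    have dc: "0 \<le> d * c" using d nn by simp

    have "a > 0" using lt nn dc by linarith
    have "a * (2 * s + 12 * d * c) < a * a" using lt \<open>a > 0\<close> by simp
    moreover have "2 * s \<le> a" using lt dc by linarith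
    then have "s * (2 * s) \<le> s * a" using nn by (intro mult_left_mono)
    moreover have "a * a \<le> 2 * s\<^sup>2 + 12 * d * a * c" using \<open>a\<^sup>2 \<le> _\<close> by (simp add: power2_eq_square)
    moreover have "0 \<le> s * a" using nn by simp
    moreover have "a * (2 * s + 12 * d * c) = 2 * (s * a) + 12 * d * a * c" by (simp add: algebra_simps)
    moreover have "s * (2 * s) = 2 * s\<^sup>2" "0 \<le> s\<^sup>2" by (simp_all add: power2_eq_square)
    ultimately show False by linarith
  qed
  then show ?thesis by (simp add: a_def s_def c_def)
qed

text \<open>
  The pair of \<open>u\<close> and \<open>G\<close> lies in the closure of the graph of \<open>\<sigma>\<close> on test functions. For the symbols of gradient
  and curl this is membership in \<^const>\<open>H1_0\<close> and \<^const>\<open>HCurl_0\<close>, with \<open>G\<close> the weak derivative.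
\<close>

definition fo_closure :: "(real^3) set \<Rightarrow> (3 \<Rightarrow> 'b::euclidean_space \<Rightarrow> 'c::euclidean_space) \<Rightarrow>
    (real^3 \<Rightarrow> 'b) \<Rightarrow> (real^3 \<Rightarrow> 'c) \<Rightarrow> bool" where
  "fo_closure \<Omega> \<sigma> u G \<longleftrightarrow> u \<in> L2 \<Omega> \<and> G \<in> L2 \<Omega> \<and>
     (\<forall>\<epsilon>>0. \<exists>\<phi>\<in>test_functions \<Omega>. l2 (lebesgue_on \<Omega>) (\<lambda>x. u x - \<phi> x) < \<epsilon> \<and>
        l2 (lebesgue_on \<Omega>) (\<lambda>x. G x - fo_op \<sigma> \<phi> x) < \<epsilon>)"

lemma fo_closure_sqint:
  "fo_closure \<Omega> \<sigma> u G \<Longrightarrow> sqint (lebesgue_on \<Omega>) u" "fo_closure \<Omega> \<sigma> u G \<Longrightarrow> sqint (lebesgue_on \<Omega>) G"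
  by (auto simp: fo_closure_def L2_iff)

lemma le_if_le_add_multiple:
  fixes a b K :: real
  assumes "\<And>\<epsilon>. \<epsilon> > 0 \<Longrightarrow> a \<le> b + K * \<epsilon>" "K \<ge> 0"
  shows "a \<le> b"
proof (rule field_le_epsilon)
  fix e :: real assume e: "e > 0"
  have "K * (e / (K + 1)) \<le> e" using e assms(2) by (simp add: field_simps)
  then show "a \<le> b + e" using assms(1)[of "e / (K + 1)"] e assms(2) by simp
qed

lemma Korn_gradient:
  assumes \<Omega>: "open \<Omega>" and u: "fo_closure \<Omega> grad_symbol u G"
  shows "l2 (lebesgue_on \<Omega>) G \<le> 2 * l2 (lebesgue_on \<Omega>) (\<lambda>x. sym_part (G x))"
proof (rule le_if_le_add_multiple[where K = 3])
  fix \<epsilon> :: real assume "\<epsilon> > 0"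
  let ?M = "lebesgue_on \<Omega>"
  obtain \<phi> where \<phi>: "\<phi> \<in> test_functions \<Omega>" "l2 ?M (\<lambda>x. G x - fo_op grad_symbol \<phi> x) < \<epsilon>"
    using u \<open>\<epsilon> > 0\<close> unfolding fo_closure_def by blast
  let ?g = "fo_op grad_symbol \<phi>"
  note z = fo_test[OF linear_grad_symbol \<phi>(1)]
  have sg: "sqint ?M ?g" using fo_L2(1)[OF \<Omega> linear_grad_symbol \<phi>(1)] by (simp add: L2_iff)
  have sG: "sqint ?M G" using u by (rule fo_closure_sqint)
  have "l2 ?M ?g = l2 lborel ?g" by (rule fo_L2(2)[OF \<Omega> linear_grad_symbol \<phi>(1)])
  moreover have "l2 ?M (\<lambda>x. sym_part (?g x)) = l2 lborel (\<lambda>x. sym_part (?g x))"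
    by (rule zero_extension_L2(2)[OF \<Omega> sqint_sym_part[OF z(1)]])
       (simp add: z(3) linear_0[OF linear_sym_part])
  ultimately have "l2 ?M ?g \<le> 2 * l2 ?M (\<lambda>x. sym_part (?g x))"
    using Korn_gradient_test[OF \<phi>(1)] by simp
  moreover have "l2 ?M G \<le> l2 ?M ?g + \<epsilon>" using l2_le_add_diff[OF sG sg] \<phi>(2) by simp
  moreover have "l2 ?M (\<lambda>x. sym_part (?g x)) \<le> l2 ?M (\<lambda>x. sym_part (G x)) + \<epsilon>"
  proof -
    have "l2 ?M (\<lambda>x. sym_part (?g x) - sym_part (G x)) = l2 ?M (\<lambda>x. sym_part (?g x - G x))"
      by (simp add: linear_diff[OF linear_sym_part])
    also have "\<dots> \<le> l2 ?M (\<lambda>x. ?g x - G x)" by (rule l2_sym_part_le[OF sqint_diff[OF sg sG]])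
    also have "\<dots> \<le> \<epsilon>" using \<phi>(2) l2_minus_commute[of ?M ?g G] by simp
    finally show ?thesis
      using l2_le_add_diff[OF sqint_sym_part[OF sg] sqint_sym_part[OF sG]] by simp
  qed
  ultimately show "l2 ?M G \<le> 2 * l2 ?M (\<lambda>x. sym_part (G x)) + 3 * \<epsilon>" by linarith
qed simp

text \<open>
  The estimate for test fields passes to limits in the graph norm. The domain enters the constant through its
  diameter, beyond which the shifted supports in the estimate of the minors are disjoint.
\<close>

lemma Korn_curl:
  assumes \<Omega>: "open \<Omega>" and P: "fo_closure \<Omega> curl_symbol P Q"
    and diam: "\<And>x y. x \<in> \<Omega> \<Longrightarrow> y \<in> \<Omega> \<Longrightarrow> dist x y < d" and d: "d \<ge> 0"
  shows "l2 (lebesgue_on \<Omega>) P \<le> 2 * l2 (lebesgue_on \<Omega>) (\<lambda>x. sym_part (P x)) + 12 * d * l2 (lebesgue_on \<Omega>) Q"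
proof (rule le_if_le_add_multiple[where K = "3 + 12 * d"])
  fix \<epsilon> :: real assume "\<epsilon> > 0"
  let ?M = "lebesgue_on \<Omega>"
  obtain \<phi> where \<phi>: "\<phi> \<in> test_functions \<Omega>" "l2 ?M (\<lambda>x. P x - \<phi> x) < \<epsilon>"
      "l2 ?M (\<lambda>x. Q x - fo_op curl_symbol \<phi> x) < \<epsilon>"
    using P \<open>\<epsilon> > 0\<close> unfolding fo_closure_def by blast
  let ?g = "fo_op curl_symbol \<phi>"
  have sp: "sqint ?M \<phi>" using test_L2(1)[OF \<Omega> \<phi>(1)] by (simp add: L2_iff)
  have sg: "sqint ?M ?g" using fo_L2(1)[OF \<Omega> linear_curl_symbol \<phi>(1)] by (simp add: L2_iff)
  have sP: "sqint ?M P" and sQ: "sqint ?M Q" using P by (auto dest: fo_closure_sqint)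
  have "l2 ?M \<phi> = l2 lborel \<phi>" by (rule test_L2(2)[OF \<Omega> \<phi>(1)])
  moreover have "l2 ?M (\<lambda>x. sym_part (\<phi> x)) = l2 lborel (\<lambda>x. sym_part (\<phi> x))"
    by (rule zero_extension_L2(2)[OF \<Omega> sqint_sym_part[OF test_sqint[OF \<phi>(1)]]])
       (simp add: test_zero[OF \<phi>(1)] linear_0[OF linear_sym_part])
  moreover have "l2 ?M ?g = l2 lborel ?g" by (rule fo_L2(2)[OF \<Omega> linear_curl_symbol \<phi>(1)])
  ultimately have "l2 ?M \<phi> \<le> 2 * l2 ?M (\<lambda>x. sym_part (\<phi> x)) + 12 * d * l2 ?M ?g"
    using Korn_curl_test[OF \<phi>(1) diam d] by simp
  moreover have "l2 ?M P \<le> l2 ?M \<phi> + \<epsilon>" using l2_le_add_diff[OF sP sp] \<phi>(2) by simp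
  moreover have "l2 ?M ?g \<le> l2 ?M Q + \<epsilon>"
    using l2_le_add_diff[OF sg sQ] \<phi>(3) l2_minus_commute[of ?M ?g Q] by simp
  then have "12 * d * l2 ?M ?g \<le> 12 * d * (l2 ?M Q + \<epsilon>)" using d by (intro mult_left_mono) auto
  moreover have "l2 ?M (\<lambda>x. sym_part (\<phi> x)) \<le> l2 ?M (\<lambda>x. sym_part (P x)) + \<epsilon>"
  proof -
    have "l2 ?M (\<lambda>x. sym_part (\<phi> x) - sym_part (P x)) = l2 ?M (\<lambda>x. sym_part (\<phi> x - P x))"
      by (simp add: linear_diff[OF linear_sym_part])
    also have "\<dots> \<le> l2 ?M (\<lambda>x. \<phi> x - P x)" by (rule l2_sym_part_le[OF sqint_diff[OF sp sP]])
    also have "\<dots> \<le> \<epsilon>" using \<phi>(2) l2_minus_commute[of ?M \<phi> P] by simp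
    finally show ?thesis
      using l2_le_add_diff[OF sqint_sym_part[OF sp] sqint_sym_part[OF sP]] by simp
  qed
  ultimately show "l2 ?M P \<le> 2 * l2 ?M (\<lambda>x. sym_part (P x)) + 12 * d * l2 ?M Q + (3 + 12 * d) * \<epsilon>"
    by (simp add: algebra_simps)
qed (use d in simp)

text \<open>
  Both sides are continuous in the graph norm of \<open>\<tau>\<close>, so it suffices to have the identity for test fields. The
  factor is \<open>c = 1\<close> for divergence and gradient, and \<open>c = - 1\<close> for curl against itself.
\<close>

lemma weak_fo_duality:
  fixes \<sigma> :: "3 \<Rightarrow> 'b::euclidean_space \<Rightarrow> 'c::euclidean_space"
  assumes \<Omega>: "open \<Omega>" "bounded \<Omega>"
    and \<tau>: "\<And>j. linear (\<tau> j)" and adj: "\<And>j X Y. \<sigma> j X \<bullet> Y = X \<bullet> c *\<^sub>R \<tau> j Y"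
    and F: "weak_fo \<Omega> \<sigma> F Z" and v: "fo_closure \<Omega> \<tau> v G"
  shows "ip (lebesgue_on \<Omega>) Z v = - c * ip (lebesgue_on \<Omega>) F G"
proof -
  let ?M = "lebesgue_on \<Omega>"
  have sF: "sqint ?M F" and sZ: "sqint ?M Z" using F by (auto simp: weak_fo_def L2_iff)
  have sv: "sqint ?M v" and sG: "sqint ?M G" using v by (auto dest: fo_closure_sqint)
  have "\<bar>ip ?M Z v + c * ip ?M F G\<bar> \<le> 0"
  proof (rule le_if_le_add_multiple[where K = "l2 ?M Z + \<bar>c\<bar> * l2 ?M F"])
    fix \<epsilon> :: real assume "\<epsilon> > 0"
    then obtain \<phi> where \<phi>: "\<phi> \<in> test_functions \<Omega>" "l2 ?M (\<lambda>x. v x - \<phi> x) < \<epsilon>"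
      "l2 ?M (\<lambda>x. G x - fo_op \<tau> \<phi> x) < \<epsilon>"
      using v unfolding fo_closure_def by blast
    have sp: "sqint ?M \<phi>" using test_L2(1)[OF \<Omega>(1) \<phi>(1)] by (simp add: L2_iff)
    have sg: "sqint ?M (fo_op \<tau> \<phi>)" using fo_L2(1)[OF \<Omega>(1) \<tau> \<phi>(1)] by (simp add: L2_iff)
    have lc: "linear (\<lambda>Y. c *\<^sub>R \<tau> j Y)" for j
      by (rule linear_compose_scale_right[OF \<tau>])
    have "fo_op (\<lambda>j Y. c *\<^sub>R \<tau> j Y) \<phi> = (\<lambda>x. c *\<^sub>R fo_op \<tau> \<phi> x)"
      by (simp add: fo_op_def scaleR_sum_right)
    then have "ip ?M Z \<phi> = - c * ip ?M F (fo_op \<tau> \<phi>)"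
      using weak_fo_duality_test[OF \<Omega> lc adj F \<phi>(1)] ip_scale[of ?M c "fo_op \<tau> \<phi>" F]
      by (simp add: ip_commute[of ?M F])
    then have "ip ?M Z v + c * ip ?M F G = ip ?M (\<lambda>x. v x - \<phi> x) Z + c * ip ?M (\<lambda>x. G x - fo_op \<tau> \<phi> x) F"
      by (simp add: ip_diff[OF sv sp sZ] ip_diff[OF sG sg sF] ip_commute[of ?M Z] ip_commute[of ?M F] algebra_simps)
    also have "\<bar>\<dots>\<bar> \<le> \<epsilon> * l2 ?M Z + \<bar>c\<bar> * (\<epsilon> * l2 ?M F)"
    proof -
      have "\<bar>ip ?M (\<lambda>x. v x - \<phi> x) Z\<bar> \<le> \<epsilon> * l2 ?M Z"
        using ip_Cauchy_Schwarz[OF sqint_diff[OF sv sp] sZ]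
          mult_right_mono[OF less_imp_le[OF \<phi>(2)] l2_nonneg[of ?M Z]] by linarith
      moreover have "\<bar>ip ?M (\<lambda>x. G x - fo_op \<tau> \<phi> x) F\<bar> \<le> \<epsilon> * l2 ?M F"
        using ip_Cauchy_Schwarz[OF sqint_diff[OF sG sg] sF]
          mult_right_mono[OF less_imp_le[OF \<phi>(3)] l2_nonneg[of ?M F]] by linarith
      then have "\<bar>c * ip ?M (\<lambda>x. G x - fo_op \<tau> \<phi> x) F\<bar> \<le> \<bar>c\<bar> * (\<epsilon> * l2 ?M F)"
        unfolding abs_mult by (rule mult_left_mono) simp
      ultimately show ?thesis by linarith
    qed
    finally show "\<bar>ip ?M Z v + c * ip ?M F G\<bar> \<le> 0 + (l2 ?M Z + \<bar>c\<bar> * l2 ?M F) * \<epsilon>"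
      by (simp add: algebra_simps)
  qed (simp add: l2_nonneg)
  then show ?thesis by simp
qed

section \<open>Sobolev spaces and weak derivatives\<close>

lemma weak_grad_iff:
  "weak_fo \<Omega> grad_symbol u G \<longleftrightarrow> u \<in> L2 \<Omega> \<and> G \<in> L2 \<Omega> \<and> distr_eq \<Omega> (grad_distr (distr_of \<Omega> u)) (distr_of \<Omega> G)"
  by (simp add: weak_fo_def grad_distr_fo)

lemma weak_curl_iff:
  "weak_fo \<Omega> curl_symbol u G \<longleftrightarrow> u \<in> L2 \<Omega> \<and> G \<in> L2 \<Omega> \<and> distr_eq \<Omega> (curl_distr (distr_of \<Omega> u)) (distr_of \<Omega> G)"
  by (simp add: weak_fo_def curl_distr_fo)

lemma H1_iff: "u \<in> H1 \<Omega> \<longleftrightarrow> (\<exists>G. weak_fo \<Omega> grad_symbol u G)"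
  by (auto simp: H1_def weak_grad_iff)

lemma HCurl_iff: "u \<in> HCurl \<Omega> \<longleftrightarrow> (\<exists>G. weak_fo \<Omega> curl_symbol u G)"
  by (auto simp: HCurl_def weak_curl_iff)

lemma weak_Grad: "u \<in> H1 \<Omega> \<Longrightarrow> weak_fo \<Omega> grad_symbol u (Grad \<Omega> u)"
proof -
  assume "u \<in> H1 \<Omega>"
  then have u: "u \<in> L2 \<Omega>" and ex: "\<exists>G. G \<in> L2 \<Omega> \<and> distr_eq \<Omega> (grad_distr (distr_of \<Omega> u)) (distr_of \<Omega> G)"
    by (auto simp: H1_def)
  show ?thesis unfolding weak_grad_iff Grad_def using u someI_ex[OF ex] by blast
qed

lemma weak_Curl: "u \<in> HCurl \<Omega> \<Longrightarrow> weak_fo \<Omega> curl_symbol u (Curl \<Omega> u)"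
proof -
  assume "u \<in> HCurl \<Omega>"
  then have u: "u \<in> L2 \<Omega>" and ex: "\<exists>G. G \<in> L2 \<Omega> \<and> distr_eq \<Omega> (curl_distr (distr_of \<Omega> u)) (distr_of \<Omega> G)"
    by (auto simp: HCurl_def)
  show ?thesis unfolding weak_curl_iff Curl_def using u someI_ex[OF ex] by blast
qed

lemma L2_norm_Grad:
  assumes \<Omega>: "open \<Omega>" "bounded \<Omega>" and u: "weak_fo \<Omega> grad_symbol u G"
  shows "L2_norm \<Omega> (Grad \<Omega> u) = l2 (lebesgue_on \<Omega>) G"
proof -
  have w: "weak_fo \<Omega> grad_symbol u (Grad \<Omega> u)" using u H1_iff weak_Grad by blast
  have "AE x in lebesgue_on \<Omega>. Grad \<Omega> u x = G x"
    by (rule weak_fo_unique[OF \<Omega> w u]) simp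
  then show ?thesis unfolding L2_norm_eq
    using w u by (intro l2_cong_AE) (auto simp: weak_fo_def L2_iff)
qed

lemma L2_norm_Curl:
  assumes \<Omega>: "open \<Omega>" "bounded \<Omega>" and u: "weak_fo \<Omega> curl_symbol u G"
  shows "L2_norm \<Omega> (Curl \<Omega> u) = l2 (lebesgue_on \<Omega>) G"
proof -
  have w: "weak_fo \<Omega> curl_symbol u (Curl \<Omega> u)" using u HCurl_iff weak_Curl by blast
  have "AE x in lebesgue_on \<Omega>. Curl \<Omega> u x = G x"
    by (rule weak_fo_unique[OF \<Omega> w u]) simp
  then show ?thesis unfolding L2_norm_eq
    using w u by (intro l2_cong_AE) (auto simp: weak_fo_def L2_iff)
qed

lemma sqrt_sum_squares_lt:
  fixes a b :: real
  assumes "sqrt (a\<^sup>2 + b\<^sup>2) < e" shows "a < e" "b < e"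
  using real_sqrt_sum_squares_ge1[of a b] real_sqrt_sum_squares_ge2[of b a] assms by linarith+

lemma weak_fo_diff:
  assumes "open \<Omega>" "bounded \<Omega>" "\<And>j. linear (\<sigma> j)" "weak_fo \<Omega> \<sigma> u G" "weak_fo \<Omega> \<sigma> v H"
  shows "weak_fo \<Omega> \<sigma> (\<lambda>x. u x - v x) (\<lambda>x. G x - H x)"
  using weak_fo_lincomb[OF assms, of 1 "-1"] by simp

lemma H1_0_closure:
  assumes \<Omega>: "open \<Omega>" "bounded \<Omega>" and u: "u \<in> H1_0 \<Omega>"
  shows "fo_closure \<Omega> grad_symbol u (Grad \<Omega> u)"
proof -
  have w: "weak_fo \<Omega> grad_symbol u (Grad \<Omega> u)" using u weak_Grad by (simp add: H1_0_def)
  have "\<exists>\<phi>\<in>test_functions \<Omega>. l2 (lebesgue_on \<Omega>) (\<lambda>x. u x - \<phi> x) < \<epsilon> \<and>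
        l2 (lebesgue_on \<Omega>) (\<lambda>x. Grad \<Omega> u x - fo_op grad_symbol \<phi> x) < \<epsilon>" if e: "\<epsilon> > 0" for \<epsilon>
  proof -
    obtain \<phi> where \<phi>: "\<phi> \<in> test_functions \<Omega>" "H1_norm \<Omega> (\<lambda>x. u x - \<phi> x) < \<epsilon>"
      using u e unfolding H1_0_def by blast
    show ?thesis
      using \<phi>(1) sqrt_sum_squares_lt[OF \<phi>(2)[unfolded H1_norm_def]]
        L2_norm_Grad[OF \<Omega> weak_fo_diff[OF \<Omega> linear_grad_symbol w weak_fo_test[OF \<Omega>(1) linear_grad_symbol \<phi>(1)]]]
      by (auto simp: L2_norm_eq)
  qed
  then show ?thesis using w unfolding fo_closure_def weak_fo_def by blast
qed

lemma HCurl_0_closure: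
  assumes \<Omega>: "open \<Omega>" "bounded \<Omega>" and u: "u \<in> HCurl_0 \<Omega>"
  shows "fo_closure \<Omega> curl_symbol u (Curl \<Omega> u)"
proof -
  have w: "weak_fo \<Omega> curl_symbol u (Curl \<Omega> u)" using u weak_Curl by (simp add: HCurl_0_def)
  have "\<exists>\<phi>\<in>test_functions \<Omega>. l2 (lebesgue_on \<Omega>) (\<lambda>x. u x - \<phi> x) < \<epsilon> \<and>
        l2 (lebesgue_on \<Omega>) (\<lambda>x. Curl \<Omega> u x - fo_op curl_symbol \<phi> x) < \<epsilon>" if e: "\<epsilon> > 0" for \<epsilon>
  proof -
    obtain \<phi> where \<phi>: "\<phi> \<in> test_functions \<Omega>" "HCurl_norm \<Omega> (\<lambda>x. u x - \<phi> x) < \<epsilon>"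
      using u e unfolding HCurl_0_def by blast
    show ?thesis
      using \<phi>(1) sqrt_sum_squares_lt[OF \<phi>(2)[unfolded HCurl_norm_def]]
        L2_norm_Curl[OF \<Omega> weak_fo_diff[OF \<Omega> linear_curl_symbol w weak_fo_test[OF \<Omega>(1) linear_curl_symbol \<phi>(1)]]]
      by (auto simp: L2_norm_eq)
  qed
  then show ?thesis using w unfolding fo_closure_def weak_fo_def by blast
qed

section \<open>Quadratic forms along differentiable paths\<close>

definition l2_deriv :: "'a measure \<Rightarrow> real set \<Rightarrow> (real \<Rightarrow> 'a \<Rightarrow> 'b::euclidean_space) \<Rightarrow> ('a \<Rightarrow> 'b) \<Rightarrow> real \<Rightarrow> bool" where
  "l2_deriv M I F F' t \<longleftrightarrow>
     ((\<lambda>s. l2 M (\<lambda>x. (1 / (s - t)) *\<^sub>R (F s x - F t x) - F' x)) \<longlongrightarrow> 0) (at t within I)"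

text \<open>
  The pointwise properties of a coefficient tensor that make its quadratic form on \<open>L\<^sup>2\<close> symmetric and
  bounded.
\<close>

definition selfadjoint_coeff :: "'a measure \<Rightarrow> ('a \<Rightarrow> 'b::euclidean_space \<Rightarrow> 'b) \<Rightarrow> real \<Rightarrow> bool" where
  "selfadjoint_coeff M a c \<longleftrightarrow> 0 \<le> c \<and>
     (\<forall>x\<in>space M. linear (a x) \<and> (\<forall>X Y. a x X \<bullet> Y = X \<bullet> a x Y) \<and> (\<forall>X. norm (a x X) \<le> c * norm X)) \<and>
     (\<forall>F\<in>borel_measurable M. (\<lambda>x. a x (F x)) \<in> borel_measurable M)"

definition qf :: "'a measure \<Rightarrow> ('a \<Rightarrow> 'b::euclidean_space \<Rightarrow> 'b) \<Rightarrow> ('a \<Rightarrow> 'b) \<Rightarrow> ('a \<Rightarrow> 'b) \<Rightarrow> real" where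
  "qf M a F G = ip M (\<lambda>x. a x (F x)) G"

lemma selfadjoint_coeff_sqint:
  assumes a: "selfadjoint_coeff M a c" and F: "sqint M F"
  shows "sqint M (\<lambda>x. a x (F x))" "l2 M (\<lambda>x. a x (F x)) \<le> c * l2 M F"
proof -
  have m: "(\<lambda>x. a x (F x)) \<in> borel_measurable M" using a sqint_measurable[OF F] by (auto simp: selfadjoint_coeff_def)
  have b: "norm (a x (F x)) \<le> c * norm (F x)" if "x \<in> space M" for x using a that by (auto simp: selfadjoint_coeff_def)
  show "sqint M (\<lambda>x. a x (F x))" "l2 M (\<lambda>x. a x (F x)) \<le> c * l2 M F"
    using l2_dominated[OF m F b] a by (auto simp: selfadjoint_coeff_def)
qed

lemma qf_commute:
  assumes "selfadjoint_coeff M a c" shows "qf M a F G = qf M a G F"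
  unfolding qf_def ip_def
  by (rule Bochner_Integration.integral_cong) (use assms in \<open>auto simp: selfadjoint_coeff_def inner_commute\<close>)

lemma qf_bound:
  assumes a: "selfadjoint_coeff M a c" and F: "sqint M F" and G: "sqint M G"
  shows "\<bar>qf M a F G\<bar> \<le> c * l2 M F * l2 M G"
proof -
  have "\<bar>qf M a F G\<bar> \<le> l2 M (\<lambda>x. a x (F x)) * l2 M G"
    unfolding qf_def by (rule ip_Cauchy_Schwarz[OF selfadjoint_coeff_sqint(1)[OF a F] G])
  also have "\<dots> \<le> (c * l2 M F) * l2 M G"
    by (rule mult_right_mono[OF selfadjoint_coeff_sqint(2)[OF a F] l2_nonneg])
  finally show ?thesis .
qed

lemma qf_add:
  assumes a: "selfadjoint_coeff M a c" and s: "sqint M F" "sqint M G" "sqint M H"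
  shows "qf M a (\<lambda>x. F x + G x) H = qf M a F H + qf M a G H"
proof -
  have "qf M a (\<lambda>x. F x + G x) H = ip M (\<lambda>x. a x (F x) + a x (G x)) H"
    unfolding qf_def ip_def
    by (rule Bochner_Integration.integral_cong) (use a in \<open>auto simp: selfadjoint_coeff_def linear_add\<close>)
  also have "\<dots> = qf M a F H + qf M a G H"
    unfolding qf_def by (rule ip_add[OF selfadjoint_coeff_sqint(1)[OF a s(1)] selfadjoint_coeff_sqint(1)[OF a s(2)] s(3)])
  finally show ?thesis .
qed

lemma qf_scale:
  assumes a: "selfadjoint_coeff M a c"
  shows "qf M a (\<lambda>x. k *\<^sub>R F x) H = k * qf M a F H"
proof -
  have "qf M a (\<lambda>x. k *\<^sub>R F x) H = ip M (\<lambda>x. k *\<^sub>R a x (F x)) H"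
    unfolding qf_def ip_def
    by (rule Bochner_Integration.integral_cong) (use a in \<open>auto simp: selfadjoint_coeff_def linear_scale\<close>)
  then show ?thesis by (simp add: ip_scale qf_def)
qed

lemma qf_square_add:
  assumes a: "selfadjoint_coeff M a c" and s: "sqint M F" "sqint M G"
  shows "qf M a (\<lambda>x. F x + G x) (\<lambda>x. F x + G x) = qf M a F F + 2 * qf M a G F + qf M a G G"
  unfolding qf_add[OF a s sqint_add[OF s]]
  by (subst (1 2) qf_commute[OF a])
     (simp add: qf_add[OF a s s(1)] qf_add[OF a s s(2)] qf_commute[OF a, of F G])

lemma qf_continuous:
  assumes a: "selfadjoint_coeff M a c" and F: "\<And>s. s \<in> I \<Longrightarrow> sqint M (F s)" and t: "t \<in> I"
    and lim: "((\<lambda>s. l2 M (\<lambda>x. F s x - F t x)) \<longlongrightarrow> 0) (at t within I)"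
  shows "((\<lambda>s. qf M a (F s) (F s)) \<longlongrightarrow> qf M a (F t) (F t)) (at t within I)"
proof (rule LIM_zero_cancel, rule Lim_null_comparison)
  let ?D = "\<lambda>s. l2 M (\<lambda>x. F s x - F t x)"
  show "\<forall>\<^sub>F s in at t within I. norm (qf M a (F s) (F s) - qf M a (F t) (F t)) \<le>
      2 * (c * ?D s * l2 M (F t)) + c * ?D s * ?D s"
    unfolding eventually_at_filter
  proof (intro always_eventually allI impI)
    fix s assume "s \<in> I"
    have d: "sqint M (\<lambda>x. F s x - F t x)" by (intro sqint_diff F t \<open>s \<in> I\<close>)
    have "qf M a (F s) (F s) = qf M a (F t) (F t) + 2 * qf M a (\<lambda>x. F s x - F t x) (F t)
        + qf M a (\<lambda>x. F s x - F t x) (\<lambda>x. F s x - F t x)"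
      using qf_square_add[OF a F[OF t] d] by simp
    then show "norm (qf M a (F s) (F s) - qf M a (F t) (F t)) \<le> 2 * (c * ?D s * l2 M (F t)) + c * ?D s * ?D s"
      using qf_bound[OF a d F[OF t]] qf_bound[OF a d d] by simp
  qed
  show "((\<lambda>s. 2 * (c * ?D s * l2 M (F t)) + c * ?D s * ?D s) \<longlongrightarrow> 0) (at t within I)"
    by (rule tendsto_eq_intros lim refl | simp)+
qed

text \<open>
  With \<open>Q\<close> the difference quotient of \<open>F\<close>, the difference quotient of the form is
  \<open>2 q(Q, F t) + (s - t) q(Q, Q)\<close>, and \<open>Q\<close> tends to \<open>F'\<close>.
\<close>

lemma qf_has_derivative:
  assumes a: "selfadjoint_coeff M a c" and F: "\<And>s. s \<in> I \<Longrightarrow> sqint M (F s)" and t: "t \<in> I"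
    and F': "sqint M F'" and d: "l2_deriv M I F F' t"
  shows "((\<lambda>s. qf M a (F s) (F s)) has_real_derivative 2 * qf M a F' (F t)) (at t within I)"
  unfolding has_field_derivative_iff
proof (rule LIM_zero_cancel, rule Lim_null_comparison)
  let ?R = "\<lambda>s. l2 M (\<lambda>x. (1 / (s - t)) *\<^sub>R (F s x - F t x) - F' x)"
  show "\<forall>\<^sub>F s in at t within I. norm ((qf M a (F s) (F s) - qf M a (F t) (F t)) / (s - t) - 2 * qf M a F' (F t)) \<le>
      2 * (c * ?R s * l2 M (F t)) + \<bar>s - t\<bar> * (c * (?R s + l2 M F') * (?R s + l2 M F'))"
    unfolding eventually_at_filter
  proof (intro always_eventually allI impI)
    fix s assume st: "s \<noteq> t" and "s \<in> I"
    define Q where "Q = (\<lambda>x. (1 / (s - t)) *\<^sub>R (F s x - F t x))"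
    define R where "R = (\<lambda>x. Q x - F' x)"
    have sQ: "sqint M Q" unfolding Q_def by (intro sqint_scale sqint_diff F t \<open>s \<in> I\<close>)
    have sR: "sqint M R" unfolding R_def by (intro sqint_diff sQ F')
    have Fs: "F s = (\<lambda>x. F t x + (s - t) *\<^sub>R Q x)" using st by (simp add: Q_def fun_eq_iff)
    have "qf M a (F s) (F s) = qf M a (F t) (F t) + 2 * ((s - t) * qf M a Q (F t)) + (s - t) * ((s - t) * qf M a Q Q)"
      unfolding Fs using qf_square_add[OF a F[OF t] sqint_scale[OF sQ, of "s - t"]]
        qf_commute[OF a, of Q "\<lambda>x. (s - t) *\<^sub>R Q x"]
      by (simp add: qf_scale[OF a])
    then have "(qf M a (F s) (F s) - qf M a (F t) (F t)) / (s - t) = 2 * qf M a Q (F t) + (s - t) * qf M a Q Q"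
      using st by (simp add: divide_eq_eq) (simp add: algebra_simps)
    moreover have "qf M a Q (F t) = qf M a R (F t) + qf M a F' (F t)"
      using qf_add[OF a sR F' F[OF t]] by (simp add: R_def)
    ultimately have "norm ((qf M a (F s) (F s) - qf M a (F t) (F t)) / (s - t) - 2 * qf M a F' (F t))
        \<le> 2 * \<bar>qf M a R (F t)\<bar> + \<bar>s - t\<bar> * \<bar>qf M a Q Q\<bar>"
      using abs_triangle_ineq[of "2 * qf M a R (F t)" "(s - t) * qf M a Q Q"] by (simp add: abs_mult)
    moreover have "\<bar>qf M a R (F t)\<bar> \<le> c * l2 M R * l2 M (F t)" by (rule qf_bound[OF a sR F[OF t]])
    moreover have "\<bar>qf M a Q Q\<bar> \<le> c * (l2 M R + l2 M F') * (l2 M R + l2 M F')"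
    proof -
      have "l2 M Q \<le> l2 M R + l2 M F'" using l2_le_add_diff[OF sQ F'] by (simp add: R_def)
      moreover have "0 \<le> c" using a by (simp add: selfadjoint_coeff_def)
      ultimately have "c * l2 M Q * l2 M Q \<le> c * (l2 M R + l2 M F') * (l2 M R + l2 M F')"
        by (intro mult_mono mult_nonneg_nonneg add_nonneg_nonneg l2_nonneg) auto
      then show ?thesis using qf_bound[OF a sQ sQ] by linarith
    qed
    then have "\<bar>s - t\<bar> * \<bar>qf M a Q Q\<bar> \<le> \<bar>s - t\<bar> * (c * (l2 M R + l2 M F') * (l2 M R + l2 M F'))"
      by (rule mult_left_mono) simp
    moreover have "l2 M R = ?R s" by (simp add: R_def Q_def)
    ultimately show "norm ((qf M a (F s) (F s) - qf M a (F t) (F t)) / (s - t) - 2 * qf M a F' (F t)) \<le>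
      2 * (c * ?R s * l2 M (F t)) + \<bar>s - t\<bar> * (c * (?R s + l2 M F') * (?R s + l2 M F'))"
      by simp
  qed
  have "((\<lambda>s. 2 * (c * ?R s * l2 M (F t)) + \<bar>s - t\<bar> * (c * (?R s + l2 M F') * (?R s + l2 M F'))) \<longlongrightarrow>
     2 * (c * 0 * l2 M (F t)) + \<bar>t - t\<bar> * (c * (0 + l2 M F') * (0 + l2 M F'))) (at t within I)"
    by (intro tendsto_intros d[unfolded l2_deriv_def])
  then show "((\<lambda>s. 2 * (c * ?R s * l2 M (F t)) + \<bar>s - t\<bar> * (c * (?R s + l2 M F') * (?R s + l2 M F'))) \<longlongrightarrow> 0) (at t within I)"
    by simp
qed

lemma l2_deriv_diff:
  assumes F: "\<And>s. s \<in> I \<Longrightarrow> sqint M (F s)" and G: "\<And>s. s \<in> I \<Longrightarrow> sqint M (G s)" and t: "t \<in> I"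
    and F': "sqint M F'" and G': "sqint M G'" and d: "l2_deriv M I F F' t" "l2_deriv M I G G' t"
  shows "l2_deriv M I (\<lambda>s x. F s x - G s x) (\<lambda>x. F' x - G' x) t"
  unfolding l2_deriv_def
proof (rule Lim_null_comparison)
  let ?f = "\<lambda>s x. (1 / (s - t)) *\<^sub>R (F s x - F t x) - F' x" and ?g = "\<lambda>s x. (1 / (s - t)) *\<^sub>R (G s x - G t x) - G' x"
  show "\<forall>\<^sub>F s in at t within I. norm (l2 M (\<lambda>x. (1 / (s - t)) *\<^sub>R (F s x - G s x - (F t x - G t x)) - (F' x - G' x)))
     \<le> l2 M (?f s) + l2 M (?g s)"
    unfolding eventually_at_filter
  proof (intro always_eventually allI impI)
    fix s assume s: "s \<in> I"
    have 1: "sqint M (?f s)" by (intro sqint_diff sqint_scale F s t F')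
    have 2: "sqint M (\<lambda>x. - 1 *\<^sub>R ?g s x)" by (intro sqint_diff sqint_scale G s t G')
    have "(\<lambda>x. (1 / (s - t)) *\<^sub>R (F s x - G s x - (F t x - G t x)) - (F' x - G' x)) = (\<lambda>x. ?f s x + - 1 *\<^sub>R ?g s x)"
      by (simp add: fun_eq_iff algebra_simps)
    then show "norm (l2 M (\<lambda>x. (1 / (s - t)) *\<^sub>R (F s x - G s x - (F t x - G t x)) - (F' x - G' x)))
       \<le> l2 M (?f s) + l2 M (?g s)"
      using l2_triangle[OF 1 2] by (simp only: l2_scale) (simp add: l2_nonneg)
  qed
  show "((\<lambda>s. l2 M (?f s) + l2 M (?g s)) \<longlongrightarrow> 0) (at t within I)"
    using tendsto_add[OF d[unfolded l2_deriv_def]] by simp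
qed

lemma selfadjoint_coeff_id: "selfadjoint_coeff M (\<lambda>x X. X) 1"
  by (simp add: selfadjoint_coeff_def linear_id[unfolded id_def] linear_ident)

lemma qf_id: "qf M (\<lambda>x X. X) F G = ip M F G"
  by (simp add: qf_def)

section \<open>The coefficient tensors\<close>

lemma tensor_app_component: "tensor_app A X $ i $ j = (\<Sum>k\<in>UNIV. \<Sum>l\<in>UNIV. A $ i $ j $ k $ l * X $ k $ l)"
  by (simp add: tensor_app_def)

lemma linear_tensor_app: "linear (tensor_app A)"
  by (rule linearI)
     (simp_all add: vec_eq_iff tensor_app_component sum.distrib distrib_left sum_distrib_left mult_ac)

lemma sum_swap_pairs:
  "(\<Sum>i\<in>A. \<Sum>j\<in>B. \<Sum>k\<in>C. \<Sum>l\<in>D. g i j k l) = (\<Sum>k\<in>C. \<Sum>l\<in>D. \<Sum>i\<in>A. \<Sum>j\<in>B. g i j k l)"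
  unfolding sum.cartesian_product
  by (rule sum.reindex_bij_witness[where i = "\<lambda>(k, l, i, j). (i, j, k, l)" and j = "\<lambda>(i, j, k, l). (k, l, i, j)"]) auto

lemma tensor_app_symmetric:
  assumes "major_symmetric A" shows "tensor_app A X \<bullet> Y = X \<bullet> tensor_app A Y"
proof -
  have "tensor_app A X \<bullet> Y = (\<Sum>i\<in>UNIV. \<Sum>j\<in>UNIV. \<Sum>k\<in>UNIV. \<Sum>l\<in>UNIV. A $ i $ j $ k $ l * X $ k $ l * Y $ i $ j)"
    by (simp add: inner_vec_def tensor_app_component sum_distrib_right)
  also have "\<dots> = (\<Sum>k\<in>UNIV. \<Sum>l\<in>UNIV. \<Sum>i\<in>UNIV. \<Sum>j\<in>UNIV. A $ i $ j $ k $ l * X $ k $ l * Y $ i $ j)"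
    by (rule sum_swap_pairs)
  also have "\<dots> = (\<Sum>k\<in>UNIV. \<Sum>l\<in>UNIV. \<Sum>i\<in>UNIV. \<Sum>j\<in>UNIV. X $ k $ l * (A $ k $ l $ i $ j * Y $ i $ j))"
    by (intro sum.cong refl) (use assms in \<open>simp add: major_symmetric_def mult_ac\<close>)
  also have "\<dots> = X \<bullet> tensor_app A Y"
    by (simp add: inner_vec_def tensor_app_component sum_distrib_left)
  finally show ?thesis .
qed

lemma tensor_app_Sym3: "minor_symmetric A \<Longrightarrow> tensor_app A X \<in> Sym3"
  by (simp add: Sym3_def transpose_def vec_eq_iff tensor_app_component minor_symmetric_def)

lemma sym_part_Sym3: "sym_part X \<in> Sym3"
  by (simp add: Sym3_def sym_part_def vec_eq_iff transpose_def)

lemma Sym3_inner_sym_part: "Z \<in> Sym3 \<Longrightarrow> Z \<bullet> sym_part Y = Z \<bullet> Y"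
  by (simp add: Sym3_def sym_part_def vec_eq_iff transpose_def inner_vec_def sum_3 algebra_simps)

lemma Sym3_subspace: "subspace Sym3"
  by (auto simp: subspace_def Sym3_def transpose_def vec_eq_iff)

text \<open>
  A semidefinite form is bounded by its diagonal. Polarization is applied to multiples \<open>X\<close> of \<open>S\<close> and \<open>Y\<close> of
  \<open>A S\<close> that have the same norm, which makes the constant exactly \<open>M\<close>.
\<close>

lemma psd_norm_bound:
  fixes A :: "'a::real_inner \<Rightarrow> 'a"
  assumes lin: "linear A" and sym: "\<And>X Y. A X \<bullet> Y = X \<bullet> A Y" and V: "subspace V" "\<And>X. X \<in> V \<Longrightarrow> A X \<in> V"
    and bd: "\<And>X. X \<in> V \<Longrightarrow> 0 \<le> A X \<bullet> X \<and> A X \<bullet> X \<le> M * (norm X)\<^sup>2" and S: "S \<in> V" and M: "0 \<le> M"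
  shows "norm (A S) \<le> M * norm S"
proof (cases "norm S = 0 \<or> norm (A S) = 0")
  case True
  then show ?thesis using linear_0[OF lin] M by auto
next
  case False
  define n m where "n = norm S" and "m = norm (A S)"
  have pos: "0 < n" "0 < m" using False by (auto simp: n_def m_def)
  \<comment> \<open>Both vectors have norm \<open>n * m\<close>.\<close>
  define X Y where "X = m *\<^sub>R S" and "Y = n *\<^sub>R A S"
  have XY: "X \<in> V" "Y \<in> V" using V S by (auto simp: X_def Y_def subspace_mul)
  have nXY: "norm X = n * m" "norm Y = n * m" using pos by (auto simp: X_def Y_def n_def m_def)
  have "A X \<bullet> Y = m * n * m\<^sup>2"
    by (simp add: X_def Y_def linear_scale[OF lin] m_def power2_norm_eq_inner)
  then have "4 * (m * n * m\<^sup>2) = A (X + Y) \<bullet> (X + Y) - A (X - Y) \<bullet> (X - Y)"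
    using sym[of Y X] by (simp add: linear_add[OF lin] linear_diff[OF lin] algebra_simps inner_commute)
  also have "\<dots> \<le> M * (norm (X + Y))\<^sup>2"
    using bd[of "X + Y"] bd[of "X - Y"] XY V(1) by (smt (verit) subspace_add subspace_diff)
  also have "\<dots> \<le> M * (2 * (n * m))\<^sup>2"
  proof (intro mult_left_mono power_mono)
    show "norm (X + Y) \<le> 2 * (n * m)" using norm_triangle_ineq[of X Y] nXY by linarith
  qed (use M in auto)
  finally have "(m * m * n) * m \<le> (m * m * n) * (M * n)" by (simp add: power2_eq_square mult_ac)
  then have "m \<le> M * n" by (rule mult_left_le_imp_le) (use pos in simp)
  then show ?thesis by (simp add: n_def m_def)
qed

lemma Ck_on_1_continuous: "Ck_on 1 f S \<Longrightarrow> continuous_on S f"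
proof -
  assume "Ck_on 1 f S"
  then have d: "\<forall>x\<in>S. f differentiable (at x)" by simp
  show ?thesis
    unfolding continuous_on_eq_continuous_within
  proof
    fix x assume "x \<in> S"
    then have "f differentiable (at x within S)" using d differentiable_at_withinI by blast
    then show "continuous (at x within S) f" by (rule differentiable_imp_continuous_within)
  qed
qed

lemma tensor_app_measurable:
  fixes A :: "real^3 \<Rightarrow> tensor4"
  assumes A: "continuous_on \<Omega> A" and \<Omega>: "open \<Omega>" and F: "F \<in> borel_measurable (lebesgue_on \<Omega>)"
  shows "(\<lambda>x. tensor_app (A x) (F x)) \<in> borel_measurable (lebesgue_on \<Omega>)"
proof -
  have Am: "A \<in> borel_measurable (lebesgue_on \<Omega>)"
    using A \<Omega> by (intro continuous_imp_measurable_on_sets_lebesgue) (simp_all add: borel_open)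
  have "continuous_on UNIV (\<lambda>p :: tensor4 \<times> (real^3^3). tensor_app (fst p) (snd p))"
    unfolding tensor_app_def by (intro continuous_intros continuous_on_vec_lambda)
  from borel_measurable_continuous_Pair[OF Am F this] show ?thesis .
qed

text \<open>
  Definiteness is given on symmetric matrices only. Composing with the symmetric part gives a self-adjoint map
  on all matrices, because the minor symmetry makes the values of the tensor symmetric.
\<close>

lemma sym_tensor_coefficient:
  fixes A :: "real^3 \<Rightarrow> tensor4"
  assumes \<Omega>: "open \<Omega>" and A: "Ck_on 1 A \<Omega>"
    and sym: "\<forall>x\<in>\<Omega>. major_symmetric (A x) \<and> minor_symmetric (A x)"
    and def: "uniformly_definite_on \<Omega> Sym3 A"
  obtains c m where "selfadjoint_coeff (lebesgue_on \<Omega>) (\<lambda>x X. tensor_app (A x) (sym_part X)) c" "m > 0"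
    "\<And>F. sqint (lebesgue_on \<Omega>) F \<Longrightarrow> m * (l2 (lebesgue_on \<Omega>) (\<lambda>x. sym_part (F x)))\<^sup>2 \<le>
        qf (lebesgue_on \<Omega>) (\<lambda>x X. tensor_app (A x) (sym_part X)) F F"
proof -
  let ?M = "lebesgue_on \<Omega>" and ?a = "\<lambda>x X. tensor_app (A x) (sym_part X)"
  obtain m c where mc: "m > 0" "c > 0" and b: "\<And>x X. x \<in> \<Omega> \<Longrightarrow> X \<in> Sym3 \<Longrightarrow>
      m * (norm X)\<^sup>2 \<le> tensor_app (A x) X \<bullet> X \<and> tensor_app (A x) X \<bullet> X \<le> c * (norm X)\<^sup>2"
    using def unfolding uniformly_definite_on_def by blast
  have inn: "?a x X \<bullet> Y = tensor_app (A x) (sym_part X) \<bullet> sym_part Y" if "x \<in> \<Omega>" for x X Y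
    using sym that by (simp add: Sym3_inner_sym_part tensor_app_Sym3)
  have co: "selfadjoint_coeff ?M ?a c"
    unfolding selfadjoint_coeff_def
  proof (intro conjI ballI allI)
    show "0 \<le> c" using mc by simp
    fix x assume "x \<in> space ?M"
    then have x: "x \<in> \<Omega>" by simp
    show "linear (?a x)" using linear_compose[OF linear_sym_part linear_tensor_app] by (simp add: o_def)
    show "?a x X \<bullet> Y = X \<bullet> ?a x Y" for X Y
      using inn[OF x, of X Y] inn[OF x, of Y X] tensor_app_symmetric[of "A x" "sym_part X" "sym_part Y"] sym x
      by (simp add: inner_commute)
    show "norm (?a x X) \<le> c * norm X" for X
    proof -
      have "norm (?a x X) \<le> c * norm (sym_part X)"
      proof (rule psd_norm_bound[OF linear_tensor_app _ Sym3_subspace])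
        show "tensor_app (A x) X \<bullet> Y = X \<bullet> tensor_app (A x) Y" for X Y
          using sym x by (intro tensor_app_symmetric) auto
        show "tensor_app (A x) X \<in> Sym3" for X using sym x by (intro tensor_app_Sym3) auto
        show "0 \<le> tensor_app (A x) X \<bullet> X \<and> tensor_app (A x) X \<bullet> X \<le> c * (norm X)\<^sup>2" if "X \<in> Sym3" for X
          using b[OF x that] mult_nonneg_nonneg[OF less_imp_le[OF mc(1)] zero_le_power2[of "norm X"]] by linarith
      qed (use mc sym_part_Sym3 in auto)
      also have "\<dots> \<le> c * norm X" using norm_sym_part_le mc by (intro mult_left_mono) auto
      finally show ?thesis .
    qed
  next
    fix F :: "real^3 \<Rightarrow> real^3^3" assume "F \<in> borel_measurable ?M"
    then show "(\<lambda>x. ?a x (F x)) \<in> borel_measurable ?M"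
      by (intro tensor_app_measurable[OF Ck_on_1_continuous[OF A] \<Omega>] sym_part_measurable)
  qed
  have lower: "m * (l2 ?M (\<lambda>x. sym_part (F x)))\<^sup>2 \<le> qf ?M ?a F F" if F: "sqint ?M F" for F
  proof -
    have "m * (l2 ?M (\<lambda>x. sym_part (F x)))\<^sup>2 = (LINT x|?M. m * (sym_part (F x) \<bullet> sym_part (F x)))"
      by (simp add: l2_power2 ip_def)
    also have "\<dots> \<le> (LINT x|?M. ?a x (F x) \<bullet> F x)"
    proof (rule integral_mono)
      show "integrable ?M (\<lambda>x. m * (sym_part (F x) \<bullet> sym_part (F x)))"
        using sqint_integrable_inner[OF sqint_sym_part[OF F] sqint_sym_part[OF F]] by simp
      show "integrable ?M (\<lambda>x. ?a x (F x) \<bullet> F x)"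
        by (rule sqint_integrable_inner[OF selfadjoint_coeff_sqint(1)[OF co F] F])
      show "m * (sym_part (F x) \<bullet> sym_part (F x)) \<le> ?a x (F x) \<bullet> F x" if "x \<in> space ?M" for x
        using b[OF _ sym_part_Sym3, of x "F x"] that inn[of x "F x" "F x"] by (simp add: power2_norm_eq_inner)
    qed
    finally show ?thesis by (simp add: qf_def ip_def)
  qed
  show thesis by (rule that[OF co mc(1) lower])
qed

lemma full_tensor_coefficient:
  fixes A :: "real^3 \<Rightarrow> tensor4"
  assumes \<Omega>: "open \<Omega>" and A: "Ck_on 1 A \<Omega>"
    and sym: "\<forall>x\<in>\<Omega>. major_symmetric (A x)" and def: "uniformly_definite_on \<Omega> UNIV A"
  obtains c m where "selfadjoint_coeff (lebesgue_on \<Omega>) (\<lambda>x X. tensor_app (A x) X) c" "m > 0"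
    "\<And>F. sqint (lebesgue_on \<Omega>) F \<Longrightarrow> m * (l2 (lebesgue_on \<Omega>) F)\<^sup>2 \<le>
        qf (lebesgue_on \<Omega>) (\<lambda>x X. tensor_app (A x) X) F F"
proof -
  let ?M = "lebesgue_on \<Omega>" and ?a = "\<lambda>x X. tensor_app (A x) X"
  obtain m c where mc: "m > 0" "c > 0" and b: "\<And>x X. x \<in> \<Omega> \<Longrightarrow>
      m * (norm X)\<^sup>2 \<le> tensor_app (A x) X \<bullet> X \<and> tensor_app (A x) X \<bullet> X \<le> c * (norm X)\<^sup>2"
    using def unfolding uniformly_definite_on_def by blast
  have co: "selfadjoint_coeff ?M ?a c"
    unfolding selfadjoint_coeff_def
  proof (intro conjI ballI allI)
    show "0 \<le> c" using mc by simp
    fix x assume "x \<in> space ?M"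
    then have x: "x \<in> \<Omega>" by simp
    show "linear (?a x)" by (rule linear_tensor_app)
    show s: "?a x X \<bullet> Y = X \<bullet> ?a x Y" for X Y using sym x by (intro tensor_app_symmetric) auto
    show "norm (?a x X) \<le> c * norm X" for X
    proof (rule psd_norm_bound[OF linear_tensor_app s subspace_UNIV])
      show "0 \<le> tensor_app (A x) X \<bullet> X \<and> tensor_app (A x) X \<bullet> X \<le> c * (norm X)\<^sup>2" for X
        using b[OF x, of X] mult_nonneg_nonneg[OF less_imp_le[OF mc(1)] zero_le_power2[of "norm X"]] by linarith
    qed (use mc in auto)
  next
    fix F :: "real^3 \<Rightarrow> real^3^3" assume "F \<in> borel_measurable ?M"
    then show "(\<lambda>x. ?a x (F x)) \<in> borel_measurable ?M"
      by (intro tensor_app_measurable[OF Ck_on_1_continuous[OF A] \<Omega>])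
  qed
  have lower: "m * (l2 ?M F)\<^sup>2 \<le> qf ?M ?a F F" if F: "sqint ?M F" for F
  proof -
    have "m * (l2 ?M F)\<^sup>2 = (LINT x|?M. m * (F x \<bullet> F x))"
      by (simp add: l2_power2 ip_def)
    also have "\<dots> \<le> (LINT x|?M. ?a x (F x) \<bullet> F x)"
    proof (rule integral_mono)
      show "integrable ?M (\<lambda>x. m * (F x \<bullet> F x))" using sqint_integrable_inner[OF F F] by simp
      show "integrable ?M (\<lambda>x. ?a x (F x) \<bullet> F x)"
        by (rule sqint_integrable_inner[OF selfadjoint_coeff_sqint(1)[OF co F] F])
      show "m * (F x \<bullet> F x) \<le> ?a x (F x) \<bullet> F x" if "x \<in> space ?M" for x
        using b[of x "F x"] that by (simp add: power2_norm_eq_inner)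
    qed
    finally show ?thesis by (simp add: qf_def ip_def)
  qed
  show thesis by (rule that[OF co mc(1) lower])
qed

section \<open>A differential inequality\<close>

lemma integrable_lebesgue_on_subset:
  fixes g :: "real \<Rightarrow> real"
  assumes "integrable (lebesgue_on S) g" "U \<subseteq> S" "S \<in> sets lebesgue" "U \<in> sets lebesgue"
  shows "integrable (lebesgue_on U) g"
proof -
  have "set_integrable lebesgue S g"
    using assms by (simp add: integrable_restrict_space set_integrable_def)
  then have "set_integrable lebesgue U g" by (rule set_integrable_subset[OF _ assms(4,2)])
  then show ?thesis using assms by (simp add: integrable_restrict_space set_integrable_def)
qed

text \<open>
  The square root is not differentiable where \<open>E\<close> vanishes, in particular at time zero. Therefore
  \<open>\<surd>(E + \<delta>\<^sup>2)\<close> is differentiated, whose derivative is still at most \<open>g\<close>, and \<open>\<delta>\<close> tends to zero.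
\<close>

lemma sqrt_growth:
  fixes E E' g :: "real \<Rightarrow> real"
  assumes cont: "continuous_on {0..T} E" and nn: "\<And>t. t \<in> {0..T} \<Longrightarrow> 0 \<le> E t" and E0: "E 0 = 0"
    and der: "\<And>t. t \<in> {0<..T} \<Longrightarrow> (E has_real_derivative E' t) (at t within {0..T})"
    and le: "\<And>t. t \<in> {0<..T} \<Longrightarrow> E' t \<le> 2 * g t * sqrt (E t)" and g: "\<And>t. 0 \<le> g t"
    and gi: "integrable (lebesgue_on {0..T}) g" and t: "t \<in> {0..T}"
  shows "sqrt (E t) \<le> (LINT s|lebesgue_on {0..t}. g s)"
proof (rule field_le_epsilon)
  fix \<delta> :: real assume \<delta>: "\<delta> > 0"
  define \<phi> where "\<phi> = (\<lambda>s. sqrt (E s + \<delta>\<^sup>2))"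
  \<comment> \<open>At the end points, where nothing is known about \<open>E'\<close>, the comparison function itself is used.\<close>
  define \<psi> where "\<psi> = (\<lambda>s. if 0 < s \<and> s < t then E' s / (2 * \<phi> s) else g s)"
  have pos: "0 < E s + \<delta>\<^sup>2" if "s \<in> {0..T}" for s using nn[OF that] \<delta> zero_less_power[OF \<delta>, of 2] by linarith
  have gt: "integrable (lebesgue_on {0..t}) g"
    by (rule integrable_lebesgue_on_subset[OF gi]) (use t in auto)
  have h1: "(\<psi> has_integral \<phi> t - \<phi> 0) {0..t}"
  proof (rule fundamental_theorem_of_calculus_interior)
    show "0 \<le> t" using t by simp
    show "continuous_on {0..t} \<phi>"
    proof -
      have "continuous_on {0..t} E" using continuous_on_subset[OF cont] t by simp
      then show ?thesis unfolding \<phi>_def by (intro continuous_intros)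
    qed
    fix s assume s: "s \<in> {0<..<t}"
    then have sT: "s \<in> {0<..T}" "s \<in> {0..T}" "0 < s" "s < T" using t by auto
    have "(E has_real_derivative E' s) (at s)"
      using der[OF sT(1)] at_within_Icc_at[OF sT(3,4)] by simp
    from DERIV_add[OF this DERIV_const[of "\<delta>\<^sup>2"]]
    have "((\<lambda>s. E s + \<delta>\<^sup>2) has_real_derivative E' s) (at s)" by simp
    from DERIV_chain2[OF DERIV_real_sqrt[OF pos[OF sT(2)]] this]
    have "(\<phi> has_real_derivative inverse (sqrt (E s + \<delta>\<^sup>2)) / 2 * E' s) (at s)"
      unfolding \<phi>_def .
    moreover have "inverse (sqrt (E s + \<delta>\<^sup>2)) / 2 * E' s = \<psi> s"
      using s by (simp add: \<phi>_def \<psi>_def inverse_eq_divide)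
    ultimately have "(\<phi> has_real_derivative \<psi> s) (at s)" by simp
    then show "(\<phi> has_vector_derivative \<psi> s) (at s)"
      by (simp add: has_real_derivative_iff_has_vector_derivative)
  qed
  have h2: "(g has_integral (LINT s|lebesgue_on {0..t}. g s)) {0..t}"
    by (rule has_integral_integral_lebesgue_on[OF gt]) simp
  have h3: "\<psi> s \<le> g s" for s
  proof (cases "0 < s \<and> s < t")
    case True
    then have s: "s \<in> {0<..T}" "s \<in> {0..T}" using t by auto
    have p: "\<phi> s > 0" using pos[OF s(2)] by (simp add: \<phi>_def)
    have "E' s \<le> 2 * g s * sqrt (E s)" by (rule le[OF s(1)])
    also have "\<dots> \<le> 2 * g s * \<phi> s" using g[of s] by (intro mult_left_mono) (auto simp: \<phi>_def)
    also have "\<dots> = g s * (2 * \<phi> s)" by simp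
    finally have "E' s / (2 * \<phi> s) \<le> g s" using p by (simp add: pos_divide_le_eq)
    then show ?thesis using True by (simp add: \<psi>_def)
  qed (auto simp: \<psi>_def)
  have "\<phi> t - \<phi> 0 \<le> (LINT s|lebesgue_on {0..t}. g s)"
    by (rule has_integral_le[OF h1 h2]) (rule h3)
  moreover have "\<phi> 0 = \<delta>" using \<delta> E0 by (simp add: \<phi>_def)
  moreover have "sqrt (E t) \<le> \<phi> t" by (simp add: \<phi>_def)
  ultimately show "sqrt (E t) \<le> (LINT s|lebesgue_on {0..t}. g s) + \<delta>" by simp
qed

section \<open>Coercivity\<close>

lemma coercivity_arithmetic:
  fixes X Y Z p g c h l d :: real
  assumes "0 \<le> p" "0 \<le> g" "p \<le> 2 * Y + 12 * d * Z" "g \<le> 2 * (X + Y)" and pos: "c > 0" "h > 0" "l > 0"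
  shows "g\<^sup>2 + p\<^sup>2 + Z\<^sup>2 \<le> (8 / c + 16 / h + (288 * d\<^sup>2 + 1) / l) * (c * X\<^sup>2 + h * Y\<^sup>2 + l * Z\<^sup>2)"
proof -
  have sq: "(x + y)\<^sup>2 \<le> 2 * x\<^sup>2 + 2 * y\<^sup>2" for x y :: real
    using sum_squares_bound[of x y] by (simp add: power2_sum)
  have "p\<^sup>2 \<le> (2 * Y + 12 * d * Z)\<^sup>2" using assms by (intro power_mono)
  also have "\<dots> \<le> 8 * Y\<^sup>2 + 288 * d\<^sup>2 * Z\<^sup>2"
    using sq[of "2 * Y" "12 * d * Z"] by (simp add: power_mult_distrib)
  finally have p: "p\<^sup>2 \<le> 8 * Y\<^sup>2 + 288 * d\<^sup>2 * Z\<^sup>2" .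
  have "g\<^sup>2 \<le> (2 * (X + Y))\<^sup>2" using assms by (intro power_mono)
  also have "\<dots> \<le> 8 * X\<^sup>2 + 8 * Y\<^sup>2" using sq[of "2 * X" "2 * Y"] by (simp add: power_mult_distrib)
  finally have g: "g\<^sup>2 \<le> 8 * X\<^sup>2 + 8 * Y\<^sup>2" .
  define A B D where "A = c * X\<^sup>2" and "B = h * Y\<^sup>2" and "D = l * Z\<^sup>2"
  have nn: "0 \<le> A" "0 \<le> B" "0 \<le> D" using pos by (auto simp: A_def B_def D_def)
  have e: "8 * X\<^sup>2 = 8 / c * A" "16 * Y\<^sup>2 = 16 / h * B" "(288 * d\<^sup>2 + 1) * Z\<^sup>2 = (288 * d\<^sup>2 + 1) / l * D"
    using pos by (auto simp: A_def B_def D_def)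
  define k1 k2 k3 where "k1 = 8 / c" and "k2 = 16 / h" and "k3 = (288 * d\<^sup>2 + 1) / l"
  have k: "0 \<le> k1" "0 \<le> k2" "0 \<le> k3" using pos by (auto simp: k1_def k2_def k3_def)
  have "g\<^sup>2 + p\<^sup>2 + Z\<^sup>2 \<le> 8 * X\<^sup>2 + 16 * Y\<^sup>2 + (288 * d\<^sup>2 + 1) * Z\<^sup>2"
    using p g by (simp add: algebra_simps)
  also have "\<dots> = k1 * A + k2 * B + k3 * D" unfolding e k1_def k2_def k3_def ..
  also have "\<dots> \<le> (k1 + k2 + k3) * A + (k1 + k2 + k3) * B + (k1 + k2 + k3) * D"
    using k nn by (intro add_mono mult_right_mono) auto
  also have "\<dots> = (k1 + k2 + k3) * (A + B + D)" by (simp add: algebra_simps)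
  finally show ?thesis by (simp add: k1_def k2_def k3_def A_def B_def D_def)
qed

lemma bounded_diameter:
  assumes "bounded (\<Omega> :: (real^3) set)"
  obtains d where "d \<ge> 0" "\<And>x y. x \<in> \<Omega> \<Longrightarrow> y \<in> \<Omega> \<Longrightarrow> dist x y < d"
proof -
  obtain B where B: "B > 0" "\<forall>x\<in>\<Omega>. norm x \<le> B" using assms bounded_pos by blast
  have "dist x y < 2 * B + 1" if "x \<in> \<Omega>" "y \<in> \<Omega>" for x y
  proof -
    have "norm x \<le> B" "norm y \<le> B" using B(2) that by auto
    then show ?thesis using norm_triangle_ineq4[of x y] by (simp add: dist_norm)
  qed
  then show thesis using B(1) by (intro that[of "2 * B + 1"]) auto
qed

abbreviation tensor_on_sym :: "(real^3 \<Rightarrow> tensor4) \<Rightarrow> real^3 \<Rightarrow> real^3^3 \<Rightarrow> real^3^3" where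
  "tensor_on_sym A \<equiv> \<lambda>x X. tensor_app (A x) (sym_part X)"

abbreviation tensor_on_full :: "(real^3 \<Rightarrow> tensor4) \<Rightarrow> real^3 \<Rightarrow> real^3^3 \<Rightarrow> real^3^3" where
  "tensor_on_full A \<equiv> \<lambda>x X. tensor_app (A x) X"

text \<open>
  Twice the physical energy of a state.
\<close>

definition energy :: "(real^3) set \<Rightarrow> (real^3 \<Rightarrow> tensor4) \<Rightarrow> (real^3 \<Rightarrow> tensor4) \<Rightarrow> (real^3 \<Rightarrow> tensor4) \<Rightarrow> state \<Rightarrow> real" where
  "energy \<Omega> \<C> \<H> \<L> = (\<lambda>(u, v, P, K).
     ip (lebesgue_on \<Omega>) v v + ip (lebesgue_on \<Omega>) K K +
     qf (lebesgue_on \<Omega>) (tensor_on_sym \<C>) (\<lambda>x. Grad \<Omega> u x - P x) (\<lambda>x. Grad \<Omega> u x - P x) +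
     qf (lebesgue_on \<Omega>) (tensor_on_sym \<H>) P P +
     qf (lebesgue_on \<Omega>) (tensor_on_full \<L>) (Curl \<Omega> P) (Curl \<Omega> P))"

text \<open>
  The energy controls \<open>sym (\<nabla>u - P)\<close>, \<open>sym P\<close> and \<open>Curl P\<close>. Korn's inequality for \<open>P\<close> recovers \<open>P\<close> from the
  last two; then \<open>sym \<nabla>u\<close> is controlled by the first two, and Korn's inequality for \<open>u\<close> recovers the gradient.
\<close>

lemma energy_coercive:
  assumes \<Omega>: "open \<Omega>" "bounded \<Omega>" and co: "admissible_coefficients \<Omega> \<C> \<H> \<L>"
  obtains k cC cH cL where "k \<ge> 0"
    "selfadjoint_coeff (lebesgue_on \<Omega>) (tensor_on_sym \<C>) cC" "selfadjoint_coeff (lebesgue_on \<Omega>) (tensor_on_sym \<H>) cH"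
    "selfadjoint_coeff (lebesgue_on \<Omega>) (tensor_on_full \<L>) cL"
    "\<And>u v P K. (u, v, P, K) \<in> X_space \<Omega> \<Longrightarrow>
       (L2_norm \<Omega> v)\<^sup>2 + (L2_norm \<Omega> K)\<^sup>2 \<le> energy \<Omega> \<C> \<H> \<L> (u, v, P, K) \<and>
       (L2_norm \<Omega> v)\<^sup>2 + (L2_norm \<Omega> K)\<^sup>2 + (L2_norm \<Omega> (Grad \<Omega> u))\<^sup>2 + (L2_norm \<Omega> P)\<^sup>2 + (L2_norm \<Omega> (Curl \<Omega> P))\<^sup>2
         \<le> (1 + k) * energy \<Omega> \<C> \<H> \<L> (u, v, P, K)"
proof -
  let ?M = "lebesgue_on \<Omega>"
  obtain d where d: "d \<ge> 0" "\<And>x y. x \<in> \<Omega> \<Longrightarrow> y \<in> \<Omega> \<Longrightarrow> dist x y < d"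
    using bounded_diameter[OF \<Omega>(2)] by blast
  have C: "Ck_on 1 \<C> \<Omega>" "\<forall>x\<in>\<Omega>. major_symmetric (\<C> x) \<and> minor_symmetric (\<C> x)" "uniformly_definite_on \<Omega> Sym3 \<C>"
    and H: "Ck_on 1 \<H> \<Omega>" "\<forall>x\<in>\<Omega>. major_symmetric (\<H> x) \<and> minor_symmetric (\<H> x)" "uniformly_definite_on \<Omega> Sym3 \<H>"
    and L: "Ck_on 1 \<L> \<Omega>" "\<forall>x\<in>\<Omega>. major_symmetric (\<L> x)" "uniformly_definite_on \<Omega> UNIV \<L>"
    using co unfolding admissible_coefficients_def by blast+
  obtain cC mC where cC: "selfadjoint_coeff ?M (tensor_on_sym \<C>) cC" "mC > 0"
    "\<And>F. sqint ?M F \<Longrightarrow> mC * (l2 ?M (\<lambda>x. sym_part (F x)))\<^sup>2 \<le> qf ?M (tensor_on_sym \<C>) F F"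
    by (rule sym_tensor_coefficient[OF \<Omega>(1) C]) (rule that)
  obtain cH mH where cH: "selfadjoint_coeff ?M (tensor_on_sym \<H>) cH" "mH > 0"
    "\<And>F. sqint ?M F \<Longrightarrow> mH * (l2 ?M (\<lambda>x. sym_part (F x)))\<^sup>2 \<le> qf ?M (tensor_on_sym \<H>) F F"
    by (rule sym_tensor_coefficient[OF \<Omega>(1) H]) (rule that)
  obtain cL mL where cL: "selfadjoint_coeff ?M (tensor_on_full \<L>) cL" "mL > 0"
    "\<And>F. sqint ?M F \<Longrightarrow> mL * (l2 ?M F)\<^sup>2 \<le> qf ?M (tensor_on_full \<L>) F F"
    by (rule full_tensor_coefficient[OF \<Omega>(1) L]) (rule that)
  define k where "k = 8 / mC + 16 / mH + (288 * d\<^sup>2 + 1) / mL"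
  have k: "k \<ge> 0" using cC(2) cH(2) cL(2) by (simp add: k_def)
  have main: "(L2_norm \<Omega> v)\<^sup>2 + (L2_norm \<Omega> K)\<^sup>2 \<le> energy \<Omega> \<C> \<H> \<L> (u, v, P, K) \<and>
       (L2_norm \<Omega> v)\<^sup>2 + (L2_norm \<Omega> K)\<^sup>2 + (L2_norm \<Omega> (Grad \<Omega> u))\<^sup>2 + (L2_norm \<Omega> P)\<^sup>2 + (L2_norm \<Omega> (Curl \<Omega> P))\<^sup>2
         \<le> (1 + k) * energy \<Omega> \<C> \<H> \<L> (u, v, P, K)"
    if w: "(u, v, P, K) \<in> X_space \<Omega>" for u v P K
  proof -
    have cl: "fo_closure \<Omega> grad_symbol u (Grad \<Omega> u)" "fo_closure \<Omega> curl_symbol P (Curl \<Omega> P)"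
      using w H1_0_closure[OF \<Omega>, of u] HCurl_0_closure[OF \<Omega>, of P] by (auto simp: X_space_def)
    let ?G = "Grad \<Omega> u" and ?Q = "Curl \<Omega> P"
    have s: "sqint ?M ?G" "sqint ?M P" "sqint ?M ?Q" using cl fo_closure_sqint by blast+
    have sD: "sqint ?M (\<lambda>x. ?G x - P x)" by (intro sqint_diff s)
    define X Y Z where "X = l2 ?M (\<lambda>x. sym_part (?G x - P x))" and "Y = l2 ?M (\<lambda>x. sym_part (P x))" and "Z = l2 ?M ?Q"
    have 1: "l2 ?M P \<le> 2 * Y + 12 * d * Z"
      unfolding Y_def Z_def by (rule Korn_curl[OF \<Omega>(1) cl(2) d(2,1)])
    have "l2 ?M (\<lambda>x. sym_part (?G x)) \<le> X + Y"
      using l2_triangle[OF sqint_sym_part[OF sD] sqint_sym_part[OF s(2)]]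
      by (simp add: X_def Y_def linear_diff[OF linear_sym_part])
    then have "2 * l2 ?M (\<lambda>x. sym_part (?G x)) \<le> 2 * (X + Y)" by (rule mult_left_mono) simp
    with Korn_gradient[OF \<Omega>(1) cl(1)] have 2: "l2 ?M ?G \<le> 2 * (X + Y)" by (rule order_trans)
    define e where "e = qf ?M (tensor_on_sym \<C>) (\<lambda>x. ?G x - P x) (\<lambda>x. ?G x - P x) + qf ?M (tensor_on_sym \<H>) P P + qf ?M (tensor_on_full \<L>) ?Q ?Q"
    have e: "mC * X\<^sup>2 + mH * Y\<^sup>2 + mL * Z\<^sup>2 \<le> e"
      using cC(3)[OF sD] cH(3)[OF s(2)] cL(3)[OF s(3)] by (simp add: e_def X_def Y_def Z_def)
    have e0: "0 \<le> e" using e cC(2) cH(2) cL(2) zero_le_power2[of X] zero_le_power2[of Y] zero_le_power2[of Z]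
      by (smt (verit) mult_nonneg_nonneg)
    have "(l2 ?M ?G)\<^sup>2 + (l2 ?M P)\<^sup>2 + Z\<^sup>2 \<le> k * (mC * X\<^sup>2 + mH * Y\<^sup>2 + mL * Z\<^sup>2)"
      unfolding k_def by (rule coercivity_arithmetic[OF l2_nonneg l2_nonneg 1 2 cC(2) cH(2) cL(2)])
    also have "\<dots> \<le> k * e" using e k by (rule mult_left_mono)
    finally have f: "(l2 ?M ?G)\<^sup>2 + (l2 ?M P)\<^sup>2 + (l2 ?M ?Q)\<^sup>2 \<le> k * e" by (simp add: Z_def)
    have en: "energy \<Omega> \<C> \<H> \<L> (u, v, P, K) = (l2 ?M v)\<^sup>2 + (l2 ?M K)\<^sup>2 + e"
      by (simp add: energy_def e_def l2_power2)
    have "0 \<le> k * ((l2 ?M v)\<^sup>2 + (l2 ?M K)\<^sup>2)" using k by simp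
    then show ?thesis unfolding en L2_norm_eq using f e0 by (simp add: algebra_simps)
  qed
  show thesis by (rule that[OF k cC(1) cH(1) cL(1) main])
qed

section \<open>The energy balance\<close>

text \<open>
  With \<open>\<S>\<close> the stress \<open>\<C>. sym (\<nabla>u - P)\<close>, testing the divergence of \<open>\<S>\<close> with \<open>v\<close> produces \<open>- \<langle>\<S>, \<nabla>v\<rangle>\<close>, and
  testing the fourth component with \<open>K\<close> produces \<open>\<langle>\<S>, K\<rangle> - \<langle>\<H>. sym P, K\<rangle> - \<langle>\<L>. Curl P, Curl K\<rangle>\<close>. Both are legitimate
  because \<open>v\<close> and \<open>K\<close>, being components of an element of the state space, satisfy the boundary conditions. These
  terms are the negatives of the elastic power.
\<close>

lemma generator_conserves_energy:
  assumes \<Omega>: "open \<Omega>" "bounded \<Omega>"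
    and C: "selfadjoint_coeff (lebesgue_on \<Omega>) (tensor_on_sym \<C>) cC" and H: "selfadjoint_coeff (lebesgue_on \<Omega>) (tensor_on_sym \<H>) cH"
    and L: "selfadjoint_coeff (lebesgue_on \<Omega>) (tensor_on_full \<L>) cL"
    and w: "(u, v, P, K) \<in> X_space \<Omega>" and z: "(z1, z2, z3, z4) \<in> X_space \<Omega>"
    and A: "represents_A \<Omega> \<C> \<H> \<L> (u, v, P, K) (z1, z2, z3, z4)"
  shows "ip (lebesgue_on \<Omega>) z2 v + ip (lebesgue_on \<Omega>) z4 K
     + qf (lebesgue_on \<Omega>) (tensor_on_sym \<C>) (\<lambda>x. Grad \<Omega> v x - K x) (\<lambda>x. Grad \<Omega> u x - P x)
     + qf (lebesgue_on \<Omega>) (tensor_on_sym \<H>) K P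
     + qf (lebesgue_on \<Omega>) (tensor_on_full \<L>) (Curl \<Omega> K) (Curl \<Omega> P) = 0"
proof -
  let ?M = "lebesgue_on \<Omega>"
  have eqs: "z1 = v" "z3 = K" using A by (auto simp: represents_A_def)
  have clu: "fo_closure \<Omega> grad_symbol u (Grad \<Omega> u)" and clv: "fo_closure \<Omega> grad_symbol v (Grad \<Omega> v)"
    and clP: "fo_closure \<Omega> curl_symbol P (Curl \<Omega> P)" and clK: "fo_closure \<Omega> curl_symbol K (Curl \<Omega> K)"
    using w z eqs H1_0_closure[OF \<Omega>] HCurl_0_closure[OF \<Omega>] by (auto simp: X_space_def)
  have s: "sqint ?M (Grad \<Omega> u)" "sqint ?M P" "sqint ?M (Curl \<Omega> P)" "sqint ?M v" "sqint ?M K"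
    "sqint ?M (Grad \<Omega> v)" "sqint ?M (Curl \<Omega> K)"
    using clu clv clP clK fo_closure_sqint by blast+
  have sz: "sqint ?M z2" "sqint ?M z4" using z by (auto simp: X_space_def L2_iff)
  define S where "S = (\<lambda>x. tensor_app (\<C> x) (sym_part (Grad \<Omega> u x - P x)))"
  define R where "R = (\<lambda>x. tensor_app (\<H> x) (sym_part (P x)))"
  define W where "W = (\<lambda>x. tensor_app (\<L> x) (Curl \<Omega> P x))"
  have sD: "sqint ?M (\<lambda>x. Grad \<Omega> u x - P x)" by (intro sqint_diff s)
  have sS: "sqint ?M S" unfolding S_def by (rule selfadjoint_coeff_sqint(1)[OF C sD])
  have sR: "sqint ?M R" unfolding R_def by (rule selfadjoint_coeff_sqint(1)[OF H s(2)])
  have sW: "sqint ?M W" unfolding W_def by (rule selfadjoint_coeff_sqint(1)[OF L s(3)])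
  have sV: "sqint ?M (\<lambda>x. S x - R x)" by (intro sqint_diff sS sR)
  have sZ: "sqint ?M (\<lambda>x. S x - R x - z4 x)" by (intro sqint_diff sV sz)
  have wdiv: "weak_fo \<Omega> div_symbol S z2"
    using A sS sz(1) by (simp add: weak_fo_def L2_iff represents_A_def S_def flip: div_distr_fo)
  \<comment> \<open>The fourth equation, solved for the curl of \<open>\<L>. Curl P\<close>.\<close>
  have wcurl: "weak_fo \<Omega> curl_symbol W (\<lambda>x. S x - R x - z4 x)"
    unfolding weak_fo_def distr_eq_def
  proof (intro conjI ballI)
    show "W \<in> L2 \<Omega>" "(\<lambda>x. S x - R x - z4 x) \<in> L2 \<Omega>" using sW sZ by (simp_all add: L2_iff)
    fix \<phi> :: "real^3 \<Rightarrow> real" assume \<phi>: "\<phi> \<in> test_functions \<Omega>"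
    have "- curl_distr (distr_of \<Omega> W) \<phi> + distr_of \<Omega> S \<phi> - distr_of \<Omega> R \<phi> = distr_of \<Omega> z4 \<phi>"
      using A \<phi> by (simp add: represents_A_def distr_eq_def S_def R_def W_def)
    moreover have "distr_of \<Omega> (\<lambda>x. S x - R x - z4 x) \<phi> = distr_of \<Omega> S \<phi> - distr_of \<Omega> R \<phi> - distr_of \<Omega> z4 \<phi>"
      using distr_of_lincomb[OF \<Omega> _ _ \<phi>, of "\<lambda>x. S x - R x" z4 1 "-1"] distr_of_lincomb[OF \<Omega> _ _ \<phi>, of S R 1 "-1"]
        sS sR sV sz by (simp add: L2_iff)
    ultimately show "fo_op_distr curl_symbol (distr_of \<Omega> W) \<phi> = distr_of \<Omega> (\<lambda>x. S x - R x - z4 x) \<phi>"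
      by (simp add: curl_distr_fo algebra_simps)
  qed
  have 1: "ip ?M z2 v = - ip ?M S (Grad \<Omega> v)"
    using weak_fo_duality[OF \<Omega> linear_grad_symbol _ wdiv clv, of 1] by (simp add: div_grad_adjoint)
  have "ip ?M (\<lambda>x. S x - R x - z4 x) K = ip ?M W (Curl \<Omega> K)"
    using weak_fo_duality[OF \<Omega> linear_curl_symbol _ wcurl clK, of "-1"] curl_adjoint by simp
  then have 2: "ip ?M z4 K = ip ?M S K - ip ?M R K - ip ?M W (Curl \<Omega> K)"
    by (simp add: ip_diff[OF sV sz(2) s(5)] ip_diff[OF sS sR s(5)])
  have 3: "qf ?M (tensor_on_sym \<C>) (\<lambda>x. Grad \<Omega> v x - K x) (\<lambda>x. Grad \<Omega> u x - P x) = ip ?M S (Grad \<Omega> v) - ip ?M S K"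
    by (subst qf_commute[OF C])
       (simp add: qf_def ip_commute[of ?M _ "\<lambda>x. Grad \<Omega> v x - K x"] ip_diff[OF s(6,5) sS[unfolded S_def]] S_def
          ip_commute[of ?M "Grad \<Omega> v"] ip_commute[of ?M K])
  have 4: "qf ?M (tensor_on_sym \<H>) K P = ip ?M R K"
    by (subst qf_commute[OF H]) (simp add: qf_def R_def)
  have 5: "qf ?M (tensor_on_full \<L>) (Curl \<Omega> K) (Curl \<Omega> P) = ip ?M W (Curl \<Omega> K)"
    by (subst qf_commute[OF L]) (simp add: qf_def W_def)
  show ?thesis unfolding 1 2 3 4 5 by simp
qed

section \<open>Curves in the state space\<close>

lemma X_norm_ge:
  "L2_norm \<Omega> u \<le> X_norm \<Omega> (u, v, P, K)" "L2_norm \<Omega> (Grad \<Omega> u) \<le> X_norm \<Omega> (u, v, P, K)"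
  "L2_norm \<Omega> v \<le> X_norm \<Omega> (u, v, P, K)" "L2_norm \<Omega> P \<le> X_norm \<Omega> (u, v, P, K)"
  "L2_norm \<Omega> (Curl \<Omega> P) \<le> X_norm \<Omega> (u, v, P, K)" "L2_norm \<Omega> K \<le> X_norm \<Omega> (u, v, P, K)"
  by (auto simp: X_norm_def H1_norm_def HCurl_norm_def intro!: real_le_rsqrt)

lemma l2_null_comparison:
  assumes "(N \<longlongrightarrow> 0) (at t within I)" "\<And>s. s \<in> I \<Longrightarrow> l2 M (D s) \<le> N s"
  shows "((\<lambda>s. l2 M (D s)) \<longlongrightarrow> 0) (at t within I)"
proof (rule Lim_null_comparison[OF _ assms(1)])
  show "\<forall>\<^sub>F s in at t within I. norm (l2 M (D s)) \<le> N s"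
    unfolding eventually_at_filter
    using assms(2) by (intro always_eventually allI impI) (simp add: l2_nonneg)
qed

lemma weak_fo_scale:
  assumes "open \<Omega>" "bounded \<Omega>" "\<And>j. linear (\<sigma> j)" "weak_fo \<Omega> \<sigma> u G"
  shows "weak_fo \<Omega> \<sigma> (\<lambda>x. a *\<^sub>R u x) (\<lambda>x. a *\<^sub>R G x)"
  using weak_fo_lincomb[OF assms assms(4), of a 0] by simp

lemma X_spaceD:
  assumes "(u, v, P, K) \<in> X_space \<Omega>"
  shows "weak_fo \<Omega> grad_symbol u (Grad \<Omega> u)" "weak_fo \<Omega> curl_symbol P (Curl \<Omega> P)"
    "sqint (lebesgue_on \<Omega>) v" "sqint (lebesgue_on \<Omega>) K" "sqint (lebesgue_on \<Omega>) P"
    "sqint (lebesgue_on \<Omega>) (Grad \<Omega> u)" "sqint (lebesgue_on \<Omega>) (Curl \<Omega> P)"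
proof -
  show w: "weak_fo \<Omega> grad_symbol u (Grad \<Omega> u)" "weak_fo \<Omega> curl_symbol P (Curl \<Omega> P)"
    using assms by (auto simp: X_space_def H1_0_def HCurl_0_def intro!: weak_Grad weak_Curl)
  show "sqint (lebesgue_on \<Omega>) v" "sqint (lebesgue_on \<Omega>) K" "sqint (lebesgue_on \<Omega>) P"
    "sqint (lebesgue_on \<Omega>) (Grad \<Omega> u)" "sqint (lebesgue_on \<Omega>) (Curl \<Omega> P)"
    using assms w by (auto simp: X_space_def weak_fo_def L2_iff)
qed

lemma X_continuous_components:
  assumes \<Omega>: "open \<Omega>" "bounded \<Omega>" and X: "X_continuous_on \<Omega> I (\<lambda>t. (u t, v t, P t, K t))" and t: "t \<in> I"
  defines "M \<equiv> lebesgue_on \<Omega>"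
  shows "((\<lambda>s. l2 M (\<lambda>x. v s x - v t x)) \<longlongrightarrow> 0) (at t within I)"
    "((\<lambda>s. l2 M (\<lambda>x. K s x - K t x)) \<longlongrightarrow> 0) (at t within I)"
    "((\<lambda>s. l2 M (\<lambda>x. Grad \<Omega> (u s) x - Grad \<Omega> (u t) x)) \<longlongrightarrow> 0) (at t within I)"
    "((\<lambda>s. l2 M (\<lambda>x. P s x - P t x)) \<longlongrightarrow> 0) (at t within I)"
    "((\<lambda>s. l2 M (\<lambda>x. Curl \<Omega> (P s) x - Curl \<Omega> (P t) x)) \<longlongrightarrow> 0) (at t within I)"
proof -
  let ?N = "\<lambda>s. X_norm \<Omega> ((\<lambda>x. u s x - u t x), (\<lambda>x. v s x - v t x), (\<lambda>x. P s x - P t x), (\<lambda>x. K s x - K t x))"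
  have lim: "(?N \<longlongrightarrow> 0) (at t within I)"
    using X t by (auto simp: X_continuous_on_def state_diff_def state_add_def state_scale_def)
  have w: "(u s, v s, P s, K s) \<in> X_space \<Omega>" if "s \<in> I" for s using X that by (auto simp: X_continuous_on_def)
  have g: "l2 M (\<lambda>x. Grad \<Omega> (u s) x - Grad \<Omega> (u t) x) = L2_norm \<Omega> (Grad \<Omega> (\<lambda>x. u s x - u t x))" if "s \<in> I" for s
    unfolding M_def
    by (rule L2_norm_Grad[OF \<Omega> weak_fo_diff[OF \<Omega> linear_grad_symbol X_spaceD(1)[OF w[OF that]] X_spaceD(1)[OF w[OF t]]], symmetric])
  have c: "l2 M (\<lambda>x. Curl \<Omega> (P s) x - Curl \<Omega> (P t) x) = L2_norm \<Omega> (Curl \<Omega> (\<lambda>x. P s x - P t x))" if "s \<in> I" for s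
    unfolding M_def
    by (rule L2_norm_Curl[OF \<Omega> weak_fo_diff[OF \<Omega> linear_curl_symbol X_spaceD(2)[OF w[OF that]] X_spaceD(2)[OF w[OF t]]], symmetric])
  show "((\<lambda>s. l2 M (\<lambda>x. v s x - v t x)) \<longlongrightarrow> 0) (at t within I)"
    by (rule l2_null_comparison[OF lim]) (simp only: M_def X_norm_ge flip: L2_norm_eq)
  show "((\<lambda>s. l2 M (\<lambda>x. K s x - K t x)) \<longlongrightarrow> 0) (at t within I)"
    by (rule l2_null_comparison[OF lim]) (simp only: M_def X_norm_ge flip: L2_norm_eq)
  show "((\<lambda>s. l2 M (\<lambda>x. Grad \<Omega> (u s) x - Grad \<Omega> (u t) x)) \<longlongrightarrow> 0) (at t within I)"
    by (rule l2_null_comparison[OF lim]) (simp only: g X_norm_ge)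
  show "((\<lambda>s. l2 M (\<lambda>x. P s x - P t x)) \<longlongrightarrow> 0) (at t within I)"
    by (rule l2_null_comparison[OF lim]) (simp only: M_def X_norm_ge flip: L2_norm_eq)
  show "((\<lambda>s. l2 M (\<lambda>x. Curl \<Omega> (P s) x - Curl \<Omega> (P t) x)) \<longlongrightarrow> 0) (at t within I)"
    by (rule l2_null_comparison[OF lim]) (simp only: c X_norm_ge)
qed

text \<open>
  Convergence in the norm of the state space involves the weak gradient and curl of difference quotients; by
  uniqueness of weak derivatives these are difference quotients of gradients and curls.
\<close>

lemma X_derivative_components:
  assumes \<Omega>: "open \<Omega>" "bounded \<Omega>" and w: "\<And>s. s \<in> I \<Longrightarrow> (u s, v s, P s, K s) \<in> X_space \<Omega>"
    and X: "X_has_derivative_within \<Omega> I (\<lambda>t. (u t, v t, P t, K t)) (d1, d2, d3, d4) t" and t: "t \<in> I"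
  defines "M \<equiv> lebesgue_on \<Omega>"
  shows "l2_deriv M I v d2 t" "l2_deriv M I K d4 t"
    "l2_deriv M I (\<lambda>s. Grad \<Omega> (u s)) (Grad \<Omega> d1) t" "l2_deriv M I P d3 t"
    "l2_deriv M I (\<lambda>s. Curl \<Omega> (P s)) (Curl \<Omega> d3) t"
proof -
  let ?q = "\<lambda>f s x. (1 / (s - t)) *\<^sub>R (f s x - f t x)"
  let ?N = "\<lambda>s. X_norm \<Omega> ((\<lambda>x. ?q u s x - d1 x), (\<lambda>x. ?q v s x - d2 x), (\<lambda>x. ?q P s x - d3 x), (\<lambda>x. ?q K s x - d4 x))"
  have lim: "(?N \<longlongrightarrow> 0) (at t within I)"
    using X by (auto simp: X_has_derivative_within_def state_diff_def state_add_def state_scale_def)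
  have d: "(d1, d2, d3, d4) \<in> X_space \<Omega>" using X by (simp add: X_has_derivative_within_def)
  have g: "l2 M (\<lambda>x. ?q (\<lambda>s. Grad \<Omega> (u s)) s x - Grad \<Omega> d1 x) = L2_norm \<Omega> (Grad \<Omega> (\<lambda>x. ?q u s x - d1 x))" if "s \<in> I" for s
    unfolding M_def
    by (rule L2_norm_Grad[OF \<Omega> weak_fo_diff[OF \<Omega> linear_grad_symbol weak_fo_scale[OF \<Omega> linear_grad_symbol
          weak_fo_diff[OF \<Omega> linear_grad_symbol X_spaceD(1)[OF w[OF that]] X_spaceD(1)[OF w[OF t]]]] X_spaceD(1)[OF d]], symmetric])
  have c: "l2 M (\<lambda>x. ?q (\<lambda>s. Curl \<Omega> (P s)) s x - Curl \<Omega> d3 x) = L2_norm \<Omega> (Curl \<Omega> (\<lambda>x. ?q P s x - d3 x))" if "s \<in> I" for s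
    unfolding M_def
    by (rule L2_norm_Curl[OF \<Omega> weak_fo_diff[OF \<Omega> linear_curl_symbol weak_fo_scale[OF \<Omega> linear_curl_symbol
          weak_fo_diff[OF \<Omega> linear_curl_symbol X_spaceD(2)[OF w[OF that]] X_spaceD(2)[OF w[OF t]]]] X_spaceD(2)[OF d]], symmetric])
  show "l2_deriv M I v d2 t" unfolding l2_deriv_def
    by (rule l2_null_comparison[OF lim]) (simp only: M_def X_norm_ge flip: L2_norm_eq)
  show "l2_deriv M I K d4 t" unfolding l2_deriv_def
    by (rule l2_null_comparison[OF lim]) (simp only: M_def X_norm_ge flip: L2_norm_eq)
  show "l2_deriv M I (\<lambda>s. Grad \<Omega> (u s)) (Grad \<Omega> d1) t" unfolding l2_deriv_def
    by (rule l2_null_comparison[OF lim]) (simp only: g X_norm_ge)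
  show "l2_deriv M I P d3 t" unfolding l2_deriv_def
    by (rule l2_null_comparison[OF lim]) (simp only: M_def X_norm_ge flip: L2_norm_eq)
  show "l2_deriv M I (\<lambda>s. Curl \<Omega> (P s)) (Curl \<Omega> d3) t" unfolding l2_deriv_def
    by (rule l2_null_comparison[OF lim]) (simp only: c X_norm_ge)
qed

section \<open>The energy estimate\<close>

lemma X_has_derivativeD: "X_has_derivative_within \<Omega> I w d t \<Longrightarrow> d \<in> X_space \<Omega>"
  by (simp add: X_has_derivative_within_def)

lemma op_A_spec:
  assumes "w \<in> dom_A \<Omega> \<C> \<H> \<L>"
  shows "op_A \<Omega> \<C> \<H> \<L> w \<in> X_space \<Omega>" "represents_A \<Omega> \<C> \<H> \<L> w (op_A \<Omega> \<C> \<H> \<L> w)"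
proof -
  have "\<exists>z. z \<in> X_space \<Omega> \<and> represents_A \<Omega> \<C> \<H> \<L> w z" using assms by (auto simp: dom_A_def)
  from someI_ex[OF this] show "op_A \<Omega> \<C> \<H> \<L> w \<in> X_space \<Omega>" "represents_A \<Omega> \<C> \<H> \<L> w (op_A \<Omega> \<C> \<H> \<L> w)"
    by (simp_all add: op_A_def)
qed

lemma energy_continuous:
  assumes \<Omega>: "open \<Omega>" "bounded \<Omega>"
    and C: "selfadjoint_coeff (lebesgue_on \<Omega>) (tensor_on_sym \<C>) cC" and H: "selfadjoint_coeff (lebesgue_on \<Omega>) (tensor_on_sym \<H>) cH"
    and L: "selfadjoint_coeff (lebesgue_on \<Omega>) (tensor_on_full \<L>) cL"
    and X: "X_continuous_on \<Omega> I (\<lambda>t. (u t, v t, P t, K t))"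
  shows "continuous_on I (\<lambda>t. energy \<Omega> \<C> \<H> \<L> (u t, v t, P t, K t))"
  unfolding continuous_on_def
proof
  fix t assume t: "t \<in> I"
  let ?M = "lebesgue_on \<Omega>"
  have w: "(u s, v s, P s, K s) \<in> X_space \<Omega>" if "s \<in> I" for s using X that by (auto simp: X_continuous_on_def)
  note c = X_continuous_components[OF \<Omega> X t]
  note m = X_spaceD[OF w]
  have sD: "sqint ?M (\<lambda>x. Grad \<Omega> (u s) x - P s x)" if "s \<in> I" for s
    by (intro sqint_diff m that)
  have D: "((\<lambda>s. l2 ?M (\<lambda>x. (Grad \<Omega> (u s) x - P s x) - (Grad \<Omega> (u t) x - P t x))) \<longlongrightarrow> 0) (at t within I)"
  proof (rule l2_null_comparison)
    show "((\<lambda>s. l2 ?M (\<lambda>x. Grad \<Omega> (u s) x - Grad \<Omega> (u t) x) + l2 ?M (\<lambda>x. P t x - P s x)) \<longlongrightarrow> 0) (at t within I)"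
      using tendsto_add[OF c(3,4)] l2_minus_commute[of ?M "P t"] by simp
    fix s assume s: "s \<in> I"
    show "l2 ?M (\<lambda>x. (Grad \<Omega> (u s) x - P s x) - (Grad \<Omega> (u t) x - P t x))
      \<le> l2 ?M (\<lambda>x. Grad \<Omega> (u s) x - Grad \<Omega> (u t) x) + l2 ?M (\<lambda>x. P t x - P s x)"
      using l2_triangle[OF sqint_diff[OF m(6)[OF s] m(6)[OF t]] sqint_diff[OF m(5)[OF t] m(5)[OF s]]]
      by (simp add: algebra_simps)
  qed
  have 1: "((\<lambda>s. qf ?M (\<lambda>x X. X) (v s) (v s)) \<longlongrightarrow> qf ?M (\<lambda>x X. X) (v t) (v t)) (at t within I)"
    by (rule qf_continuous[OF selfadjoint_coeff_id m(3) t c(1)])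
  have 2: "((\<lambda>s. qf ?M (\<lambda>x X. X) (K s) (K s)) \<longlongrightarrow> qf ?M (\<lambda>x X. X) (K t) (K t)) (at t within I)"
    by (rule qf_continuous[OF selfadjoint_coeff_id m(4) t c(2)])
  note 3 = qf_continuous[where F = "\<lambda>s x. Grad \<Omega> (u s) x - P s x", OF C sD t D]
  note 4 = qf_continuous[where F = P, OF H m(5) t c(4)]
  note 5 = qf_continuous[where F = "\<lambda>s. Curl \<Omega> (P s)", OF L m(7) t c(5)]
  show "((\<lambda>t. energy \<Omega> \<C> \<H> \<L> (u t, v t, P t, K t)) \<longlongrightarrow> energy \<Omega> \<C> \<H> \<L> (u t, v t, P t, K t)) (at t within I)"
    using 1 2 3 4 5 unfolding energy_def prod.case qf_id by (intro tendsto_add)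
qed

text \<open>
  The generator preserves the energy, so only the power of the loads remains. The loads are square integrable
  at every such time, as differences of components of the derivative and of the generator.
\<close>

lemma energy_has_derivative:
  assumes \<Omega>: "open \<Omega>" "bounded \<Omega>"
    and C: "selfadjoint_coeff (lebesgue_on \<Omega>) (tensor_on_sym \<C>) cC" and H: "selfadjoint_coeff (lebesgue_on \<Omega>) (tensor_on_sym \<H>) cH"
    and L: "selfadjoint_coeff (lebesgue_on \<Omega>) (tensor_on_full \<L>) cL"
    and w: "\<And>s. s \<in> I \<Longrightarrow> (u s, v s, P s, K s) \<in> X_space \<Omega>" and t: "t \<in> I"
    and dom: "(u t, v t, P t, K t) \<in> dom_A \<Omega> \<C> \<H> \<L>"
    and X: "X_has_derivative_within \<Omega> I (\<lambda>t. (u t, v t, P t, K t))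
       (state_add (op_A \<Omega> \<C> \<H> \<L> (u t, v t, P t, K t)) (\<lambda>x. 0, f, \<lambda>x. 0, m)) t"
  shows "sqint (lebesgue_on \<Omega>) f" "sqint (lebesgue_on \<Omega>) m"
    "((\<lambda>t. energy \<Omega> \<C> \<H> \<L> (u t, v t, P t, K t)) has_real_derivative
       2 * (ip (lebesgue_on \<Omega>) f (v t) + ip (lebesgue_on \<Omega>) m (K t))) (at t within I)"
proof -
  let ?M = "lebesgue_on \<Omega>"
  obtain z1 z2 z3 z4 where z: "op_A \<Omega> \<C> \<H> \<L> (u t, v t, P t, K t) = (z1, z2, z3, z4)"
    by (metis prod.exhaust)
  have zX: "(z1, z2, z3, z4) \<in> X_space \<Omega>" and A: "represents_A \<Omega> \<C> \<H> \<L> (u t, v t, P t, K t) (z1, z2, z3, z4)"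
    using op_A_spec[OF dom] unfolding z by auto
  have eqs: "z1 = v t" "z3 = K t" using A by (auto simp: represents_A_def)
  define d2 d4 where "d2 = (\<lambda>x. z2 x + f x)" and "d4 = (\<lambda>x. z4 x + m x)"
  have X': "X_has_derivative_within \<Omega> I (\<lambda>t. (u t, v t, P t, K t)) (v t, d2, K t, d4) t"
    using X unfolding z eqs by (simp add: state_add_def d2_def d4_def)
  have dX: "(v t, d2, K t, d4) \<in> X_space \<Omega>" using X_has_derivativeD[OF X'] .
  have sz: "sqint ?M z2" "sqint ?M z4" using X_spaceD(3,4)[OF zX] .
  have sd: "sqint ?M d2" "sqint ?M d4" using X_spaceD(3,4)[OF dX] .
  show sf: "sqint ?M f" using sqint_diff[OF sd(1) sz(1)] by (simp add: d2_def)
  show sm: "sqint ?M m" using sqint_diff[OF sd(2) sz(2)] by (simp add: d4_def)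
  note s = X_spaceD[OF w]
  have sGP: "sqint ?M (\<lambda>x. Grad \<Omega> (u s) x - P s x)" if "s \<in> I" for s by (intro sqint_diff s that)
  have sGP': "sqint ?M (\<lambda>x. Grad \<Omega> (v t) x - K t x)" by (intro sqint_diff X_spaceD[OF dX])
  note d = X_derivative_components[OF \<Omega> w X' t]
  have dGP: "l2_deriv ?M I (\<lambda>s x. Grad \<Omega> (u s) x - P s x) (\<lambda>x. Grad \<Omega> (v t) x - K t x) t"
    by (rule l2_deriv_diff[OF s(6) s(5) t X_spaceD(6,5)[OF dX] d(3,4)])
  note 1 = qf_has_derivative[OF selfadjoint_coeff_id s(3) t sd(1) d(1), unfolded qf_id]
  note 2 = qf_has_derivative[OF selfadjoint_coeff_id s(4) t sd(2) d(2), unfolded qf_id]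
  note 3 = qf_has_derivative[where F = "\<lambda>s x. Grad \<Omega> (u s) x - P s x", OF C sGP t sGP' dGP]
  note 4 = qf_has_derivative[where F = P, OF H s(5) t X_spaceD(5)[OF dX] d(4)]
  note 5 = qf_has_derivative[where F = "\<lambda>s. Curl \<Omega> (P s)", OF L s(7) t X_spaceD(7)[OF dX] d(5)]
  have "((\<lambda>t. energy \<Omega> \<C> \<H> \<L> (u t, v t, P t, K t)) has_real_derivative
     2 * ip ?M d2 (v t) + 2 * ip ?M d4 (K t)
     + 2 * qf ?M (tensor_on_sym \<C>) (\<lambda>x. Grad \<Omega> (v t) x - K t x) (\<lambda>x. Grad \<Omega> (u t) x - P t x)
     + 2 * qf ?M (tensor_on_sym \<H>) (K t) (P t) + 2 * qf ?M (tensor_on_full \<L>) (Curl \<Omega> (K t)) (Curl \<Omega> (P t))) (at t within I)"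
    unfolding energy_def prod.case by (intro DERIV_add 1 2 3 4 5)
  moreover have "ip ?M d2 (v t) = ip ?M z2 (v t) + ip ?M f (v t)"
    unfolding d2_def by (rule ip_add[OF sz(1) sf s(3)[OF t]])
  moreover have "ip ?M d4 (K t) = ip ?M z4 (K t) + ip ?M m (K t)"
    unfolding d4_def by (rule ip_add[OF sz(2) sm s(4)[OF t]])
  moreover note generator_conserves_energy[OF \<Omega> C H L w[OF t] zX A]
  ultimately show "((\<lambda>t. energy \<Omega> \<C> \<H> \<L> (u t, v t, P t, K t)) has_real_derivative
       2 * (ip ?M f (v t) + ip ?M m (K t))) (at t within I)"
    by (elim DERIV_cong) (simp add: algebra_simps)
qed

lemma qf_zero_AE:
  assumes a: "selfadjoint_coeff M a c" and F: "sqint M F" and z: "AE x in M. F x = 0"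
  shows "qf M a F F = 0"
proof -
  have "ip M F F = ip M (\<lambda>x. 0) F" by (rule ip_cong_AE[OF F sqint_zero F z])
  then have "l2 M F = 0" using l2_power2[of M F] by (simp add: ip_def)
  then show ?thesis using qf_bound[OF a F F] by simp
qed

lemma energy_zero:
  assumes \<Omega>: "open \<Omega>" "bounded \<Omega>"
    and C: "selfadjoint_coeff (lebesgue_on \<Omega>) (tensor_on_sym \<C>) cC" and H: "selfadjoint_coeff (lebesgue_on \<Omega>) (tensor_on_sym \<H>) cH"
    and L: "selfadjoint_coeff (lebesgue_on \<Omega>) (tensor_on_full \<L>) cL"
    and w: "(u, v, P, K) \<in> X_space \<Omega>"
    and z: "AE x in lebesgue_on \<Omega>. u x = 0 \<and> v x = 0 \<and> P x = 0 \<and> K x = 0"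
  shows "energy \<Omega> \<C> \<H> \<L> (u, v, P, K) = 0"
proof -
  let ?M = "lebesgue_on \<Omega>"
  note s = X_spaceD[OF w]
  have AEs: "AE x in ?M. u x = 0" "AE x in ?M. v x = 0" "AE x in ?M. P x = 0" "AE x in ?M. K x = 0"
    using z by (auto elim: eventually_mono)
  have zg: "weak_fo \<Omega> grad_symbol (\<lambda>x. 0) (\<lambda>x. 0)" using weak_fo_scale[OF \<Omega> linear_grad_symbol s(1), of 0] by simp
  have zc: "weak_fo \<Omega> curl_symbol (\<lambda>x. 0) (\<lambda>x. 0)" using weak_fo_scale[OF \<Omega> linear_curl_symbol s(2), of 0] by simp
  have G: "AE x in ?M. Grad \<Omega> u x = 0" by (rule weak_fo_unique[OF \<Omega> s(1) zg AEs(1)])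
  have Q: "AE x in ?M. Curl \<Omega> P x = 0" by (rule weak_fo_unique[OF \<Omega> s(2) zc AEs(3)])
  have GP: "AE x in ?M. Grad \<Omega> u x - P x = 0" using G AEs(3) by eventually_elim simp
  show ?thesis
    unfolding energy_def prod.case
    using qf_zero_AE[OF selfadjoint_coeff_id s(3) AEs(2)] qf_zero_AE[OF selfadjoint_coeff_id s(4) AEs(4)]
      qf_zero_AE[OF C sqint_diff[OF s(6,5)] GP] qf_zero_AE[OF H s(5) AEs(3)] qf_zero_AE[OF L s(7) Q]
    by (simp add: qf_id)
qed

lemma Cauchy_Schwarz_pairs:
  fixes a b c d e :: real
  assumes "c\<^sup>2 + d\<^sup>2 \<le> e" "0 \<le> a" "0 \<le> b" "0 \<le> c" "0 \<le> d"
  shows "a * c + b * d \<le> sqrt (a\<^sup>2 + b\<^sup>2) * sqrt e"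
proof -
  have "(a * c + b * d)\<^sup>2 \<le> (a\<^sup>2 + b\<^sup>2) * (c\<^sup>2 + d\<^sup>2)"
    using zero_le_power2[of "a * d - b * c"] by (simp add: power2_eq_square algebra_simps)
  also have "\<dots> \<le> (a\<^sup>2 + b\<^sup>2) * e" using assms(1) by (intro mult_left_mono) auto
  finally show ?thesis by (simp add: real_le_rsqrt flip: real_sqrt_mult)
qed

lemma L1_L2_norms_integrable:
  assumes "f \<in> L1_L2 T \<Omega>" "m \<in> L1_L2 T \<Omega>"
  shows "integrable (lebesgue_on {0..T}) (\<lambda>s. sqrt ((L2_norm \<Omega> (f s))\<^sup>2 + (L2_norm \<Omega> (m s))\<^sup>2))"
proof (rule Bochner_Integration.integrable_bound)
  have i: "integrable (lebesgue_on {0..T}) (\<lambda>s. L2_norm \<Omega> (f s))" "integrable (lebesgue_on {0..T}) (\<lambda>s. L2_norm \<Omega> (m s))"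
    using assms by (auto simp: L1_L2_def)
  show "integrable (lebesgue_on {0..T}) (\<lambda>s. \<bar>L2_norm \<Omega> (f s)\<bar> + \<bar>L2_norm \<Omega> (m s)\<bar>)" using i by simp
  show "(\<lambda>s. sqrt ((L2_norm \<Omega> (f s))\<^sup>2 + (L2_norm \<Omega> (m s))\<^sup>2)) \<in> borel_measurable (lebesgue_on {0..T})"
    using i[THEN borel_measurable_integrable] by measurable
  show "AE s in lebesgue_on {0..T}. norm (sqrt ((L2_norm \<Omega> (f s))\<^sup>2 + (L2_norm \<Omega> (m s))\<^sup>2))
      \<le> norm (\<bar>L2_norm \<Omega> (f s)\<bar> + \<bar>L2_norm \<Omega> (m s)\<bar>)"
    using sqrt_sum_squares_le_sum_abs by (intro AE_I2) simp
qed

text \<open>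
  At time zero the data need not be square integrable, and the two expressions for their norm may differ
  there.
\<close>

lemma integral_cong_off_point:
  fixes g h :: "real \<Rightarrow> real"
  assumes h: "integrable (lebesgue_on {0..t}) h" and eq: "\<And>s. s \<in> {0<..t} \<Longrightarrow> g s = h s"
  shows "(LINT s|lebesgue_on {0..t}. g s) = (LINT s|lebesgue_on {0..t}. h s)"
proof -
  let ?M = "lebesgue_on {0..t}" and ?k = "\<lambda>s. if s = 0 then g 0 else h s"
  have "(LINT s|?M. g s) = (LINT s|?M. ?k s)"
    by (rule Bochner_Integration.integral_cong) (use eq in auto)
  also have "\<dots> = (LINT s|?M. h s)"
  proof (rule integral_cong_AE)
    have "{0::real} \<in> sets lebesgue" by simp
    then have "{x \<in> space ?M. x = 0} \<in> sets ?M"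
      by (auto simp: sets_restrict_space image_iff intro!: bexI[of _ "{0}"])
    then show "?k \<in> borel_measurable ?M" using h by (intro measurable_If) auto
    have "AE s in lebesgue. s \<noteq> (0::real)" by (rule AE_completion[OF AE_lborel_singleton])
    then have "AE s in lebesgue. s \<in> {0..t} \<longrightarrow> ?k s = h s" by eventually_elim simp
    then show "AE s in ?M. ?k s = h s" by (simp add: AE_restrict_space_iff)
  qed (use h in auto)
  finally show ?thesis .
qed

theorem theorem5p5:
  fixes \<Omega> :: "(real^3) set" and \<C> \<H> \<L> :: "real^3 \<Rightarrow> tensor4"
  assumes "admissible_domain \<Omega>" and "admissible_coefficients \<Omega> \<C> \<H> \<L>"
  shows "\<exists>a::real. a > 0 \<and>
    (\<forall>(T::real) f M u ut P Pt.
       T > 0 \<longrightarrow> f \<in> L1_L2 T \<Omega> \<longrightarrow> M \<in> L1_L2 T \<Omega> \<longrightarrow>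
       is_solution \<Omega> \<C> \<H> \<L> T f M (\<lambda>x. 0) (\<lambda>x. 0) (\<lambda>x. 0) (\<lambda>x. 0) u ut P Pt \<longrightarrow>
       (\<forall>t\<in>{0..T}.
          sqrt a * sqrt ((L2_norm \<Omega> (ut t))\<^sup>2 + (L2_norm \<Omega> (Pt t))\<^sup>2
                         + (L2_norm \<Omega> (Grad \<Omega> (u t)))\<^sup>2 + (L2_norm \<Omega> (P t))\<^sup>2
                         + (L2_norm \<Omega> (Curl \<Omega> (P t)))\<^sup>2)
          \<le> (1/2) * (LINT s|lebesgue_on {0..t}.
                sqrt (LINT x|lebesgue_on \<Omega>. ((norm (f s x))\<^sup>2 + (norm (M s x))\<^sup>2)))))"
proof -
  have \<Omega>: "open \<Omega>" "bounded \<Omega>" using assms(1) by (auto simp: admissible_domain_def)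
  let ?M = "lebesgue_on \<Omega>"
  obtain k cC cH cL where k: "k \<ge> 0"
    and co: "selfadjoint_coeff ?M (tensor_on_sym \<C>) cC" "selfadjoint_coeff ?M (tensor_on_sym \<H>) cH" "selfadjoint_coeff ?M (tensor_on_full \<L>) cL"
    and en: "\<And>u v P K. (u, v, P, K) \<in> X_space \<Omega> \<Longrightarrow>
       (L2_norm \<Omega> v)\<^sup>2 + (L2_norm \<Omega> K)\<^sup>2 \<le> energy \<Omega> \<C> \<H> \<L> (u, v, P, K) \<and>
       (L2_norm \<Omega> v)\<^sup>2 + (L2_norm \<Omega> K)\<^sup>2 + (L2_norm \<Omega> (Grad \<Omega> u))\<^sup>2 + (L2_norm \<Omega> P)\<^sup>2 + (L2_norm \<Omega> (Curl \<Omega> P))\<^sup>2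
         \<le> (1 + k) * energy \<Omega> \<C> \<H> \<L> (u, v, P, K)"
    by (rule energy_coercive[OF \<Omega> assms(2)]) (rule that)
  \<comment> \<open>The factor \<open>1 / 4\<close> is the square of the \<open>1 / 2\<close> in front of the integral.\<close>
  define a where "a = 1 / (4 * (1 + k))"
  have a: "a > 0" "a * (1 + k) = 1 / 4" using k by (auto simp: a_def)
  show ?thesis
  proof (intro exI[of _ a] conjI allI impI ballI)
    show "a > 0" by (rule a)
    fix T :: real and f m u v P K t
    assume T: "T > 0" and f: "f \<in> L1_L2 T \<Omega>" and m: "m \<in> L1_L2 T \<Omega>"
      and sol: "is_solution \<Omega> \<C> \<H> \<L> T f m (\<lambda>x. 0) (\<lambda>x. 0) (\<lambda>x. 0) (\<lambda>x. 0) u v P K"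
      and t: "t \<in> {0..T}"
    let ?w = "\<lambda>t. (u t, v t, P t, K t)"
    have cont: "X_continuous_on \<Omega> {0..T} ?w"
      and dom: "\<And>t. t \<in> {0<..T} \<Longrightarrow> ?w t \<in> dom_A \<Omega> \<C> \<H> \<L>"
      and der: "\<And>t. t \<in> {0<..T} \<Longrightarrow> X_has_derivative_within \<Omega> {0..T} ?w
         (state_add (op_A \<Omega> \<C> \<H> \<L> (?w t)) (\<lambda>x. 0, f t, \<lambda>x. 0, m t)) t"
      and init: "AE x in ?M. u 0 x = 0 \<and> v 0 x = 0 \<and> P 0 x = 0 \<and> K 0 x = 0"
      using sol by (auto simp: is_solution_def Let_def)
    have w: "?w s \<in> X_space \<Omega>" if "s \<in> {0..T}" for s using cont that by (simp add: X_continuous_on_def)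
    define E where "E = (\<lambda>t. energy \<Omega> \<C> \<H> \<L> (?w t))"
    define g where "g = (\<lambda>s. sqrt ((L2_norm \<Omega> (f s))\<^sup>2 + (L2_norm \<Omega> (m s))\<^sup>2))"
    have gi: "integrable (lebesgue_on {0..T}) g" unfolding g_def by (rule L1_L2_norms_integrable[OF f m])
    have sfm: "sqint ?M (f s)" "sqint ?M (m s)"
      and dE: "(E has_real_derivative 2 * (ip ?M (f s) (v s) + ip ?M (m s) (K s))) (at s within {0..T})"
      if "s \<in> {0<..T}" for s
      unfolding E_def
      using energy_has_derivative[OF \<Omega> co w _ dom[OF that] der[OF that]] that by auto
    have "sqrt (E t) \<le> (LINT s|lebesgue_on {0..t}. g s)"
    proof (rule sqrt_growth[where E' = "\<lambda>s. 2 * (ip ?M (f s) (v s) + ip ?M (m s) (K s))"])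
      show "continuous_on {0..T} E" unfolding E_def by (rule energy_continuous[OF \<Omega> co cont])
      show "0 \<le> E s" if "s \<in> {0..T}" for s
        unfolding E_def by (rule order_trans[OF _ conjunct1[OF en[OF w[OF that]]]]) simp
      show "E 0 = 0" unfolding E_def using T by (intro energy_zero[OF \<Omega> co w init]) auto
      show "2 * (ip ?M (f s) (v s) + ip ?M (m s) (K s)) \<le> 2 * g s * sqrt (E s)" if s: "s \<in> {0<..T}" for s
      proof -
        have sw: "?w s \<in> X_space \<Omega>" using w s by auto
        have "ip ?M (f s) (v s) + ip ?M (m s) (K s) \<le> l2 ?M (f s) * l2 ?M (v s) + l2 ?M (m s) * l2 ?M (K s)"
          using ip_Cauchy_Schwarz[OF sfm(1)[OF s] X_spaceD(3)[OF sw]]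
            ip_Cauchy_Schwarz[OF sfm(2)[OF s] X_spaceD(4)[OF sw]] by linarith
        also have "\<dots> \<le> g s * sqrt (E s)"
          unfolding g_def E_def L2_norm_eq
          by (rule Cauchy_Schwarz_pairs) (use en[OF sw] in \<open>auto simp: L2_norm_eq l2_nonneg\<close>)
        finally show ?thesis by simp
      qed
    qed (use dE gi t in \<open>auto simp: g_def\<close>)
    also have "(LINT s|lebesgue_on {0..t}. g s) = (LINT s|lebesgue_on {0..t}.
        sqrt (LINT x|?M. ((norm (f s x))\<^sup>2 + (norm (m s x))\<^sup>2)))" (is "_ = ?I")
    proof (rule integral_cong_off_point[symmetric])
      show "integrable (lebesgue_on {0..t}) g"
        by (rule integrable_lebesgue_on_subset[OF gi]) (use t in auto)
      fix s assume "s \<in> {0<..t}"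
      then have s: "s \<in> {0<..T}" using t by auto
      have "(LINT x|?M. ((norm (f s x))\<^sup>2 + (norm (m s x))\<^sup>2)) = (LINT x|?M. (norm (f s x))\<^sup>2) + (LINT x|?M. (norm (m s x))\<^sup>2)"
        by (rule Bochner_Integration.integral_add) (use sfm[OF s] in \<open>auto simp: sqint_def\<close>)
      then show "sqrt (LINT x|?M. ((norm (f s x))\<^sup>2 + (norm (m s x))\<^sup>2)) = g s"
        by (simp add: g_def L2_norm_def)
    qed
    finally have I: "sqrt (E t) \<le> ?I" .
    let ?N = "(L2_norm \<Omega> (v t))\<^sup>2 + (L2_norm \<Omega> (K t))\<^sup>2 + (L2_norm \<Omega> (Grad \<Omega> (u t)))\<^sup>2 + (L2_norm \<Omega> (P t))\<^sup>2
       + (L2_norm \<Omega> (Curl \<Omega> (P t)))\<^sup>2"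
    have "a * ?N \<le> a * ((1 + k) * E t)"
      using conjunct2[OF en[OF w[OF t]]] a unfolding E_def by (intro mult_left_mono) auto
    also have "\<dots> = (1/2)\<^sup>2 * E t" unfolding mult.assoc[symmetric] a(2) by (simp add: power2_eq_square)
    finally have "sqrt (a * ?N) \<le> sqrt ((1/2)\<^sup>2 * E t)" by (rule real_sqrt_le_mono)
    then have "sqrt a * sqrt ?N \<le> (1/2) * sqrt (E t)" by (simp add: real_sqrt_mult)
    then show "sqrt a * sqrt ?N \<le> (1/2) * ?I" using I by linarith
  qed
qed

end
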